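(* Let $H:\mathbf{R}_+\to(0,1)$ be $\beta$-Hölder-continuous with $\beta>0$ and such that $H(t)<\beta$ for all $t\in\mathbf{R}_+$. Let $X=\{X_t;\ t\in\mathbf{R}_+\}$ be the generalized Weierstrass function $$X_t=\sum_{j=1}^{\infty}Z_j\,\lambda^{-jH(t)}\sin(\lambda^jt+\theta_j),\qquad t\in\mathbf{R}_+,$$ where $\lambda\ge2$, $(Z_j)_{j\ge1}$ is a sequence of i.i.d. $\mathcal{N}(0,1)$ random variables, and $(\theta_j)_{j\ge1}$ is a sequence of random variables uniformly distributed on $[0,2\pi)$, independent of $(Z_j)_{j\ge1}$. Then the deterministic local Hölder exponent and the deterministic local sub-exponent of $X$ are given by $$\forall t_0\in\mathbf{R}_+,\quad \widetilde{\alpha}_X(t_0)=\underline{\alpha}_X(t_0)=H(t_0).$$ Consequently, with probability one, for all $t_0\in\mathbf{R}_+$, $$\lim_{\rho\to0}\dim_{\mathcal H}(\mathrm{Gr}_X(B(t_0,\rho)))=2-H(t_0),\qquad \lim_{\rho\to0}\dim_{\mathcal H}(\mathrm{Rg}_X(B(t_0,\rho)))=1.$$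
   Context: $\mathbf{R}_+=[0,\infty)$; $B(t_0,\rho)$ is the ball (interval) of $\mathbf{R}_+$ with center $t_0$ and radius $\rho$. The $\theta_j$'s are not assumed to be independent of one another. The deterministic local Hölder exponent and the deterministic local sub-exponent of $X$ at $t_0$ are $$\widetilde{\alpha}_X(t_0)=\sup\Big\{\alpha>0:\ \lim_{\rho\to0}\sup_{s,t\in B(t_0,\rho)}\frac{\mathbf{E}[|X_t-X_s|^2]}{|t-s|^{2\alpha}}<+\infty\Big\},$$ $$\underline{\alpha}_X(t_0)=\inf\Big\{\alpha>0:\ \lim_{\rho\to0}\inf_{s,t\in B(t_0,\rho)}\frac{\mathbf{E}[|X_t-X_s|^2]}{|t-s|^{2\alpha}}=+\infty\Big\}$$ (sup and inf over $s\ne t$). $\mathrm{Rg}_X(A)=\{X_t;\ t\in A\}$ and $\mathrm{Gr}_X(A)=\{(t,X_t);\ t\in A\}$ are the range and graph of $X$ over $A$, and $\dim_{\mathcal H}$ is Hausdorff dimension. "With probability one, for all $t_0$" means on a single event of probability one, simultaneously for all $t_0$. *)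

theory Defs
  imports "HOL-Probability.Probability"
begin

section \<open>Hoelder continuity\<close>

definition holder_continuous_on :: "real \<Rightarrow> 'a::metric_space set \<Rightarrow> ('a \<Rightarrow> 'b::metric_space) \<Rightarrow> bool" where
  "holder_continuous_on \<beta> S f \<longleftrightarrow>
     (\<exists>C. \<forall>s\<in>S. \<forall>t\<in>S. dist (f s) (f t) \<le> C * dist s t powr \<beta>)"


section \<open>Hausdorff dimension\<close>

text \<open>The convention for exponent 0 is that a nonempty set has weight 1. It has to be
  spelled out because \<open>0 powr 0 = 0\<close> in Isabelle/HOL.\<close>

definition diameter_powr :: "real \<Rightarrow> 'a::metric_space set \<Rightarrow> ennreal" where
  "diameter_powr s U =
     (if U = {} then 0 else if s = 0 then 1 else ennreal (diameter U powr s))"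

text \<open>Boundedness of the covering sets is required explicitly: \<^const>\<open>diameter\<close> is a real
  number and is unspecified on unbounded sets. Finite covers are included, since the
  sets \<open>U i\<close> may be empty.\<close>

definition hausdorff_premeasure :: "real \<Rightarrow> real \<Rightarrow> 'a::metric_space set \<Rightarrow> ennreal" where
  "hausdorff_premeasure s \<delta> A =
     (INF U\<in>{U :: nat \<Rightarrow> 'a set. A \<subseteq> (\<Union>i. U i) \<and> (\<forall>i. bounded (U i) \<and> diameter (U i) \<le> \<delta>)}.
        \<Sum>i. diameter_powr s (U i))"

definition hausdorff_measure :: "real \<Rightarrow> 'a::metric_space set \<Rightarrow> ennreal" where
  "hausdorff_measure s A = (SUP \<delta>\<in>{0<..}. hausdorff_premeasure s \<delta> A)"

definition hausdorff_dim :: "'a::metric_space set \<Rightarrow> ennreal" where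
  "hausdorff_dim A = Inf {ennreal s |s. 0 \<le> s \<and> hausdorff_measure s A = 0}"


section \<open>Local exponents of a process indexed by the half-line\<close>

text \<open>A process is a function \<open>X :: real \<Rightarrow> 'a \<Rightarrow> real\<close> of which only the values at times
  \<open>t \<ge> 0\<close> matter; balls are therefore taken relative to the half-line.\<close>

definition half_line_ball :: "real \<Rightarrow> real \<Rightarrow> real set" where
  "half_line_ball t\<^sub>0 \<rho> = ball t\<^sub>0 \<rho> \<inter> {0..}"

text \<open>The expectation of the nonnegative variable is the Lebesgue integral with values in
  \<open>[0, \<infinity>]\<close>; the Bochner integral would be 0 on a non-integrable increment.\<close>

definition increment_ratio :: "'a measure \<Rightarrow> (real \<Rightarrow> 'a \<Rightarrow> real) \<Rightarrow> real \<Rightarrow> real \<Rightarrow> real \<Rightarrow> ennreal" where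
  "increment_ratio M X \<alpha> s t =
     (\<integral>\<^sup>+\<omega>. ennreal (\<bar>X t \<omega> - X s \<omega>\<bar>\<^sup>2) \<partial>M) / ennreal (\<bar>t - s\<bar> powr (2 * \<alpha>))"

definition distinct_pairs :: "real set \<Rightarrow> (real \<times> real) set" where
  "distinct_pairs B = {(s, t). s \<in> B \<and> t \<in> B \<and> s \<noteq> t}"

definition sup_increment_ratio ::
  "'a measure \<Rightarrow> (real \<Rightarrow> 'a \<Rightarrow> real) \<Rightarrow> real \<Rightarrow> real \<Rightarrow> real \<Rightarrow> ennreal" where
  "sup_increment_ratio M X \<alpha> t\<^sub>0 \<rho> =
     (SUP (s, t)\<in>distinct_pairs (half_line_ball t\<^sub>0 \<rho>). increment_ratio M X \<alpha> s t)"

definition inf_increment_ratio ::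
  "'a measure \<Rightarrow> (real \<Rightarrow> 'a \<Rightarrow> real) \<Rightarrow> real \<Rightarrow> real \<Rightarrow> real \<Rightarrow> ennreal" where
  "inf_increment_ratio M X \<alpha> t\<^sub>0 \<rho> =
     (INF (s, t)\<in>distinct_pairs (half_line_ball t\<^sub>0 \<rho>). increment_ratio M X \<alpha> s t)"

text \<open>Both limits below always exist in \<open>[0, \<infinity>]\<close>, by monotonicity in the radius
  (see \<open>tendsto_sup_increment_ratio\<close> and \<open>tendsto_inf_increment_ratio\<close>). The exponents
  take values in \<open>[0, \<infinity>]\<close>, with \<open>Sup {} = 0\<close> and \<open>Inf {} = \<infinity>\<close>.\<close>

definition local_holder_exponent :: "'a measure \<Rightarrow> (real \<Rightarrow> 'a \<Rightarrow> real) \<Rightarrow> real \<Rightarrow> ennreal" where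
  "local_holder_exponent M X t\<^sub>0 =
     Sup {ennreal \<alpha> |\<alpha>. \<alpha> > 0 \<and> Lim (at_right 0) (sup_increment_ratio M X \<alpha> t\<^sub>0) < \<infinity>}"

definition local_sub_exponent :: "'a measure \<Rightarrow> (real \<Rightarrow> 'a \<Rightarrow> real) \<Rightarrow> real \<Rightarrow> ennreal" where
  "local_sub_exponent M X t\<^sub>0 =
     Inf {ennreal \<alpha> |\<alpha>. \<alpha> > 0 \<and> Lim (at_right 0) (inf_increment_ratio M X \<alpha> t\<^sub>0) = \<infinity>}"

lemma distinct_pairs_half_line_ball_mono:
  "\<rho> \<le> \<rho>' \<Longrightarrow> distinct_pairs (half_line_ball t\<^sub>0 \<rho>) \<subseteq> distinct_pairs (half_line_ball t\<^sub>0 \<rho>')"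
  by (auto simp: distinct_pairs_def half_line_ball_def)

lemma tendsto_sup_increment_ratio:
  "(sup_increment_ratio M X \<alpha> t\<^sub>0 \<longlongrightarrow> (INF \<rho>\<in>{0<..}. sup_increment_ratio M X \<alpha> t\<^sub>0 \<rho>)) (at_right 0)"
proof -
  have mono: "sup_increment_ratio M X \<alpha> t\<^sub>0 \<rho> \<le> sup_increment_ratio M X \<alpha> t\<^sub>0 \<rho>'" if "\<rho> \<le> \<rho>'" for \<rho> \<rho>'
    unfolding sup_increment_ratio_def
    by (intro SUP_subset_mono distinct_pairs_half_line_ball_mono that order_refl)
  show ?thesis
  proof (rule order_tendstoI)
    fix a assume "a < (INF \<rho>\<in>{0<..}. sup_increment_ratio M X \<alpha> t\<^sub>0 \<rho>)"
    then show "\<forall>\<^sub>F \<rho> in at_right 0. a < sup_increment_ratio M X \<alpha> t\<^sub>0 \<rho>"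
      by (intro eventually_at_rightI[of 0 1]) (auto intro: less_le_trans INF_lower)
  next
    fix a assume "(INF \<rho>\<in>{0<..}. sup_increment_ratio M X \<alpha> t\<^sub>0 \<rho>) < a"
    then obtain r where "r > 0" "sup_increment_ratio M X \<alpha> t\<^sub>0 r < a"
      by (auto simp: INF_less_iff)
    then show "\<forall>\<^sub>F \<rho> in at_right 0. sup_increment_ratio M X \<alpha> t\<^sub>0 \<rho> < a"
      by (intro eventually_at_rightI[of 0 r]) (auto dest: le_less_trans[OF mono[OF less_imp_le]])
  qed
qed

lemma tendsto_inf_increment_ratio:
  "(inf_increment_ratio M X \<alpha> t\<^sub>0 \<longlongrightarrow> (SUP \<rho>\<in>{0<..}. inf_increment_ratio M X \<alpha> t\<^sub>0 \<rho>)) (at_right 0)"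
proof -
  have mono: "inf_increment_ratio M X \<alpha> t\<^sub>0 \<rho>' \<le> inf_increment_ratio M X \<alpha> t\<^sub>0 \<rho>" if "\<rho> \<le> \<rho>'" for \<rho> \<rho>'
    unfolding inf_increment_ratio_def
    by (intro INF_superset_mono distinct_pairs_half_line_ball_mono that order_refl)
  show ?thesis
  proof (rule order_tendstoI)
    fix a assume "(SUP \<rho>\<in>{0<..}. inf_increment_ratio M X \<alpha> t\<^sub>0 \<rho>) < a"
    then show "\<forall>\<^sub>F \<rho> in at_right 0. inf_increment_ratio M X \<alpha> t\<^sub>0 \<rho> < a"
      by (intro eventually_at_rightI[of 0 1]) (auto intro: le_less_trans[OF SUP_upper, rotated])
  next
    fix a assume "a < (SUP \<rho>\<in>{0<..}. inf_increment_ratio M X \<alpha> t\<^sub>0 \<rho>)"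
    then obtain r where "r > 0" "a < inf_increment_ratio M X \<alpha> t\<^sub>0 r"
      by (auto simp: less_SUP_iff)
    then show "\<forall>\<^sub>F \<rho> in at_right 0. a < inf_increment_ratio M X \<alpha> t\<^sub>0 \<rho>"
      by (intro eventually_at_rightI[of 0 r]) (auto intro: less_le_trans[OF _ mono])
  qed
qed


section \<open>Range, graph and the generalized Weierstrass function\<close>

definition path_range :: "(real \<Rightarrow> 'a \<Rightarrow> real) \<Rightarrow> 'a \<Rightarrow> real set \<Rightarrow> real set" where
  "path_range X \<omega> A = {X t \<omega> |t. t \<in> A}"

definition path_graph :: "(real \<Rightarrow> 'a \<Rightarrow> real) \<Rightarrow> 'a \<Rightarrow> real set \<Rightarrow> (real \<times> real) set" where
  "path_graph X \<omega> A = {(t, X t \<omega>) |t. t \<in> A}"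

text \<open>The sequences \<open>Z\<close> and \<open>\<theta>\<close> are indexed by \<open>j \<ge> 1\<close>, while infinite sums start at 0;
  hence the \<open>Suc\<close>.\<close>

definition weierstrass_process ::
  "real \<Rightarrow> (real \<Rightarrow> real) \<Rightarrow> (nat \<Rightarrow> 'a \<Rightarrow> real) \<Rightarrow> (nat \<Rightarrow> 'a \<Rightarrow> real) \<Rightarrow> real \<Rightarrow> 'a \<Rightarrow> real" where
  "weierstrass_process l H Z \<theta> t \<omega> =
     (\<Sum>j. Z (Suc j) \<omega> * l powr (- real (Suc j) * H t) * sin (l ^ Suc j * t + \<theta> (Suc j) \<omega>))"

end

(*
  Fix s and t, and let j be the scale with l^j |t - s| comparable to 1. The j-th term contributes
  b(theta_j) Z_j to X_t - X_s, where b is a sine wave in theta_j of amplitude at least c |t - s|^h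
  (h an upper bound for H near s and t), and Z_j is independent of all the phases and of the
  other Z_i. Hence a single term yields the lower bound for the second moment. Integrating first
  over Z_j and then over theta_j, it also bounds
  E[max(|t - s|, |X_t - X_s|)^(-g)] by a constant times |t - s|^(-k) with k < 1 whenever
  1 < g < 2 - h, so almost every path has finite g-energy and its graph has dimension at least g.
  The joint law of the phases plays no role. In the other direction |Z_j| <= K j almost surely, so
  the series is estimated term by term: paths are a-Hoelder for every a below the local values of
  H, which gives dimension at most 2 - a. Since a graph of dimension greater than 1 is not that of
  a constant function, the range contains an interval. All of this is needed on countably many
  intervals only, by monotonicity of the dimension and continuity of H.
*)

theory Submission
  imports Defs
begin

section \<open>Bounds on the Hausdorff dimension\<close>

text \<open>The Gaussian density of the chosen term yields a factor \<open>1 / |a|\<close>, where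
  \<open>a = A * sin (u + \<phi>)\<close> and \<open>u\<close> is the phase, and this factor is not
  integrable in \<open>u\<close>. So only a power \<open>\<eta> < 1\<close> of the gain is kept, the
  trivial bound \<open>r powr - \<gamma>\<close> supplying the rest, with \<open>r\<close> the time
  distance. As \<open>A\<close> is at least of order \<open>r powr h\<close>, the outcome is of
  order \<open>r powr - (\<gamma> - \<eta> + h * \<eta>)\<close>. This is integrable in time exactly
  when \<open>\<eta> > (\<gamma> - 1) / (1 - h)\<close>, and for \<open>\<gamma> > 1\<close> such an
  \<open>\<eta> < 1\<close> exists exactly when \<open>\<gamma> < 2 - h\<close>, so the truncation
  costs nothing in the dimension. The variability of \<open>H\<close> enters in two ways. The
  squared amplitude of \<open>p * sin (x + u) - q * sin (y + u)\<close> is \<open>(p - q)^2\<close>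
  plus a term that does not degenerate at the chosen scale, so unequal amplitudes can only help the
  lower bounds. In the upper bounds they cost \<open>j * |t - s| powr \<beta>\<close> times the
  geometric decay. This is harmless, since only exponents below \<open>H\<close>, hence below
  \<open>\<beta>\<close>, are used.\<close>

lemma hausdorff_dim_mono:
  assumes "A \<subseteq> B"
  shows "hausdorff_dim A \<le> hausdorff_dim B"
proof -
  have "hausdorff_premeasure s \<delta> A \<le> hausdorff_premeasure s \<delta> B" for s \<delta>
    unfolding hausdorff_premeasure_def using assms by (intro INF_superset_mono) auto
  then have "hausdorff_measure s A \<le> hausdorff_measure s B" for s
    unfolding hausdorff_measure_def by (intro SUP_mono) auto
  then have "hausdorff_measure s A = 0" if "hausdorff_measure s B = 0" for s
    using that by (metis le_zero_eq)
  then show ?thesis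
    unfolding hausdorff_dim_def by (intro Inf_superset_mono) auto
qed

section \<open>Upper bounds by counting the cells of a grid\<close>

lemma diameter_le_of_dist:
  fixes S :: "'a::metric_space set"
  assumes "0 \<le> d" "\<And>x y. x \<in> S \<Longrightarrow> y \<in> S \<Longrightarrow> dist x y \<le> d"
  shows "diameter S \<le> d"
  using assms unfolding diameter_def by (auto intro!: cSUP_least)

lemma bounded_of_dist:
  fixes S :: "'a::metric_space set"
  assumes "\<And>x y. x \<in> S \<Longrightarrow> y \<in> S \<Longrightarrow> dist x y \<le> d"
  shows "bounded S"
  using assms unfolding bounded_def by blast

lemma hausdorff_premeasure_le_card:
  fixes U :: "'i \<Rightarrow> 'a::metric_space set"
  assumes "0 < s" "0 \<le> d" "d \<le> \<delta>" "finite F" "A \<subseteq> (\<Union>i\<in>F. U i)"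
    and dist: "\<And>i x y. i \<in> F \<Longrightarrow> x \<in> U i \<Longrightarrow> y \<in> U i \<Longrightarrow> dist x y \<le> d"
  shows "hausdorff_premeasure s \<delta> A \<le> ennreal (real (card F) * d powr s)"
proof -
  obtain f where f: "bij_betw f {0..<card F} F"
    using ex_bij_betw_nat_finite[OF \<open>finite F\<close>] by blast
  \<comment> \<open>Empty sets have weight 0, so they pad the finite cover to a sequence.\<close>
  define V where "V k = (if k < card F then U (f k) else {})" for k
  have fF: "f k \<in> F" if "k < card F" for k
    using bij_betwE[OF f] that by auto
  have distV: "dist x y \<le> d" if "x \<in> V k" "y \<in> V k" for k x y
    using that dist fF by (auto simp: V_def split: if_splits)
  have diam: "diameter (V k) \<le> d" for k
    using distV \<open>0 \<le> d\<close> by (intro diameter_le_of_dist) auto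
  have bdd: "bounded (V k)" for k
    using distV by (rule bounded_of_dist)
  have "A \<subseteq> (\<Union>k. V k)"
  proof
    fix x assume "x \<in> A"
    then obtain i where i: "i \<in> F" "x \<in> U i"
      using assms by auto
    then obtain k where "k < card F" "f k = i"
      using f unfolding bij_betw_def by (metis atLeastLessThan_iff imageE)
    then show "x \<in> (\<Union>k. V k)"
      using i by (auto simp: V_def)
  qed
  then have "hausdorff_premeasure s \<delta> A \<le> (\<Sum>k. diameter_powr s (V k))"
    unfolding hausdorff_premeasure_def
    using bdd diam \<open>d \<le> \<delta>\<close> by (intro INF_lower) (auto intro: order_trans)
  also have "\<dots> = (\<Sum>k<card F. diameter_powr s (V k))"
    by (rule suminf_finite) (auto simp: V_def diameter_powr_def)
  also have "\<dots> \<le> (\<Sum>k<card F. ennreal (d powr s))"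
    using bdd diam \<open>0 < s\<close>
    by (intro sum_mono) (auto simp: diameter_powr_def intro!: ennreal_leI powr_mono2 diameter_ge_0)
  also have "\<dots> = ennreal (real (card F) * d powr s)"
    by (simp add: ennreal_mult ennreal_of_nat_eq_real_of_nat)
  finally show ?thesis .
qed

text \<open>Box counting: about \<open>n powr p\<close> sets of diameter \<open>c / n\<close> have
  total \<open>s\<close>-weight of order \<open>n powr (p - s)\<close>, which tends to 0 for each
  \<open>s > p\<close>.\<close>

lemma hausdorff_dim_le_covers:
  fixes A :: "'a::metric_space set" and U :: "nat \<Rightarrow> 'i \<Rightarrow> 'a set"
  assumes "0 \<le> p" "0 \<le> c"
    and fin: "\<And>n. n \<ge> 1 \<Longrightarrow> finite (F n)"
    and card: "\<And>n. n \<ge> 1 \<Longrightarrow> real (card (F n)) \<le> K * real n powr p"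
    and cover: "\<And>n. n \<ge> 1 \<Longrightarrow> A \<subseteq> (\<Union>i\<in>F n. U n i)"
    and dist: "\<And>n i x y. n \<ge> 1 \<Longrightarrow> i \<in> F n \<Longrightarrow> x \<in> U n i \<Longrightarrow> y \<in> U n i \<Longrightarrow> dist x y \<le> c / real n"
  shows "hausdorff_dim A \<le> ennreal p"
proof -
  have zero: "hausdorff_measure s A = 0" if s: "p < s" for s
  proof -
    have "hausdorff_premeasure s \<delta> A \<le> 0" if "\<delta> > 0" for \<delta>
    proof (rule tendsto_lowerbound)
      have "((\<lambda>n. K * c powr s * real n powr (p - s)) \<longlongrightarrow> K * c powr s * 0) sequentially"
        using s by (intro tendsto_intros tendsto_neg_powr filterlim_real_sequentially) auto
      then show "((\<lambda>n. ennreal (K * c powr s * real n powr (p - s))) \<longlongrightarrow> 0) sequentially"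
        using tendsto_ennrealI by fastforce
      obtain N :: nat where N: "c / \<delta> < real N"
        using reals_Archimedean2 by blast
      show "\<forall>\<^sub>F n in sequentially. hausdorff_premeasure s \<delta> A \<le> ennreal (K * c powr s * real n powr (p - s))"
        unfolding eventually_sequentially
      proof (intro exI[of _ "max 1 N"] allI impI)
        fix n assume n: "max 1 N \<le> n"
        then have "c / \<delta> \<le> real n"
          using N by linarith
        then have "c / real n \<le> \<delta>"
          using n \<open>\<delta> > 0\<close> by (simp add: field_simps)
        then have "hausdorff_premeasure s \<delta> A \<le> ennreal (real (card (F n)) * (c / real n) powr s)"
          using n s assms(1,2) by (intro hausdorff_premeasure_le_card[where U = "U n"] fin cover) (auto intro: dist)
        also have "\<dots> \<le> ennreal (K * real n powr p * (c / real n) powr s)"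
          using n card by (intro ennreal_leI mult_right_mono) auto
        also have "K * real n powr p * (c / real n) powr s = K * c powr s * real n powr (p - s)"
          using n \<open>0 \<le> c\<close> by (simp add: powr_divide powr_diff)
        finally show "hausdorff_premeasure s \<delta> A \<le> ennreal (K * c powr s * real n powr (p - s))" .
      qed
    qed auto
    then show ?thesis
      unfolding hausdorff_measure_def by (simp add: SUP_eq_iff)
  qed
  show ?thesis
  proof (rule ennreal_le_epsilon)
    fix e :: real assume "0 < e"
    then have "hausdorff_dim A \<le> ennreal (p + e)"
      unfolding hausdorff_dim_def using zero[of "p + e"] assms(1)
      by (intro Inf_lower CollectI exI[of _ "p + e"]) auto
    then show "hausdorff_dim A \<le> ennreal p + ennreal e"
      using assms(1) \<open>0 < e\<close> by simp
  qed
qed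

lemma card_floor_interval_le:
  fixes x y :: real
  assumes "x \<le> y"
  shows "real (card {\<lfloor>x\<rfloor>..\<lfloor>y\<rfloor>}) \<le> y - x + 2"
proof -
  have "\<lfloor>x\<rfloor> \<le> \<lfloor>y\<rfloor>" using assms by (rule floor_mono)
  then have "real (card {\<lfloor>x\<rfloor>..\<lfloor>y\<rfloor>}) = of_int (\<lfloor>y\<rfloor> - \<lfloor>x\<rfloor> + 1)"
    by simp
  also have "\<dots> \<le> y - x + 2"
    by linarith
  finally show ?thesis .
qed

lemma abs_diff_le_of_floor_eq:
  fixes x y n :: real
  assumes "n > 0" "\<lfloor>n * x\<rfloor> = \<lfloor>n * y\<rfloor>"
  shows "\<bar>x - y\<bar> \<le> 1 / n"
proof -
  have "\<bar>n * x - n * y\<bar> \<le> 1"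
    using assms(2) by linarith
  then have "n * \<bar>x - y\<bar> \<le> 1"
    using assms(1) by (simp add: abs_mult flip: right_diff_distrib)
  then show ?thesis
    using assms(1) by (simp add: field_simps)
qed

lemma hausdorff_dim_real_le_1:
  fixes A :: "real set"
  assumes "bounded A"
  shows "hausdorff_dim A \<le> 1"
proof -
  obtain R where R: "R > 0" "\<And>x. x \<in> A \<Longrightarrow> \<bar>x\<bar> \<le> R"
    using assms by (auto simp: bounded_pos)
  have "hausdorff_dim A \<le> ennreal 1"
  proof (rule hausdorff_dim_le_covers[where c = 1 and K = "2 * R + 2"
        and F = "\<lambda>n. {\<lfloor>- (real n * R)\<rfloor>..\<lfloor>real n * R\<rfloor>}" and U = "\<lambda>n i. {x\<in>A. \<lfloor>real n * x\<rfloor> = i}"])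
    fix n :: nat assume n: "n \<ge> 1"
    have "real (card {\<lfloor>- (real n * R)\<rfloor>..\<lfloor>real n * R\<rfloor>}) \<le> real n * R - - (real n * R) + 2"
      using R by (intro card_floor_interval_le) (auto intro: order_trans[of _ 0])
    also have "\<dots> \<le> (2 * R + 2) * real n powr 1"
      using n by (simp add: algebra_simps)
    finally show "real (card {\<lfloor>- (real n * R)\<rfloor>..\<lfloor>real n * R\<rfloor>}) \<le> (2 * R + 2) * real n powr 1" .
    show "A \<subseteq> (\<Union>i\<in>{\<lfloor>- (real n * R)\<rfloor>..\<lfloor>real n * R\<rfloor>}. {x\<in>A. \<lfloor>real n * x\<rfloor> = i})"
    proof
      fix x assume x: "x \<in> A"
      then have "real n * \<bar>x\<bar> \<le> real n * R"
        using R by (intro mult_left_mono) auto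
      then have "- (real n * R) \<le> real n * x" "real n * x \<le> real n * R"
        using n abs_le_iff[of "real n * x" "real n * R"] by (auto simp: abs_mult)
      then show "x \<in> (\<Union>i\<in>{\<lfloor>- (real n * R)\<rfloor>..\<lfloor>real n * R\<rfloor>}. {x\<in>A. \<lfloor>real n * x\<rfloor> = i})"
        using x by (auto intro: floor_mono)
    qed
    show "dist x y \<le> 1 / real n" if "x \<in> {x\<in>A. \<lfloor>real n * x\<rfloor> = i}" "y \<in> {x\<in>A. \<lfloor>real n * x\<rfloor> = i}" for i x y
      using that n abs_diff_le_of_floor_eq[of "real n" x y] by (auto simp: dist_real_def)
  qed auto
  then show ?thesis by simp
qed

text \<open>Above an interval of length \<open>1 / n\<close> the function oscillates by at most a
  multiple of \<open>n powr - \<alpha>\<close>. Each of the roughly \<open>n\<close> columns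
  therefore meets about \<open>n powr (1 - \<alpha>)\<close> squares of side
  \<open>1 / n\<close>.\<close>

lemma hausdorff_dim_graph_le:
  fixes f :: "real \<Rightarrow> real"
  assumes ab: "a \<le> b" and \<alpha>: "0 \<le> \<alpha>" "\<alpha> \<le> 1" and "0 \<le> C"
    and holder: "\<And>s t. s \<in> {a..b} \<Longrightarrow> t \<in> {a..b} \<Longrightarrow> \<bar>f t - f s\<bar> \<le> C * \<bar>t - s\<bar> powr \<alpha>"
  shows "hausdorff_dim {(t, f t) |t. t \<in> {a..b}} \<le> ennreal (2 - \<alpha>)"
proof -
  \<comment> \<open>A sample point of column \<open>i\<close>; \<open>J n i\<close> lists the rows
    that a Hoelder function can reach from its value there. In a column without points of
    \<open>{a..b}\<close> the choice is arbitrary, and only the size of \<open>J n i\<close>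
    matters.\<close>
  define t where "t n i = (SOME t. t \<in> {a..b} \<and> \<lfloor>real n * t\<rfloor> = i)" for n and i :: int
  define I where "I n = {\<lfloor>real n * a\<rfloor>..\<lfloor>real n * b\<rfloor>}" for n
  define J where "J n i = {\<lfloor>real n * f (t n i) - C * real n powr (1 - \<alpha>)\<rfloor>..
      \<lfloor>real n * f (t n i) + C * real n powr (1 - \<alpha>)\<rfloor>}" for n i
  show ?thesis
  \<comment> \<open>Each \<open>+ 2\<close> pays for rounding and is absorbed through
    \<open>n \<ge> 1\<close> and \<open>n powr (1 - \<alpha>) \<ge> 1\<close>. The value
    \<open>c = 2\<close> adds the two sides of a square.\<close>
  proof (rule hausdorff_dim_le_covers[where c = 2 and K = "(b - a + 2) * (2 * C + 2)"
      and F = "\<lambda>n. Sigma (I n) (J n)"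
      and U = "\<lambda>n (i, j). {(t, f t) |t. t \<in> {a..b} \<and> \<lfloor>real n * t\<rfloor> = i \<and> \<lfloor>real n * f t\<rfloor> = j}"])
    fix n :: nat assume n: "n \<ge> 1"
    have n1: "1 \<le> real n powr (1 - \<alpha>)"
      using n \<alpha> by (intro ge_one_powr_ge_zero) auto
    have J: "real (card (J n i)) \<le> (2 * C + 2) * real n powr (1 - \<alpha>)" for i
    proof -
      have "real (card (J n i)) \<le> 2 * C * real n powr (1 - \<alpha>) + 2"
        unfolding J_def using \<open>0 \<le> C\<close> by (intro order_trans[OF card_floor_interval_le]) auto
      then show ?thesis
        using n1 by (simp add: algebra_simps)
    qed
    have I: "real (card (I n)) \<le> (b - a + 2) * real n"
    proof -
      have "real (card (I n)) \<le> real n * b - real n * a + 2"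
        unfolding I_def using ab by (intro card_floor_interval_le mult_left_mono) auto
      then show ?thesis
        using n by (simp add: algebra_simps)
    qed
    have "real (card (Sigma (I n) (J n))) = (\<Sum>i\<in>I n. real (card (J n i)))"
      by (subst card_SigmaI) (auto simp: I_def J_def)
    also have "\<dots> \<le> (\<Sum>i\<in>I n. (2 * C + 2) * real n powr (1 - \<alpha>))"
      by (intro sum_mono J)
    also have "\<dots> = real (card (I n)) * ((2 * C + 2) * real n powr (1 - \<alpha>))"
      by simp
    also have "\<dots> \<le> (b - a + 2) * real n * ((2 * C + 2) * real n powr (1 - \<alpha>))"
      using \<open>0 \<le> C\<close> by (intro mult_right_mono I) auto
    also have "\<dots> = (b - a + 2) * (2 * C + 2) * real n powr (2 - \<alpha>)"
      using n powr_add[of "real n" 1 "1 - \<alpha>"] by (simp add: algebra_simps)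
    finally show "real (card (Sigma (I n) (J n))) \<le> (b - a + 2) * (2 * C + 2) * real n powr (2 - \<alpha>)" .
    show "{(t, f t) |t. t \<in> {a..b}} \<subseteq> (\<Union>ij\<in>Sigma (I n) (J n). case ij of (i, j) \<Rightarrow>
        {(t, f t) |t. t \<in> {a..b} \<and> \<lfloor>real n * t\<rfloor> = i \<and> \<lfloor>real n * f t\<rfloor> = j})"
    proof
      fix p assume "p \<in> {(t, f t) |t. t \<in> {a..b}}"
      then obtain u where u: "p = (u, f u)" "u \<in> {a..b}" by auto
      define i where "i = \<lfloor>real n * u\<rfloor>"
      have ti: "t n i \<in> {a..b}" "\<lfloor>real n * t n i\<rfloor> = i"
        using someI[of "\<lambda>t. t \<in> {a..b} \<and> \<lfloor>real n * t\<rfloor> = i" u] u unfolding t_def i_def by auto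
      have "i \<in> I n"
        using u n unfolding i_def I_def by (auto intro!: floor_mono)
      moreover have "\<lfloor>real n * f u\<rfloor> \<in> J n i"
      proof -
        have "\<bar>u - t n i\<bar> \<le> 1 / real n"
          using ti n by (intro abs_diff_le_of_floor_eq) (auto simp: i_def)
        then have "\<bar>u - t n i\<bar> powr \<alpha> \<le> (1 / real n) powr \<alpha>"
          using \<alpha> by (intro powr_mono2) auto
        then have "\<bar>f u - f (t n i)\<bar> \<le> C * (1 / real n) powr \<alpha>"
          using holder[OF ti(1) u(2)] \<open>0 \<le> C\<close> by (meson mult_left_mono order_trans)
        then have "real n * \<bar>f u - f (t n i)\<bar> \<le> real n * (C * (1 / real n) powr \<alpha>)"
          by (intro mult_left_mono) auto
        also have "\<dots> = C * real n powr (1 - \<alpha>)"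
          using n by (simp add: powr_divide powr_diff)
        finally have "\<bar>real n * f u - real n * f (t n i)\<bar> \<le> C * real n powr (1 - \<alpha>)"
          using n by (simp add: abs_mult flip: right_diff_distrib)
        then show ?thesis
          unfolding J_def abs_le_iff by (auto intro!: floor_mono)
      qed
      ultimately show "p \<in> (\<Union>ij\<in>Sigma (I n) (J n). case ij of (i, j) \<Rightarrow>
        {(t, f t) |t. t \<in> {a..b} \<and> \<lfloor>real n * t\<rfloor> = i \<and> \<lfloor>real n * f t\<rfloor> = j})"
        using u by (auto simp: i_def)
    qed
    show "dist x y \<le> 2 / real n"
      if x: "x \<in> (case ij of (i, j) \<Rightarrow> {(t, f t) |t. t \<in> {a..b} \<and> \<lfloor>real n * t\<rfloor> = i \<and> \<lfloor>real n * f t\<rfloor> = j})"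
        and y: "y \<in> (case ij of (i, j) \<Rightarrow> {(t, f t) |t. t \<in> {a..b} \<and> \<lfloor>real n * t\<rfloor> = i \<and> \<lfloor>real n * f t\<rfloor> = j})" for ij x y
    proof -
      obtain i j where ij: "ij = (i, j)" by (cases ij)
      obtain u where u: "x = (u, f u)" "\<lfloor>real n * u\<rfloor> = i" "\<lfloor>real n * f u\<rfloor> = j"
        using x unfolding ij by auto
      obtain v where v: "y = (v, f v)" "\<lfloor>real n * v\<rfloor> = i" "\<lfloor>real n * f v\<rfloor> = j"
        using y unfolding ij by auto
      have "dist x y \<le> \<bar>u - v\<bar> + \<bar>f u - f v\<bar>"
        using sqrt_sum_squares_le_sum_abs[of "u - v" "f u - f v"]
        by (simp add: u v dist_Pair_Pair dist_real_def)
      also have "\<dots> \<le> 1 / real n + 1 / real n"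
        using u v n by (intro add_mono abs_diff_le_of_floor_eq) auto
      finally show ?thesis by simp
    qed
  qed (use \<alpha> in \<open>auto simp: I_def J_def\<close>)
qed

section \<open>Lower bounds by mass distribution and energy\<close>

text \<open>Mass distribution principle for the image of Lebesgue measure under \<open>G\<close>. A
  covering set that meets \<open>G\<close>
  A\<open>lies in a ball of radius its own diameter around a point of\<close>G \<open>A\<close>, so
  the mass it carries is at most \<open>M\<close> times its \<open>\<gamma>\<close>-weight, and
  these masses must add up to at least that of \<open>A\<close>.\<close>

lemma hausdorff_dim_ge_mass:
  fixes G :: "real \<Rightarrow> 'a::metric_space"
  assumes I: "closed I" and cont: "continuous_on I G"
    and A: "A \<subseteq> I" "emeasure lborel A > 0"
    and \<gamma>: "\<gamma> > 0" and M: "M > 0"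
    and mass: "\<And>t d. t \<in> A \<Longrightarrow> d \<ge> 0 \<Longrightarrow>
      emeasure lborel {s\<in>I. dist (G s) (G t) \<le> d} \<le> ennreal (M * d powr \<gamma>)"
  shows "ennreal \<gamma> \<le> hausdorff_dim (G ` I)"
proof -
  have clos: "closed {s\<in>I. dist (G s) p \<le> d}" for p d
    using continuous_on_closed_Collect_le[OF continuous_on_dist[OF cont continuous_on_const] continuous_on_const I] .
  have key: "emeasure lborel A \<le> ennreal M * (\<Sum>i. diameter_powr s (U i))"
    if U: "G ` I \<subseteq> (\<Union>i. U i)" "\<And>i. bounded (U i)" "\<And>i. diameter (U i) \<le> 1" and s: "0 \<le> s" "s \<le> \<gamma>"
    for s and U :: "nat \<Rightarrow> 'a set"
  proof -
    define t where "t i = (SOME t. t \<in> A \<and> G t \<in> U i)" for i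
    define S where "S i = (if \<exists>t\<in>A. G t \<in> U i then {s\<in>I. dist (G s) (G (t i)) \<le> diameter (U i)} else {})" for i
    have t: "t i \<in> A" "G (t i) \<in> U i" if "\<exists>t\<in>A. G t \<in> U i" for i
      using someI_ex[of "\<lambda>t. t \<in> A \<and> G t \<in> U i"] that unfolding t_def by auto
    have S: "S i \<in> sets lborel" for i
      using clos by (auto simp: S_def)
    have "A \<subseteq> (\<Union>i. S i)"
    proof
      fix x assume x: "x \<in> A"
      then obtain i where i: "G x \<in> U i" using U A by blast
      with x have ex: "\<exists>t\<in>A. G t \<in> U i" by auto
      have "dist (G x) (G (t i)) \<le> diameter (U i)"
        by (rule diameter_bounded_bound[OF U(2) i t(2)[OF ex]])
      then have "x \<in> S i"
        using x A ex by (auto simp: S_def)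
      then show "x \<in> (\<Union>i. S i)" by auto
    qed
    then have "emeasure lborel A \<le> emeasure lborel (\<Union>i. S i)"
      using S by (intro emeasure_mono) auto
    also have "\<dots> \<le> (\<Sum>i. emeasure lborel (S i))"
      using S by (intro emeasure_subadditive_countably) auto
    also have "\<dots> \<le> (\<Sum>i. ennreal M * diameter_powr s (U i))"
    proof (rule suminf_le)
      fix i
      show "emeasure lborel (S i) \<le> ennreal M * diameter_powr s (U i)"
      proof (cases "\<exists>t\<in>A. G t \<in> U i")
        case True
        have d0: "0 \<le> diameter (U i)"
          using U by (simp add: diameter_ge_0)
        have "emeasure lborel (S i) \<le> ennreal (M * diameter (U i) powr \<gamma>)"
          using mass[OF t(1)[OF True] d0] True by (simp add: S_def)
        also have "\<dots> = ennreal M * ennreal (diameter (U i) powr \<gamma>)"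
          using M by (intro ennreal_mult) auto
        \<comment> \<open>A diameter of at most 1 makes the smaller exponent give the larger weight.
          Exponent 0 is separate because of its convention of weight 1.\<close>
        also have "ennreal (diameter (U i) powr \<gamma>) \<le> diameter_powr s (U i)"
        proof (cases "s = 0")
          case True
          then show ?thesis
            using t(2)[OF \<open>\<exists>t\<in>A. G t \<in> U i\<close>] powr_le1[of \<gamma> "diameter (U i)"] \<gamma> d0 U(3)[of i]
            by (auto simp: diameter_powr_def)
        next
          case False
          then show ?thesis
            using t(2)[OF \<open>\<exists>t\<in>A. G t \<in> U i\<close>] s d0 U(3)[of i] powr_mono'[of s \<gamma> "diameter (U i)"]
            by (auto simp: diameter_powr_def intro!: ennreal_leI)
        qed
        finally show ?thesis by (simp add: mult_left_mono)
      qed (simp add: S_def)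
    qed auto
    finally show ?thesis
      by simp
  qed
  have "\<gamma> \<le> s" if s: "0 \<le> s" "hausdorff_measure s (G ` I) = 0" for s
  proof (rule ccontr)
    assume "\<not> \<gamma> \<le> s"
    \<comment> \<open>\<open>A\<close> may have infinite measure, so a finite positive
      \<open>e'\<close> below it serves for the contradiction.\<close>
    obtain e' where e': "0 < e'" "e' < emeasure lborel A"
      using dense[OF A(2)] by blast
    then obtain e where e: "e' = ennreal e" "e > 0"
      by (cases e') auto
    have "hausdorff_premeasure s 1 (G ` I) \<le> hausdorff_measure s (G ` I)"
      unfolding hausdorff_measure_def by (rule SUP_upper) auto
    also have "\<dots> < ennreal (e / M)"
      using s e M by simp
    finally obtain U :: "nat \<Rightarrow> 'a set" where U: "G ` I \<subseteq> (\<Union>i. U i)"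
      "\<And>i. bounded (U i)" "\<And>i. diameter (U i) \<le> 1" "(\<Sum>i. diameter_powr s (U i)) < ennreal (e / M)"
      unfolding hausdorff_premeasure_def INF_less_iff by auto
    have "emeasure lborel A \<le> ennreal M * (\<Sum>i. diameter_powr s (U i))"
      using U s \<open>\<not> \<gamma> \<le> s\<close> by (intro key) auto
    also have "\<dots> \<le> ennreal M * ennreal (e / M)"
      using U by (intro mult_left_mono) auto
    also have "\<dots> = e'"
      using M e by (simp flip: ennreal_mult)
    finally show False
      using e' by simp
  qed
  then show ?thesis
    unfolding hausdorff_dim_def by (auto simp: le_Inf_iff intro!: ennreal_leI)
qed

lemma hausdorff_dim_interval_ge_1:
  fixes c d :: real
  assumes "c < d"
  shows "1 \<le> hausdorff_dim {c..d}"
proof -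
  have "ennreal 1 \<le> hausdorff_dim (id ` {c..d})"
  proof (rule hausdorff_dim_ge_mass[where A = "{c..d}" and M = 2])
    fix t r :: real assume r: "0 \<le> r"
    have "emeasure lborel {s\<in>{c..d}. dist (id s) (id t) \<le> r} \<le> emeasure lborel {t - r..t + r}"
      by (intro emeasure_mono) (auto simp: dist_real_def)
    also have "\<dots> = ennreal (2 * r powr 1)"
      using r by simp
    finally show "emeasure lborel {s\<in>{c..d}. dist (id s) (id t) \<le> r} \<le> ennreal (2 * r powr 1)" .
  qed (use assms in auto)
  then show ?thesis by simp
qed

text \<open>Finite energy makes the potential \<open>g\<close> finite almost everywhere, hence
  bounded by some \<open>n\<close> on a set of positive measure. On that set Markov's inequality for
  the kernel is the mass bound of \<open>hausdorff_dim_ge_mass\<close>. The maximum norm in the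
  kernel is dominated by the Euclidean distance of the graph points.\<close>

lemma hausdorff_dim_graph_ge_energy:
  fixes f :: "real \<Rightarrow> real"
  assumes ab: "a < b" and \<gamma>: "\<gamma> > 0" and cont: "continuous_on {a..b} f"
    and energy: "(\<integral>\<^sup>+t\<in>{a..b}. (\<integral>\<^sup>+s\<in>{a..b}. ennreal (max \<bar>t - s\<bar> \<bar>f t - f s\<bar> powr - \<gamma>) \<partial>lborel) \<partial>lborel) < \<infinity>"
  shows "ennreal \<gamma> \<le> hausdorff_dim {(t, f t) |t. t \<in> {a..b}}"
proof -
  \<comment> \<open>Continuity is known on \<open>{a..b}\<close> only; the extension by 0 is Borel
    on the whole line, which makes the potential measurable.\<close>
  define f' where "f' t = indicator {a..b} t *\<^sub>R f t" for t
  have f'[measurable]: "f' \<in> borel_measurable borel"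
    unfolding f'_def using borel_measurable_continuous_on_indicator[OF _ cont] by simp
  have f'_eq: "f' t = f t" if "t \<in> {a..b}" for t
    using that by (simp add: f'_def)
  define g where "g t = (\<integral>\<^sup>+s\<in>{a..b}. ennreal (max \<bar>t - s\<bar> \<bar>f' t - f' s\<bar> powr - \<gamma>) \<partial>lborel)" for t
  have g[measurable]: "g \<in> borel_measurable borel"
    unfolding g_def by measurable
  have "(\<integral>\<^sup>+t. g t * indicator {a..b} t \<partial>lborel) =
      (\<integral>\<^sup>+t\<in>{a..b}. (\<integral>\<^sup>+s\<in>{a..b}. ennreal (max \<bar>t - s\<bar> \<bar>f t - f s\<bar> powr - \<gamma>) \<partial>lborel) \<partial>lborel)"
    unfolding g_def by (intro nn_integral_cong) (auto simp: f'_eq intro!: nn_integral_cong split: split_indicator)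
  then have "AE t in lborel. g t * indicator {a..b} t \<noteq> \<infinity>"
    using energy by (intro nn_integral_PInf_AE) auto
  then have ae: "AE t in lborel. t \<in> {a..b} \<longrightarrow> g t < \<infinity>"
    by eventually_elim (auto simp: top.not_eq_extremum)
  define A where "A n = {t\<in>{a..b}. g t \<le> of_nat n}" for n :: nat
  have A_sets: "A n \<in> sets lborel" for n
    unfolding A_def by simp
  have "\<exists>n. emeasure lborel (A n) > 0"
  proof (rule ccontr)
    assume "\<not> ?thesis"
    then have "A n \<in> null_sets lborel" for n
      using A_sets by (auto simp: null_sets_def)
    then have "(\<Union>n. A n) \<in> null_sets lborel"
      by auto
    then have "AE t in lborel. t \<notin> (\<Union>n. A n)"
      by (rule AE_not_in)
    with ae have "AE t in lborel. t \<notin> {a..b}"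
    proof eventually_elim
      case (elim t)
      show ?case
      proof
        assume "t \<in> {a..b}"
        then have "g t < \<infinity>" using elim by auto
        then obtain n where "g t < of_nat n"
          by (auto dest: ennreal_Ex_less_of_nat)
        then show False
          using elim \<open>t \<in> {a..b}\<close> by (auto simp: A_def dest: less_imp_le)
      qed
    qed
    then have "{a..b} \<in> null_sets lborel"
      by (subst AE_iff_null_sets) auto
    then show False
      using ab by (auto simp: null_sets_def)
  qed
  then obtain n where n: "emeasure lborel (A n) > 0" by blast
  have "ennreal \<gamma> \<le> hausdorff_dim ((\<lambda>t. (t, f t)) ` {a..b})"
  proof (rule hausdorff_dim_ge_mass[where A = "A n" and M = "real n + 1"])
    show "continuous_on {a..b} (\<lambda>t. (t, f t))"
      by (intro continuous_intros cont)
    fix t d :: real assume t: "t \<in> A n" and d: "0 \<le> d"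
    define S where "S = {s\<in>{a..b}. dist (s, f s) (t, f t) \<le> d}"
    have tab: "t \<in> {a..b}" using t by (auto simp: A_def)
    have "closed S"
      unfolding S_def
      by (intro continuous_on_closed_Collect_le continuous_on_dist continuous_on_Pair continuous_on_id cont continuous_on_const) auto
    then have S[measurable]: "S \<in> sets borel" by auto
    have le_max: "max \<bar>t - s\<bar> \<bar>f' t - f' s\<bar> \<le> d" if "s \<in> S" for s
    proof -
      have "\<bar>t - s\<bar> \<le> dist (s, f s) (t, f t)" "\<bar>f t - f s\<bar> \<le> dist (s, f s) (t, f t)"
        using dist_fst_le[of "(s, f s)" "(t, f t)"] dist_snd_le[of "(s, f s)" "(t, f t)"]
        by (auto simp: dist_real_def)
      then show ?thesis
        using that tab by (auto simp: S_def f'_eq)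
    qed
    \<comment> \<open>The point \<open>s = t\<close> must go: there the kernel is
      \<open>0 powr - \<gamma> = 0\<close> instead of infinite, and the pointwise comparison below
      would fail.\<close>
    have S': "emeasure lborel S = emeasure lborel (S - {t})"
      by (rule emeasure_Diff_null_set[symmetric]) auto
    show "emeasure lborel {s\<in>{a..b}. dist (s, f s) (t, f t) \<le> d} \<le> ennreal ((real n + 1) * d powr \<gamma>)"
    proof (cases "d = 0")
      case True
      then have "S \<subseteq> {t}" using le_max by force
      then have "S - {t} = {}" by auto
      then have "emeasure lborel S = 0"
        unfolding S' by (metis emeasure_empty)
      then show ?thesis
        unfolding S_def by simp
    next
      case False
      with d have d: "d > 0" by simp
      have "ennreal (d powr - \<gamma>) * emeasure lborel S = (\<integral>\<^sup>+s. ennreal (d powr - \<gamma>) * indicator (S - {t}) s \<partial>lborel)"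
        unfolding S' by (subst nn_integral_cmult_indicator) auto
      also have "\<dots> \<le> g t"
        unfolding g_def
      proof (intro nn_integral_mono)
        fix s
        show "ennreal (d powr - \<gamma>) * indicator (S - {t}) s
          \<le> ennreal (max \<bar>t - s\<bar> \<bar>f' t - f' s\<bar> powr - \<gamma>) * indicator {a..b} s"
        proof (cases "s \<in> S - {t}")
          case True
          then have "d powr - \<gamma> \<le> max \<bar>t - s\<bar> \<bar>f' t - f' s\<bar> powr - \<gamma>"
            using le_max[of s] \<gamma> by (intro powr_mono2') auto
          then show ?thesis
            using True by (auto simp: S_def intro!: ennreal_leI)
        qed auto
      qed
      also have "\<dots> \<le> ennreal (real n)"
        using t by (simp add: A_def ennreal_of_nat_eq_real_of_nat)
      finally have "ennreal (d powr \<gamma>) * (ennreal (d powr - \<gamma>) * emeasure lborel S) \<le> ennreal (d powr \<gamma>) * ennreal (real n)"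
        by (intro mult_left_mono) auto
      also have "ennreal (d powr \<gamma>) * (ennreal (d powr - \<gamma>) * emeasure lborel S) = emeasure lborel S"
        using d by (simp add: powr_minus flip: mult.assoc ennreal_mult)
      also have "ennreal (d powr \<gamma>) * ennreal (real n) \<le> ennreal ((real n + 1) * d powr \<gamma>)"
        by (subst ennreal_mult[symmetric]) (auto intro!: ennreal_leI simp: algebra_simps)
      finally show ?thesis
        by (simp add: S_def)
    qed
  qed (use n \<gamma> in \<open>auto simp: A_def\<close>)
  also have "(\<lambda>t. (t, f t)) ` {a..b} = {(t, f t) |t. t \<in> {a..b}}"
    by auto
  finally show ?thesis .
qed

section \<open>Integral estimates\<close>

lemma nn_integral_powr_unit_interval:
  fixes \<kappa> :: real
  assumes "\<kappa> < 1"
  shows "(\<integral>\<^sup>+x. ennreal (x powr - \<kappa>) * indicator {0..1} x \<partial>lborel) = ennreal (1 / (1 - \<kappa>))"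
proof -
  have "((\<lambda>x. x powr - \<kappa>) has_integral (1 powr (- \<kappa> + 1) / (- \<kappa> + 1))) {0..1}"
    using assms by (intro has_integral_powr_from_0) auto
  then have "((\<lambda>x. if x \<in> {0..1} then x powr - \<kappa> else 0) has_integral 1 / (1 - \<kappa>)) UNIV"
    by (subst has_integral_restrict_UNIV) auto
  then have "(\<integral>\<^sup>+x. ennreal (if x \<in> {0..1} then x powr - \<kappa> else 0) \<partial>lborel) = ennreal (1 / (1 - \<kappa>))"
    by (intro nn_integral_has_integral_lborel) auto
  also have "(\<integral>\<^sup>+x. ennreal (if x \<in> {0..1} then x powr - \<kappa> else 0) \<partial>lborel)
      = (\<integral>\<^sup>+x. ennreal (x powr - \<kappa>) * indicator {0..1} x \<partial>lborel)"
    by (intro nn_integral_cong) (auto split: split_indicator)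
  finally show ?thesis .
qed

text \<open>Within distance 1 of \<open>c\<close> the integrand is covered by two reflected copies
  of \<open>x powr - \<kappa>\<close> on the unit interval, farther away it is at most 1. The point
  is uniformity in \<open>c\<close>.\<close>

lemma nn_integral_abs_powr_le:
  fixes \<kappa> a b c :: real
  assumes \<kappa>: "0 \<le> \<kappa>" "\<kappa> < 1" and ab: "a \<le> b"
  shows "(\<integral>\<^sup>+x. ennreal (\<bar>x - c\<bar> powr - \<kappa>) * indicator {a..b} x \<partial>lborel) \<le> ennreal (2 / (1 - \<kappa>) + (b - a))"
proof -
  define f where "f x = ennreal (x powr - \<kappa>) * indicator {0..1} x" for x :: real
  have [measurable]: "f \<in> borel_measurable borel"
    unfolding f_def by measurable
  have "(\<integral>\<^sup>+x. ennreal (\<bar>x - c\<bar> powr - \<kappa>) * indicator {a..b} x \<partial>lborel)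
    \<le> (\<integral>\<^sup>+x. f (- c + 1 * x) + f (c + -1 * x) + indicator {a..b} x \<partial>lborel)"
  proof (rule nn_integral_mono)
    fix x :: real
    show "ennreal (\<bar>x - c\<bar> powr - \<kappa>) * indicator {a..b} x \<le> f (- c + 1 * x) + f (c + -1 * x) + indicator {a..b} x"
    proof (cases "\<bar>x - c\<bar> \<le> 1")
      case True
      then have "ennreal (\<bar>x - c\<bar> powr - \<kappa>) \<le> f (- c + 1 * x) + f (c + -1 * x)"
        by (cases "x \<ge> c") (auto simp: f_def split: split_indicator)
      then show ?thesis
        by (auto split: split_indicator intro: add_increasing2)
    next
      case False
      then have "\<bar>x - c\<bar> powr - \<kappa> \<le> \<bar>x - c\<bar> powr 0"
        using \<kappa> by (intro powr_mono) auto
      also have "\<dots> = 1"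
        using False by auto
      finally have "ennreal (\<bar>x - c\<bar> powr - \<kappa>) \<le> 1"
        by simp
      then show ?thesis
        by (auto split: split_indicator intro: add_increasing)
    qed
  qed
  also have "\<dots> = (\<integral>\<^sup>+x. f (- c + 1 * x) \<partial>lborel) + (\<integral>\<^sup>+x. f (c + -1 * x) \<partial>lborel) + emeasure lborel {a..b}"
    by (simp add: nn_integral_add)
  also have "(\<integral>\<^sup>+x. f (- c + 1 * x) \<partial>lborel) = (\<integral>\<^sup>+x. f x \<partial>lborel)"
    by (subst (2) nn_integral_real_affine[where c = 1 and t = "- c"]) auto
  also have "(\<integral>\<^sup>+x. f (c + -1 * x) \<partial>lborel) = (\<integral>\<^sup>+x. f x \<partial>lborel)"
    by (subst (2) nn_integral_real_affine[where c = "-1" and t = c]) auto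
  also have "(\<integral>\<^sup>+x. f x \<partial>lborel) = ennreal (1 / (1 - \<kappa>))"
    unfolding f_def using \<kappa> by (intro nn_integral_powr_unit_interval)
  finally show ?thesis
    using \<kappa> ab by (simp flip: ennreal_plus)
qed

text \<open>The plateau \<open>{- r..r}\<close> contributes
  \<open>2 * r powr (1 - \<gamma>)\<close>; the two tails, convergent because
  \<open>\<gamma> > 1\<close>, contribute \<open>r powr (1 - \<gamma>) / (\<gamma> - 1)\<close>
  each.\<close>

lemma nn_integral_max_abs_powr_le:
  fixes r \<gamma> :: real
  assumes r: "r > 0" and \<gamma>: "\<gamma> > 1"
  shows "(\<integral>\<^sup>+x. ennreal (max r \<bar>x\<bar> powr - \<gamma>) \<partial>lborel) \<le> ennreal ((2 + 2 / (\<gamma> - 1)) * r powr (1 - \<gamma>))"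
proof -
  define f where "f x = ennreal (x powr - \<gamma>) * indicator {r..} x" for x :: real
  have [measurable]: "f \<in> borel_measurable borel"
    unfolding f_def by measurable
  have int_f: "(\<integral>\<^sup>+x. f x \<partial>lborel) = ennreal (0 - (- (r powr (1 - \<gamma>) / (\<gamma> - 1))))"
    unfolding f_def
  proof (rule nn_integral_FTC_atLeast)
    show "((\<lambda>x. - (x powr (1 - \<gamma>) / (\<gamma> - 1))) has_real_derivative x powr - \<gamma>) (at x)" if "r \<le> x" for x
    proof -
      have "((\<lambda>x. - (x powr (1 - \<gamma>) / (\<gamma> - 1))) has_real_derivative - ((1 - \<gamma>) * x powr (1 - \<gamma> - 1) / (\<gamma> - 1))) (at x)"
        using that r \<gamma> by (auto intro!: derivative_eq_intros)
      also have "- ((1 - \<gamma>) * x powr (1 - \<gamma> - 1) / (\<gamma> - 1)) = x powr - \<gamma>"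
        using \<gamma> by (simp add: field_simps)
      finally show ?thesis .
    qed
    have "((\<lambda>x. - (x powr (1 - \<gamma>) / (\<gamma> - 1))) \<longlongrightarrow> - (0 / (\<gamma> - 1))) at_top"
      using \<gamma> by (intro tendsto_intros tendsto_neg_powr filterlim_ident) auto
    then show "((\<lambda>x. - (x powr (1 - \<gamma>) / (\<gamma> - 1))) \<longlongrightarrow> 0) at_top"
      by simp
  qed auto
  have "(\<integral>\<^sup>+x. ennreal (max r \<bar>x\<bar> powr - \<gamma>) \<partial>lborel)
    \<le> (\<integral>\<^sup>+x. ennreal (r powr - \<gamma>) * indicator {- r..r} x + f x + f (0 + -1 * x) \<partial>lborel)"
  proof (rule nn_integral_mono)
    fix x :: real
    consider "\<bar>x\<bar> \<le> r" | "x \<ge> r" | "- x \<ge> r"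
      by linarith
    then show "ennreal (max r \<bar>x\<bar> powr - \<gamma>) \<le> ennreal (r powr - \<gamma>) * indicator {- r..r} x + f x + f (0 + -1 * x)"
    proof cases
      case 1
      then have "ennreal (max r \<bar>x\<bar> powr - \<gamma>) = ennreal (r powr - \<gamma>) * indicator {- r..r} x"
        by (auto simp: max_absorb1 abs_le_iff)
      then show ?thesis
        by (simp add: add.assoc)
    next
      case 2
      then have "ennreal (max r \<bar>x\<bar> powr - \<gamma>) = f x"
        using r by (auto simp: max_def f_def)
      then show ?thesis
        by (simp add: add_increasing add_increasing2)
    next
      case 3
      then have "ennreal (max r \<bar>x\<bar> powr - \<gamma>) = f (0 + -1 * x)"
        using r by (auto simp: max_def f_def)
      then show ?thesis
        by (simp add: add_increasing)
    qed
  qed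
  also have "\<dots> = ennreal (r powr - \<gamma>) * emeasure lborel {- r..r} + (\<integral>\<^sup>+x. f x \<partial>lborel) + (\<integral>\<^sup>+x. f (0 + -1 * x) \<partial>lborel)"
    by (simp add: nn_integral_add nn_integral_cmult_indicator)
  also have "(\<integral>\<^sup>+x. f (0 + -1 * x) \<partial>lborel) = (\<integral>\<^sup>+x. f x \<partial>lborel)"
    by (subst (2) nn_integral_real_affine[where c = "-1" and t = 0]) auto
  also have "ennreal (r powr - \<gamma>) * emeasure lborel {- r..r} + (\<integral>\<^sup>+x. f x \<partial>lborel) + (\<integral>\<^sup>+x. f x \<partial>lborel)
    = ennreal ((2 + 2 / (\<gamma> - 1)) * r powr (1 - \<gamma>))"
  proof -
    have "r powr - \<gamma> * (2 * r) = 2 * r powr (1 - \<gamma>)"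
      using r powr_add[of r 1 "- \<gamma>"] by simp
    then have "ennreal (r powr - \<gamma>) * emeasure lborel {- r..r} = ennreal (2 * r powr (1 - \<gamma>))"
      using r by (simp flip: ennreal_mult)
    then show ?thesis
      unfolding int_f using \<gamma> by (simp flip: ennreal_plus add: algebra_simps)
  qed
  finally show ?thesis .
qed

section \<open>Integration against one Gaussian weight\<close>

lemma std_normal_density_le_1: "std_normal_density x \<le> 1"
proof -
  have "1 \<le> sqrt (2 * pi)"
    using pi_gt3 by auto
  then have "exp (- x\<^sup>2 / 2) \<le> sqrt (2 * pi)"
    by (rule order_trans[rotated]) simp
  then show ?thesis
    unfolding std_normal_density_def by (simp add: divide_le_eq)
qed

lemma nn_integral_std_normal_density: "(\<integral>\<^sup>+x. ennreal (std_normal_density x) \<partial>lborel) = 1"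
  using std_normal_moment_even[of 0] by (simp add: has_bochner_integral_iff nn_integral_eq_integral)

text \<open>Interpolates between the trivial bound \<open>r powr - \<gamma>\<close> and the bound
  \<open>C * r powr (1 - \<gamma>) / \<bar>a\<bar>\<close> coming from the density of \<open>a * z + w\<close>; the latter alone would not
  be integrable when \<open>a\<close> is the sine of a uniform phase.\<close>

lemma nn_integral_gauss_kernel_le:
  fixes r \<gamma> \<eta> a w :: real
  assumes r: "r > 0" and \<gamma>: "\<gamma> > 1" and \<eta>: "0 \<le> \<eta>" "\<eta> \<le> 1" and a: "a \<noteq> 0"
  shows "(\<integral>\<^sup>+z. ennreal (std_normal_density z) * ennreal (max r \<bar>a * z + w\<bar> powr - \<gamma>) \<partial>lborel)
    \<le> ennreal ((2 + 2 / (\<gamma> - 1)) * r powr (\<eta> - \<gamma>) * \<bar>a\<bar> powr - \<eta>)" (is "?I \<le> _")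
proof -
  define C where "C = 2 + 2 / (\<gamma> - 1)"
  have C: "C \<ge> 1"
    using \<gamma> by (simp add: C_def)
  \<comment> \<open>In this form everything depends on the ratio \<open>r / |a|\<close>. If it is at
    most 1, the density bound has its first power, which is below its power \<open>\<eta>\<close>.
    If it exceeds 1, its power \<open>\<eta>\<close> is at least 1 and the trivial bound is
    enough.\<close>
  have interp: "C * r powr (\<eta> - \<gamma>) * \<bar>a\<bar> powr - \<eta> = C * r powr - \<gamma> * (r / \<bar>a\<bar>) powr \<eta>"
    using r a by (simp add: powr_divide powr_minus powr_diff field_simps)
  have "?I \<le> ennreal (C * r powr - \<gamma> * (r / \<bar>a\<bar>) powr \<eta>)"
  proof (cases "r \<le> \<bar>a\<bar>")
    case True
    have "?I \<le> (\<integral>\<^sup>+z. ennreal (max r \<bar>w + a * z\<bar> powr - \<gamma>) \<partial>lborel)"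
    proof (rule nn_integral_mono)
      fix z
      have "ennreal (std_normal_density z) * ennreal (max r \<bar>a * z + w\<bar> powr - \<gamma>)
        \<le> 1 * ennreal (max r \<bar>w + a * z\<bar> powr - \<gamma>)"
        by (intro mult_mono) (auto simp: std_normal_density_le_1 add.commute)
      then show "ennreal (std_normal_density z) * ennreal (max r \<bar>a * z + w\<bar> powr - \<gamma>)
        \<le> ennreal (max r \<bar>w + a * z\<bar> powr - \<gamma>)"
        by simp
    qed
    also have "\<dots> = ennreal (1 / \<bar>a\<bar>) * (ennreal \<bar>a\<bar> * (\<integral>\<^sup>+z. ennreal (max r \<bar>w + a * z\<bar> powr - \<gamma>) \<partial>lborel))"
      using a by (simp flip: mult.assoc ennreal_mult)
    also have "ennreal \<bar>a\<bar> * (\<integral>\<^sup>+z. ennreal (max r \<bar>w + a * z\<bar> powr - \<gamma>) \<partial>lborel)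
      = (\<integral>\<^sup>+v. ennreal (max r \<bar>v\<bar> powr - \<gamma>) \<partial>lborel)"
      using a by (subst (2) nn_integral_real_affine[where c = a and t = w]) auto
    also have "ennreal (1 / \<bar>a\<bar>) * \<dots> \<le> ennreal (1 / \<bar>a\<bar>) * ennreal (C * r powr (1 - \<gamma>))"
      unfolding C_def by (intro mult_left_mono nn_integral_max_abs_powr_le r \<gamma>) auto
    also have "\<dots> = ennreal (C * r powr - \<gamma> * (r / \<bar>a\<bar>) powr 1)"
      using C r powr_add[of r 1 "- \<gamma>"] by (simp flip: ennreal_mult)
    also have "\<dots> \<le> ennreal (C * r powr - \<gamma> * (r / \<bar>a\<bar>) powr \<eta>)"
      using True r a \<eta> C by (intro ennreal_leI mult_left_mono powr_mono') auto
    finally show ?thesis .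
  next
    case False
    have "?I \<le> (\<integral>\<^sup>+z. ennreal (std_normal_density z) * ennreal (r powr - \<gamma>) \<partial>lborel)"
      using r \<gamma> by (intro nn_integral_mono mult_left_mono ennreal_leI powr_mono2') auto
    also have "\<dots> = ennreal (r powr - \<gamma>)"
      by (simp add: nn_integral_multc nn_integral_std_normal_density)
    also have "\<dots> \<le> ennreal (C * r powr - \<gamma> * (r / \<bar>a\<bar>) powr \<eta>)"
    proof (rule ennreal_leI)
      have "1 \<le> (r / \<bar>a\<bar>) powr \<eta>"
        using False a \<eta> by (intro ge_one_powr_ge_zero) auto
      then have "1 * 1 \<le> C * (r / \<bar>a\<bar>) powr \<eta>"
        using C by (intro mult_mono) auto
      then have "r powr - \<gamma> * 1 \<le> r powr - \<gamma> * (C * (r / \<bar>a\<bar>) powr \<eta>)"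
        by (intro mult_left_mono) auto
      then show "r powr - \<gamma> \<le> C * r powr - \<gamma> * (r / \<bar>a\<bar>) powr \<eta>"
        by (simp add: ac_simps)
    qed
    finally show ?thesis .
  qed
  then show ?thesis
    unfolding interp[symmetric] by (simp add: C_def)
qed

text \<open>The cross term vanishes by symmetry, so an offset \<open>w\<close> can only increase the
  second moment. Hence \<open>a\<^sup>2\<close> is a lower bound uniform in
  \<open>w\<close>.\<close>

lemma nn_integral_gauss_affine_square:
  fixes a w :: real
  shows "(\<integral>\<^sup>+z. ennreal (std_normal_density z) * ennreal ((a * z + w)\<^sup>2) \<partial>lborel) = ennreal (a\<^sup>2 + w\<^sup>2)"
proof -
  have "has_bochner_integral lborel (\<lambda>z. a\<^sup>2 * (std_normal_density z * z ^ (2 * 1))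
      + (2 * a * w) * (std_normal_density z * z ^ (2 * 0 + 1)) + w\<^sup>2 * (std_normal_density z * z ^ (2 * 0)))
    (a\<^sup>2 * (fact (2 * 1) / (2^1 * fact 1)) + (2 * a * w) * 0 + w\<^sup>2 * (fact (2 * 0) / (2^0 * fact 0)))"
    by (intro has_bochner_integral_add has_bochner_integral_mult_right std_normal_moment_even std_normal_moment_odd)
  then have "has_bochner_integral lborel (\<lambda>z. std_normal_density z * (a * z + w)\<^sup>2) (a\<^sup>2 + w\<^sup>2)"
    by (simp add: power2_eq_square algebra_simps fact_numeral)
  then show ?thesis
    by (simp add: has_bochner_integral_iff nn_integral_eq_integral flip: ennreal_mult)
qed

section \<open>Sine waves with a uniform phase\<close>

lemma abs_sin_diff_pi_int: "\<bar>sin (x - of_int k * pi)\<bar> = \<bar>sin x\<bar>"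
proof -
  have "(cos (of_int k * pi))\<^sup>2 = 1"
    using sin_cos_squared_add[of "of_int k * pi"] sin_npi_int[of k] by (simp add: mult.commute)
  then have "\<bar>cos (of_int k * pi)\<bar> = 1"
    using power2_eq_1_iff by fastforce
  then show ?thesis
    using sin_npi_int[of k] by (simp add: sin_diff abs_mult mult.commute)
qed

text \<open>Jordan's inequality: by concavity the sine lies above its chord from 0 to
  \<open>pi / 2\<close>.\<close>

lemma sin_ge_linear:
  fixes x :: real
  assumes "0 \<le> x" "x \<le> pi / 2"
  shows "2 / pi * x \<le> sin x"
proof -
  have convex: "convex_on {0..pi} (\<lambda>x. - sin x)"
  proof (rule f''_ge0_imp_convex)
    show "((\<lambda>x. - sin x) has_real_derivative - cos x) (at x)" for x :: real
      by (auto intro!: derivative_eq_intros)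
    show "((\<lambda>x. - cos x) has_real_derivative sin x) (at x)" for x :: real
      by (auto intro!: derivative_eq_intros)
  qed (auto intro: sin_ge_zero)
  have "- sin ((1 - 2 / pi * x) *\<^sub>R 0 + (2 / pi * x) *\<^sub>R (pi / 2)) \<le> (1 - 2 / pi * x) * - sin 0 + 2 / pi * x * - sin (pi / 2)"
    using assms by (intro convex_onD[OF convex]) (auto simp: field_simps)
  then show ?thesis
    by simp
qed

lemma abs_sin_ge_linear:
  fixes x :: real
  assumes "\<bar>x\<bar> \<le> pi / 2"
  shows "2 / pi * \<bar>x\<bar> \<le> \<bar>sin x\<bar>"
  using sin_ge_linear[of "\<bar>x\<bar>"] assms by (cases "0 \<le> x") auto

text \<open>Every \<open>x + \<phi>\<close> with \<open>0 \<le> x \<le> 2 \<pi>\<close> is within \<open>\<pi> / 2\<close> of one of four consecutive multiples of \<open>\<pi>\<close>.\<close>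

lemma nn_integral_sin_powr_le:
  fixes \<eta> \<phi> :: real
  assumes \<eta>: "0 \<le> \<eta>" "\<eta> < 1"
  shows "(\<integral>\<^sup>+x. ennreal (\<bar>sin (x + \<phi>)\<bar> powr - \<eta>) * indicator {0..2 * pi} x \<partial>lborel)
    \<le> ennreal (4 * (2 / pi) powr - \<eta> * (2 / (1 - \<eta>) + 2 * pi))"
proof -
  define k0 where "k0 = \<lfloor>\<phi> / pi\<rfloor>"
  define c where "c i = of_int (k0 + int i) * pi - \<phi>" for i :: nat
  have "(\<integral>\<^sup>+x. ennreal (\<bar>sin (x + \<phi>)\<bar> powr - \<eta>) * indicator {0..2 * pi} x \<partial>lborel)
    \<le> (\<integral>\<^sup>+x. (\<Sum>i<4. ennreal ((2 / pi) powr - \<eta>) * (ennreal (\<bar>x - c i\<bar> powr - \<eta>) * indicator {0..2 * pi} x)) \<partial>lborel)"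
  proof (rule nn_integral_mono)
    fix x :: real
    show "ennreal (\<bar>sin (x + \<phi>)\<bar> powr - \<eta>) * indicator {0..2 * pi} x
      \<le> (\<Sum>i<4. ennreal ((2 / pi) powr - \<eta>) * (ennreal (\<bar>x - c i\<bar> powr - \<eta>) * indicator {0..2 * pi} x))"
    proof (cases "x \<in> {0..2 * pi}")
      case True
      \<comment> \<open>The multiple of \<open>pi\<close> nearest to \<open>x + \<phi>\<close>. Over
        one period its index ranges over \<open>k0\<close> to \<open>k0 + 3\<close>.\<close>
      define k where "k = \<lfloor>(x + \<phi>) / pi + 1 / 2\<rfloor>"
      have "k0 \<le> k"
        unfolding k_def k0_def using True by (intro floor_mono) (auto simp: field_simps intro: add_increasing)
      moreover have "k < k0 + 4"
      proof -
        have "of_int k \<le> (x + \<phi>) / pi + 1 / 2" "\<phi> / pi < of_int k0 + 1"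
          unfolding k_def k0_def by linarith+
        moreover have "(x + \<phi>) / pi \<le> 2 + \<phi> / pi"
          using True by (simp add: field_simps)
        ultimately have "of_int k < real_of_int (k0 + 4)"
          by simp
        then show ?thesis by linarith
      qed
      ultimately obtain i where i: "i < 4" "k = k0 + int i"
        by (intro that[of "nat (k - k0)"]) auto
      have "\<bar>(x + \<phi>) / pi - of_int k\<bar> \<le> 1 / 2"
        unfolding k_def by linarith
      then have "\<bar>(x + \<phi>) / pi - of_int k\<bar> * pi \<le> 1 / 2 * pi"
        by (intro mult_right_mono) auto
      also have "\<bar>(x + \<phi>) / pi - of_int k\<bar> * pi = \<bar>((x + \<phi>) / pi - of_int k) * pi\<bar>"
        by (simp add: abs_mult)
      also have "((x + \<phi>) / pi - of_int k) * pi = x - c i"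
        by (simp add: c_def i field_simps)
      finally have "2 / pi * \<bar>x - c i\<bar> \<le> \<bar>sin (x - c i)\<bar>"
        by (intro abs_sin_ge_linear) auto
      also have "\<bar>sin (x - c i)\<bar> = \<bar>sin (x + \<phi>)\<bar>"
        using abs_sin_diff_pi_int[of "x + \<phi>" "k"] by (simp add: c_def i algebra_simps)
      finally have *: "2 / pi * \<bar>x - c i\<bar> \<le> \<bar>sin (x + \<phi>)\<bar>" .
      have "\<bar>sin (x + \<phi>)\<bar> powr - \<eta> \<le> (2 / pi) powr - \<eta> * \<bar>x - c i\<bar> powr - \<eta>"
      \<comment> \<open>At a zero of the sine both sides are 0 by the convention for
        \<open>0 powr - \<eta>\<close>; monotonicity of a negative power requires a positive
        base.\<close>
      proof (cases "x = c i")
        case True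
        then have "sin (x + \<phi>) = 0"
          by (auto simp: c_def sin_zero_iff_int2 intro!: exI[of _ "k0 + int i"])
        then show ?thesis by simp
      next
        case False
        then have "\<bar>sin (x + \<phi>)\<bar> powr - \<eta> \<le> (2 / pi * \<bar>x - c i\<bar>) powr - \<eta>"
          using \<eta> * by (intro powr_mono2') auto
        then show ?thesis
          by (subst (asm) powr_mult) auto
      qed
      then have "ennreal (\<bar>sin (x + \<phi>)\<bar> powr - \<eta>) \<le> ennreal ((2 / pi) powr - \<eta>) * ennreal (\<bar>x - c i\<bar> powr - \<eta>)"
        by (subst ennreal_mult[symmetric]) (auto intro: ennreal_leI)
      also have "\<dots> \<le> (\<Sum>i<4. ennreal ((2 / pi) powr - \<eta>) * ennreal (\<bar>x - c i\<bar> powr - \<eta>))"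
        using i by (intro member_le_sum) auto
      finally show ?thesis
        using True by simp
    qed auto
  qed
  also have "\<dots> = (\<Sum>i<4. ennreal ((2 / pi) powr - \<eta>) * (\<integral>\<^sup>+x. ennreal (\<bar>x - c i\<bar> powr - \<eta>) * indicator {0..2 * pi} x \<partial>lborel))"
    by (subst nn_integral_sum) (auto simp: nn_integral_cmult)
  also have "\<dots> \<le> (\<Sum>i<4::nat. ennreal ((2 / pi) powr - \<eta>) * ennreal (2 / (1 - \<eta>) + (2 * pi - 0)))"
    using \<eta> by (intro sum_mono mult_left_mono nn_integral_abs_powr_le) auto
  also have "\<dots> = ennreal (4 * (2 / pi) powr - \<eta> * (2 / (1 - \<eta>) + 2 * pi))"
    using \<eta> by (simp add: ennreal_mult mult.assoc del: ennreal_plus)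
  finally show ?thesis .
qed

lemma AE_sin_shift_nonzero:
  fixes \<phi> :: real
  shows "AE x in lborel. sin (x + \<phi>) \<noteq> 0"
proof -
  have "{x. sin (x + \<phi>) = 0} \<subseteq> range (\<lambda>k::int. of_int k * pi - \<phi>)"
    by (auto simp: sin_zero_iff_int2 image_iff algebra_simps)
  then have "countable {x. sin (x + \<phi>) = 0}"
    by (rule countable_subset) auto
  then have "{x. sin (x + \<phi>) = 0} \<in> null_sets lborel"
    by (rule countable_imp_null_set_lborel)
  then show ?thesis
    by (rule AE_I') auto
qed

lemma nn_integral_sin_square:
  "(\<integral>\<^sup>+x. ennreal ((sin (x + \<phi>))\<^sup>2) * indicator {0..2 * pi} x \<partial>lborel) = ennreal pi"
proof -
  define F where "F x = x / 2 - sin (2 * (x + \<phi>)) / 4" for x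
  have "(\<integral>\<^sup>+x. ennreal ((sin (x + \<phi>))\<^sup>2) * indicator {0..2 * pi} x \<partial>lborel) = F (2 * pi) - F 0"
  proof (rule nn_integral_FTC_Icc)
    fix x :: real
    have "(F has_real_derivative (1 / 2 - cos (2 * (x + \<phi>)) / 2)) (at x)"
      unfolding F_def by (auto intro!: derivative_eq_intros)
    also have "1 / 2 - cos (2 * (x + \<phi>)) / 2 = (sin (x + \<phi>))\<^sup>2"
      unfolding cos_double_sin by (simp add: field_simps)
    finally show "(F has_real_derivative (sin (x + \<phi>))\<^sup>2) (at x)" .
  qed auto
  also have "F (2 * pi) - F 0 = pi"
  proof -
    have "sin (2 * (2 * pi + \<phi>)) = sin (2 * (0 + \<phi>))"
    using sin_periodic[of "2 * \<phi>"] sin_periodic[of "2 * \<phi> + 2 * pi"] by (simp add: algebra_simps)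
    then show ?thesis
      by (simp add: F_def)
  qed
  finally show ?thesis .
qed

text \<open>Addition of phasors: \<open>A\<close> is the modulus of the difference of the vectors
  with lengths \<open>p\<close>, \<open>q\<close> and angles \<open>x\<close>, \<open>y\<close>. The
  law of cosines is arranged so that, for nonnegative \<open>p\<close> and \<open>q\<close>, both
  summands are nonnegative and either may be dropped.\<close>

lemma sin_combination:
  fixes p q x y :: real
  obtains A \<phi> where "0 \<le> A" "A\<^sup>2 = (p - q)\<^sup>2 + 4 * p * q * (sin ((x - y) / 2))\<^sup>2"
    "\<And>u. p * sin (x + u) - q * sin (y + u) = A * sin (u + \<phi>)"
proof -
  define B where "B = p * cos x - q * cos y"
  define D where "D = p * sin x - q * sin y"
  define A where "A = sqrt (B\<^sup>2 + D\<^sup>2)"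
  have A2: "A\<^sup>2 = B\<^sup>2 + D\<^sup>2"
    by (simp add: A_def)
  have "B\<^sup>2 + D\<^sup>2 = p\<^sup>2 * ((sin x)\<^sup>2 + (cos x)\<^sup>2) + q\<^sup>2 * ((sin y)\<^sup>2 + (cos y)\<^sup>2)
      - 2 * p * q * (cos x * cos y + sin x * sin y)"
    unfolding B_def D_def by algebra
  also have "\<dots> = p\<^sup>2 + q\<^sup>2 - 2 * p * q * cos (2 * ((x - y) / 2))"
    by (simp add: cos_diff[symmetric] del: distrib_left_numeral right_diff_distrib_numeral)
  also have "\<dots> = (p - q)\<^sup>2 + 4 * p * q * (sin ((x - y) / 2))\<^sup>2"
    unfolding cos_double_sin by (simp add: power2_eq_square algebra_simps)
  finally have amp: "A\<^sup>2 = (p - q)\<^sup>2 + 4 * p * q * (sin ((x - y) / 2))\<^sup>2"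
    using A2 by simp
  have expand: "p * sin (x + u) - q * sin (y + u) = B * sin u + D * cos u" for u
    unfolding B_def D_def sin_add by (simp add: algebra_simps)
  show thesis
  proof (cases "A = 0")
    case True
    then have "B = 0" "D = 0"
      using A2 by (auto simp: sum_power2_eq_zero_iff)
    then show ?thesis
      using that[of 0 0] amp expand True by simp
  next
    case False
    then have "B\<^sup>2 + D\<^sup>2 \<noteq> 0"
      by (auto simp: A_def)
    then have "(B / A)\<^sup>2 + (D / A)\<^sup>2 = 1"
      using A2 by (simp add: power_divide flip: add_divide_distrib)
    then obtain \<phi> where "B / A = cos \<phi>" "D / A = sin \<phi>"
      by (rule sincos_total_2pi)
    then have "B = A * cos \<phi>" "D = A * sin \<phi>"
      using False by (auto simp: field_simps)
    then have "p * sin (x + u) - q * sin (y + u) = A * sin (u + \<phi>)" for u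
      by (subst expand) (simp add: sin_add algebra_simps)
    then show ?thesis
      using that[of A \<phi>] amp A_def by simp
  qed
qed

section \<open>The terms of the series\<close>

text \<open>The phase is a free argument \<open>u\<close>, so that the factor of \<open>Z j\<close>
  is a deterministic function to be integrated against the law of a single phase.\<close>

definition weierstrass_coeff :: "real \<Rightarrow> (real \<Rightarrow> real) \<Rightarrow> nat \<Rightarrow> real \<Rightarrow> real \<Rightarrow> real" where
  "weierstrass_coeff l H j t u = l powr (- real j * H t) * sin (l ^ j * t + u)"

lemma weierstrass_process_eq:
  "weierstrass_process l H Z \<theta> t \<omega> = (\<Sum>j. Z (Suc j) \<omega> * weierstrass_coeff l H (Suc j) t (\<theta> (Suc j) \<omega>))"
  by (simp add: weierstrass_process_def weierstrass_coeff_def mult.assoc)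

lemma abs_exp_minus_diff_le:
  fixes x y m :: real
  assumes "m \<le> x" "m \<le> y"
  shows "\<bar>exp (- x) - exp (- y)\<bar> \<le> exp (- m) * \<bar>x - y\<bar>"
proof -
  have *: "\<bar>exp (- x) - exp (- y)\<bar> \<le> exp (- m) * \<bar>x - y\<bar>" if "m \<le> x" "x \<le> y" for x y :: real
  proof -
    have "exp (- y) = exp (- x) * exp (- (y - x))"
      by (simp flip: exp_add)
    then have "\<bar>exp (- x) - exp (- y)\<bar> = exp (- x) * (1 - exp (- (y - x)))"
      using that by (simp add: algebra_simps)
    also have "\<dots> \<le> exp (- x) * (y - x)"
      using exp_ge_add_one_self[of "- (y - x)"] by (intro mult_left_mono) (simp_all add: algebra_simps)
    also have "\<dots> \<le> exp (- m) * \<bar>x - y\<bar>"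
      using that by (intro mult_mono) auto
    finally show ?thesis .
  qed
  show ?thesis
    using *[of x y] *[of y x] assms by (cases "x \<le> y") (auto simp: abs_minus_commute)
qed

lemma abs_sin_diff_le: "\<bar>sin x - sin y\<bar> \<le> \<bar>x - y\<bar>" for x y :: real
proof -
  have "sin x - sin y = 2 * sin ((x - y) / 2) * cos ((x + y) / 2)"
    by (rule sin_diff_sin)
  then have "\<bar>sin x - sin y\<bar> = 2 * (\<bar>sin ((x - y) / 2)\<bar> * \<bar>cos ((x + y) / 2)\<bar>)"
    by (simp add: abs_mult)
  also have "\<dots> \<le> 2 * (\<bar>(x - y) / 2\<bar> * 1)"
    by (intro mult_left_mono mult_mono abs_sin_x_le_abs_x abs_cos_le_one) auto
  finally show ?thesis by simp
qed

text \<open>The Lipschitz bound serves for distances up to 1, the trivial bound 2 beyond.\<close>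

lemma abs_sin_diff_le_powr:
  fixes x y \<alpha> :: real
  assumes "0 \<le> \<alpha>" "\<alpha> \<le> 1"
  shows "\<bar>sin x - sin y\<bar> \<le> 2 * \<bar>x - y\<bar> powr \<alpha>"
proof (cases "\<bar>x - y\<bar> \<le> 1")
  case True
  have "\<bar>sin x - sin y\<bar> \<le> \<bar>x - y\<bar> powr 1"
    using abs_sin_diff_le[of x y] by simp
  also have "\<dots> \<le> \<bar>x - y\<bar> powr \<alpha>"
    using True assms by (intro powr_mono') auto
  finally show ?thesis
    by simp
next
  case False
  have "\<bar>sin x - sin y\<bar> \<le> 2 * 1"
    using sin_le_one[of x] sin_le_one[of y] sin_ge_minus_one[of x] sin_ge_minus_one[of y] by linarith
  also have "\<dots> \<le> 2 * \<bar>x - y\<bar> powr \<alpha>"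
    using False assms by (intro mult_left_mono ge_one_powr_ge_zero) auto
  finally show ?thesis .
qed

text \<open>The increment splits into a change of amplitude and a change of the sine. The first
  brings down \<open>j * ln l * |H t - H s|\<close> from the exponent, where
  \<open>\<alpha> \<le> \<beta>\<close> and \<open>|t - s| \<le> 1\<close> turn the power
  \<open>\<beta>\<close> into \<open>\<alpha>\<close>. The second costs
  \<open>(l ^ j * |t - s|) powr \<alpha>\<close>, which reduces the decay from \<open>h\<close> to
  \<open>h - \<alpha>\<close>.\<close>

lemma weierstrass_coeff_diff_le:
  fixes l h \<alpha> \<beta> C s t :: real and H :: "real \<Rightarrow> real"
  assumes l: "l > 1" and \<alpha>: "0 \<le> \<alpha>" "\<alpha> \<le> 1" "\<alpha> \<le> \<beta>" and j: "j \<ge> 1"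
    and h: "0 \<le> h" "h \<le> H s" "h \<le> H t"
    and holder: "\<bar>H t - H s\<bar> \<le> C * \<bar>t - s\<bar> powr \<beta>" and C: "C \<ge> 0" and st: "\<bar>t - s\<bar> \<le> 1"
  shows "\<bar>weierstrass_coeff l H j t u - weierstrass_coeff l H j s u\<bar>
    \<le> (C * ln l + 2) * real j * l powr (- (h - \<alpha>) * real j) * \<bar>t - s\<bar> powr \<alpha>"
proof -
  define P where "P = l powr (- real j * H t)"
  define Q where "Q = l powr (- real j * H s)"
  define E where "E = l powr (- (h - \<alpha>) * real j) * \<bar>t - s\<bar> powr \<alpha>"
  have E: "E \<ge> 0" by (simp add: E_def)
  have r: "\<bar>t - s\<bar> powr \<beta> \<le> \<bar>t - s\<bar> powr \<alpha>"
    using st \<alpha> by (intro powr_mono') auto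
  have lh: "l powr (- real j * h) \<le> l powr (- (h - \<alpha>) * real j)"
    using l \<alpha> by (intro powr_mono) (auto simp: algebra_simps)
  have PQ: "\<bar>P - Q\<bar> \<le> (C * ln l * real j) * E"
  proof -
    have "P = exp (- (real j * H t * ln l))" "Q = exp (- (real j * H s * ln l))"
      using l by (auto simp: P_def Q_def powr_def)
    then have "\<bar>P - Q\<bar> \<le> exp (- (real j * h * ln l)) * \<bar>real j * H t * ln l - real j * H s * ln l\<bar>"
      using h l by (auto intro!: abs_exp_minus_diff_le mult_mono)
    also have "exp (- (real j * h * ln l)) = l powr (- real j * h)"
      using l by (simp add: powr_def)
    also have "\<bar>real j * H t * ln l - real j * H s * ln l\<bar> = real j * ln l * \<bar>H t - H s\<bar>"
      using l by (simp add: abs_mult flip: left_diff_distrib right_diff_distrib)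
    also have "l powr (- real j * h) * (real j * ln l * \<bar>H t - H s\<bar>)
      \<le> l powr (- (h - \<alpha>) * real j) * (real j * ln l * (C * \<bar>t - s\<bar> powr \<alpha>))"
      using lh l r C order_trans[OF holder mult_left_mono[OF r C]] by (intro mult_mono) auto
    finally show ?thesis
      by (simp add: E_def mult_ac)
  qed
  have Q: "\<bar>Q\<bar> \<le> l powr (- real j * h)"
    using l h by (auto simp: Q_def intro!: powr_mono mult_left_mono)
  have QS: "\<bar>Q * (sin (l ^ j * t + u) - sin (l ^ j * s + u))\<bar> \<le> 2 * E"
  proof -
    have "\<bar>sin (l ^ j * t + u) - sin (l ^ j * s + u)\<bar> \<le> 2 * \<bar>(l ^ j * t + u) - (l ^ j * s + u)\<bar> powr \<alpha>"
      using \<alpha> by (intro abs_sin_diff_le_powr)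
    also have "\<bar>(l ^ j * t + u) - (l ^ j * s + u)\<bar> = l powr real j * \<bar>t - s\<bar>"
      using l by (simp add: abs_mult powr_realpow flip: right_diff_distrib)
    also have "(l powr real j * \<bar>t - s\<bar>) powr \<alpha> = l powr (real j * \<alpha>) * \<bar>t - s\<bar> powr \<alpha>"
      by (simp add: powr_mult powr_powr)
    finally have "\<bar>Q\<bar> * \<bar>sin (l ^ j * t + u) - sin (l ^ j * s + u)\<bar>
      \<le> l powr (- real j * h) * (2 * (l powr (real j * \<alpha>) * \<bar>t - s\<bar> powr \<alpha>))"
      using Q by (intro mult_mono) auto
    also have "\<dots> = 2 * ((l powr (- real j * h) * l powr (real j * \<alpha>)) * \<bar>t - s\<bar> powr \<alpha>)"
      by simp
    also have "\<dots> = 2 * E"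
      unfolding E_def powr_add[symmetric] by (simp add: algebra_simps)
    finally show ?thesis
      by (simp add: abs_mult)
  qed
  have "weierstrass_coeff l H j t u - weierstrass_coeff l H j s u
    = (P - Q) * sin (l ^ j * t + u) + Q * (sin (l ^ j * t + u) - sin (l ^ j * s + u))"
    by (simp add: weierstrass_coeff_def P_def Q_def algebra_simps)
  also have "\<bar>\<dots>\<bar> \<le> \<bar>(P - Q) * sin (l ^ j * t + u)\<bar> + \<bar>Q * (sin (l ^ j * t + u) - sin (l ^ j * s + u))\<bar>"
    by (rule abs_triangle_ineq)
  also have "\<dots> \<le> \<bar>P - Q\<bar> * 1 + 2 * E"
    using QS by (intro add_mono) (auto simp: abs_mult intro: mult_left_le)
  also have "\<dots> \<le> C * ln l * real j * E + 2 * (real j * E)"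
    using PQ E j mult_right_mono[of 1 "real j" E] by (intro add_mono) auto
  also have "\<dots> = (C * ln l + 2) * real j * E"
    by (simp add: algebra_simps)
  finally show ?thesis
    by (simp add: E_def mult.assoc)
qed

section \<open>Summability over the scales and choice of a scale\<close>

lemma summable_square_powr:
  fixes l \<epsilon> :: real
  assumes l: "l > 1" and \<epsilon>: "\<epsilon> > 0"
  shows "summable (\<lambda>j. (real (Suc j))\<^sup>2 * l powr (- \<epsilon> * real (Suc j)))"
proof (rule summable_comparison_test')
  \<comment> \<open>With this \<open>d\<close> the decay is \<open>exp (- (4 * d * x))\<close>; half
    of it absorbs \<open>x\<^sup>2\<close>, by \<open>d * x \<le> exp (d * x)\<close>, and the other
    half is geometric.\<close>
  define d where "d = \<epsilon> * ln l / 4"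
  have d: "d > 0" using l \<epsilon> by (simp add: d_def)
  show "summable (\<lambda>j. (1 / d)\<^sup>2 * exp (- (2 * d)) ^ j)"
    using d by (intro summable_mult summable_geometric) auto
  fix j :: nat
  define x where "x = real (Suc j)"
  have x: "x \<ge> 1" by (simp add: x_def)
  have "d * x \<le> exp (d * x)"
    using exp_ge_add_one_self[of "d * x"] by linarith
  then have "x \<le> exp (d * x) / d"
    using d by (simp add: field_simps)
  then have "x\<^sup>2 \<le> (exp (d * x) / d)\<^sup>2"
    using x by (intro power_mono) auto
  also have "\<dots> = (1 / d)\<^sup>2 * exp (2 * d * x)"
    using exp_add[of "d * x" "d * x"] by (simp add: power2_eq_square mult.assoc)
  finally have "x\<^sup>2 * exp (- (4 * d * x)) \<le> (1 / d)\<^sup>2 * exp (2 * d * x) * exp (- (4 * d * x))"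
    by (intro mult_right_mono) auto
  also have "\<dots> = (1 / d)\<^sup>2 * exp (- (2 * d * x))"
    using exp_add[of "2 * d * x" "- (4 * d * x)"] by (simp add: mult.assoc)
  also have "\<dots> \<le> (1 / d)\<^sup>2 * exp (- (2 * d * real j))"
    using d by (intro mult_left_mono) (auto simp: x_def)
  also have "exp (- (2 * d * real j)) = exp (- (2 * d)) ^ j"
    using exp_of_nat2_mult[of "- (2 * d)" j] by simp
  also have "exp (- (4 * d * x)) = l powr (- \<epsilon> * x)"
    using l by (simp add: d_def powr_def mult_ac)
  finally show "norm ((real (Suc j))\<^sup>2 * l powr (- \<epsilon> * real (Suc j))) \<le> (1 / d)\<^sup>2 * exp (- (2 * d)) ^ j"
    by (simp add: x_def)
qed

lemma summable_linear_powr: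
  fixes l \<epsilon> :: real
  assumes "l > 1" "\<epsilon> > 0"
  shows "summable (\<lambda>j. real (Suc j) * l powr (- \<epsilon> * real (Suc j)))"
proof (rule summable_comparison_test'[OF summable_square_powr[OF assms]])
  fix j :: nat
  have "real (Suc j) * 1 \<le> real (Suc j) * real (Suc j)"
    by (intro mult_left_mono) auto
  then show "norm (real (Suc j) * l powr (- \<epsilon> * real (Suc j))) \<le> (real (Suc j))\<^sup>2 * l powr (- \<epsilon> * real (Suc j))"
    by (simp add: power2_eq_square mult_right_mono)
qed

text \<open>\<open>j\<close> is the last exponent before \<open>l ^ n * r\<close> exceeds 1. The
  assumption \<open>l * r \<le> 1\<close> ensures \<open>j \<ge> 1\<close>, where the Weierstrass
  series begins.\<close>

lemma ex_power_scale:
  fixes l r :: real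
  assumes l: "l > 1" and r: "0 < r" "l * r \<le> 1"
  obtains j :: nat where "j \<ge> 1" "l ^ j * r \<le> 1" "1 < l ^ Suc j * r"
proof -
  obtain n0 where "1 / r < l ^ n0"
    using real_arch_pow[OF l] by blast
  then have ex: "\<exists>n. 1 < l ^ n * r"
    using r by (auto simp: field_simps)
  define n where "n = (LEAST n. 1 < l ^ n * r)"
  have n: "1 < l ^ n * r"
    unfolding n_def using ex by (rule LeastI_ex)
  have less: "l ^ k * r \<le> 1" if "k < n" for k
    using not_less_Least[of k "\<lambda>n. 1 < l ^ n * r"] that by (simp add: n_def not_less)
  have "r \<le> 1"
    using mult_right_mono[of 1 l r] l r by linarith
  then have "n \<noteq> 0"
    using n by (intro notI) simp
  moreover have "n \<noteq> 1"
    using n r by (intro notI) simp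
  ultimately show thesis
    using that[of "n - 1"] n less[of "n - 1"] by (cases n) auto
qed

lemma weierstrass_coeff_amplitude:
  fixes l h s t :: real and H :: "real \<Rightarrow> real"
  assumes l: "l > 1" and st: "s \<noteq> t" "l * \<bar>t - s\<bar> \<le> 1"
    and h: "0 \<le> h" "H s \<le> h" "H t \<le> h"
  obtains j A \<phi> where "j \<ge> 1" "2 / (pi * l) * \<bar>t - s\<bar> powr h \<le> A"
    "\<And>u. weierstrass_coeff l H j t u - weierstrass_coeff l H j s u = A * sin (u + \<phi>)"
proof -
  define r where "r = \<bar>t - s\<bar>"
  have r: "r > 0" "l * r \<le> 1" using st by (auto simp: r_def)
  obtain j :: nat where j: "j \<ge> 1" "l ^ j * r \<le> 1" "1 < l ^ Suc j * r"
    using ex_power_scale[OF l r] by blast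
  have lj: "l ^ j = l powr real j"
    using l by (simp add: powr_realpow)
  define p where "p = l powr (- real j * H t)"
  define q where "q = l powr (- real j * H s)"
  have pq: "p \<ge> r powr h" "q \<ge> r powr h"
  proof -
    \<comment> \<open>This end of the scale condition, \<open>l ^ j * r \<le> 1\<close>, keeps the
      amplitudes large.\<close>
    have "r \<le> l powr (- real j)"
      using j(2) l unfolding lj by (simp add: powr_minus field_simps)
    then have "r powr h \<le> (l powr (- real j)) powr h"
      using r h by (intro powr_mono2) auto
    also have "\<dots> = l powr (- real j * h)"
      by (simp add: powr_powr)
    finally have *: "r powr h \<le> l powr (- real j * h)" .
    have "l powr (- real j * h) \<le> p" "l powr (- real j * h) \<le> q"
      unfolding p_def q_def using l h by (auto intro!: powr_mono mult_left_mono)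
    with * show "p \<ge> r powr h" "q \<ge> r powr h" by auto
  qed
  define D where "D = \<bar>sin ((l ^ j * t - l ^ j * s) / 2)\<bar>"
  have D: "1 / (pi * l) \<le> D"
  proof -
    have eq: "\<bar>(l ^ j * t - l ^ j * s) / 2\<bar> = l ^ j * r / 2"
      using l by (simp add: r_def abs_mult flip: right_diff_distrib)
    \<comment> \<open>The other end, \<open>1 < l ^ Suc j * r\<close>, keeps half the phase
      difference away from 0; being at most \<open>1 / 2\<close>, it is also within reach of
      Jordan's inequality.\<close>
    have "1 / (pi * l) \<le> 2 / pi * (l ^ j * r / 2)"
      using j l by (simp add: field_simps)
    also have "\<dots> \<le> D"
      using j(2) pi_gt3 abs_sin_ge_linear[of "(l ^ j * t - l ^ j * s) / 2"] unfolding eq D_def by auto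
    finally show ?thesis .
  qed
  obtain A \<phi> where A: "0 \<le> A" "A\<^sup>2 = (p - q)\<^sup>2 + 4 * p * q * (sin ((l ^ j * t - l ^ j * s) / 2))\<^sup>2"
    "\<And>u. p * sin (l ^ j * t + u) - q * sin (l ^ j * s + u) = A * sin (u + \<phi>)"
    using sin_combination[of p q "l ^ j * t" "l ^ j * s"] by blast
  have "(2 / (pi * l) * r powr h)\<^sup>2 = 4 * (r powr h * r powr h) * (1 / (pi * l))\<^sup>2"
    by (simp add: power2_eq_square field_simps)
  also have "\<dots> \<le> 4 * (p * q) * D\<^sup>2"
    using pq D l by (intro mult_mono power_mono mult_nonneg_nonneg) (auto simp: p_def q_def)
  also have "\<dots> \<le> A\<^sup>2"
    unfolding A D_def by simp
  finally have "2 / (pi * l) * r powr h \<le> A"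
    using A(1) by (rule power2_le_imp_le)
  then show thesis
    using that[of j A \<phi>] j A(3) by (simp add: r_def weierstrass_coeff_def p_def q_def)
qed

section \<open>Thresholds of the local exponents\<close>

text \<open>Nothing is asked at \<open>a\<close> itself, which suits estimates that lose an
  arbitrarily small power.\<close>

lemma Sup_ennreal_threshold:
  fixes a :: real
  assumes a: "a > 0" and below: "\<And>\<alpha>. 0 < \<alpha> \<Longrightarrow> \<alpha> < a \<Longrightarrow> P \<alpha>" and above: "\<And>\<alpha>. a < \<alpha> \<Longrightarrow> \<not> P \<alpha>"
  shows "Sup {ennreal \<alpha> |\<alpha>. \<alpha> > 0 \<and> P \<alpha>} = ennreal a"
proof (rule antisym)
  show "Sup {ennreal \<alpha> |\<alpha>. \<alpha> > 0 \<and> P \<alpha>} \<le> ennreal a"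
    using above by (intro Sup_least) (auto intro!: ennreal_leI intro: leI)
  show "ennreal a \<le> Sup {ennreal \<alpha> |\<alpha>. \<alpha> > 0 \<and> P \<alpha>}"
  proof (rule ennreal_le_epsilon)
    fix e :: real assume e: "0 < e"
    \<comment> \<open>The maximum with \<open>a / 2\<close> keeps \<open>\<alpha>\<close> positive
      when \<open>e\<close> is large.\<close>
    define \<alpha> where "\<alpha> = max (a / 2) (a - e)"
    have \<alpha>: "0 < \<alpha>" "\<alpha> < a" "a \<le> \<alpha> + e"
      using a e by (auto simp: \<alpha>_def)
    have "ennreal a \<le> ennreal (\<alpha> + e)"
      using \<alpha> by (intro ennreal_leI)
    also have "\<dots> = ennreal \<alpha> + ennreal e"
      using \<alpha> e by simp
    also have "ennreal \<alpha> \<le> Sup {ennreal \<alpha> |\<alpha>. \<alpha> > 0 \<and> P \<alpha>}"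
      using \<alpha> below by (intro Sup_upper) auto
    finally show "ennreal a \<le> Sup {ennreal \<alpha> |\<alpha>. \<alpha> > 0 \<and> P \<alpha>} + ennreal e"
      by (simp add: add_right_mono)
  qed
qed

lemma Inf_ennreal_threshold:
  fixes a :: real
  assumes a: "a > 0" and below: "\<And>\<alpha>. 0 < \<alpha> \<Longrightarrow> \<alpha> < a \<Longrightarrow> \<not> P \<alpha>" and above: "\<And>\<alpha>. a < \<alpha> \<Longrightarrow> P \<alpha>"
  shows "Inf {ennreal \<alpha> |\<alpha>. \<alpha> > 0 \<and> P \<alpha>} = ennreal a"
proof (rule antisym)
  show "ennreal a \<le> Inf {ennreal \<alpha> |\<alpha>. \<alpha> > 0 \<and> P \<alpha>}"
    using below by (intro Inf_greatest) (auto intro!: ennreal_leI intro: leI)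
  show "Inf {ennreal \<alpha> |\<alpha>. \<alpha> > 0 \<and> P \<alpha>} \<le> ennreal a"
  proof (rule ennreal_le_epsilon)
    fix e :: real assume e: "0 < e"
    have "Inf {ennreal \<alpha> |\<alpha>. \<alpha> > 0 \<and> P \<alpha>} \<le> ennreal (a + e)"
      using a e above[of "a + e"] by (intro Inf_lower CollectI exI[of _ "a + e"]) auto
    then show "Inf {ennreal \<alpha> |\<alpha>. \<alpha> > 0 \<and> P \<alpha>} \<le> ennreal a + ennreal e"
      using a e by simp
  qed
qed

text \<open>All balls around \<open>t\<^sub>0\<close> share a pair of distinct points with any
  smaller ball. This makes each one-sided estimate count twice: a finite upper limit bounds the
  lower one, and an infinite lower limit forces the upper one.\<close>

lemma inf_increment_ratio_le_sup:
  assumes "t\<^sub>0 \<ge> 0"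
  shows "(SUP \<rho>\<in>{0<..}. inf_increment_ratio M X \<alpha> t\<^sub>0 \<rho>) \<le> (INF \<rho>\<in>{0<..}. sup_increment_ratio M X \<alpha> t\<^sub>0 \<rho>)"
proof (intro SUP_least INF_greatest)
  fix \<rho> \<rho>' :: real assume \<rho>: "\<rho> \<in> {0<..}" "\<rho>' \<in> {0<..}"
  \<comment> \<open>To the right of \<open>t\<^sub>0\<close>, hence in the half-line even when
    \<open>t\<^sub>0 = 0\<close>.\<close>
  define t where "t = t\<^sub>0 + min \<rho> \<rho>' / 2"
  have "t \<noteq> t\<^sub>0" "\<bar>t\<^sub>0 - t\<bar> < \<rho>" "\<bar>t\<^sub>0 - t\<bar> < \<rho>'" "t \<ge> 0"
    using \<rho> assms by (auto simp: t_def)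
  then have "(t\<^sub>0, t) \<in> distinct_pairs (half_line_ball t\<^sub>0 \<rho>)" "(t\<^sub>0, t) \<in> distinct_pairs (half_line_ball t\<^sub>0 \<rho>')"
    using \<rho> assms by (auto simp: distinct_pairs_def half_line_ball_def dist_real_def)
  then have "inf_increment_ratio M X \<alpha> t\<^sub>0 \<rho> \<le> increment_ratio M X \<alpha> t\<^sub>0 t"
    "increment_ratio M X \<alpha> t\<^sub>0 t \<le> sup_increment_ratio M X \<alpha> t\<^sub>0 \<rho>'"
    unfolding inf_increment_ratio_def sup_increment_ratio_def
    by (auto intro: INF_lower2 SUP_upper2)
  then show "inf_increment_ratio M X \<alpha> t\<^sub>0 \<rho> \<le> sup_increment_ratio M X \<alpha> t\<^sub>0 \<rho>'"
    by (rule order_trans)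
qed

section \<open>Path regularity and increments\<close>

text \<open>The conditions on \<open>H\<close> are imposed on the whole line to avoid a boundary at
  0; the final theorem enters by extending \<open>H\<close>. The phases occur jointly only as one
  family independent of the family \<open>Z\<close>.\<close>

locale gaussian_weierstrass = prob_space M for M :: "'a measure" +
  fixes Z \<theta> :: "nat \<Rightarrow> 'a \<Rightarrow> real" and H :: "real \<Rightarrow> real" and l \<beta> C :: real
  assumes l: "l > 1" and \<beta>: "\<beta> > 0" and C: "C \<ge> 0"
    and H: "0 < H t" "H t < 1" "H t < \<beta>"
    and holder: "\<bar>H t - H s\<bar> \<le> C * \<bar>t - s\<bar> powr \<beta>"
    and indep_Z: "indep_vars (\<lambda>_. borel) Z {1..}"
    and normal_Z: "\<And>j. j \<ge> 1 \<Longrightarrow> distributed M lborel (Z j) std_normal_density"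
    and uniform_\<theta>: "\<And>j. j \<ge> 1 \<Longrightarrow> distr M lborel (\<theta> j) = uniform_measure lborel {0..<2 * pi}"
    and measurable_\<theta>: "\<And>j. j \<ge> 1 \<Longrightarrow> \<theta> j \<in> borel_measurable M"
    and indep_\<theta>_Z: "indep_var (PiM {1..} (\<lambda>_. borel)) (\<lambda>\<omega>. \<lambda>j\<in>{1..}. \<theta> j \<omega>)
           (PiM {1..} (\<lambda>_. borel)) (\<lambda>\<omega>. \<lambda>j\<in>{1..}. Z j \<omega>)"
begin

abbreviation coeff :: "nat \<Rightarrow> real \<Rightarrow> real \<Rightarrow> real" where
  "coeff \<equiv> weierstrass_coeff l H"

abbreviation X :: "real \<Rightarrow> 'a \<Rightarrow> real" where
  "X \<equiv> weierstrass_process l H Z \<theta>"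

abbreviation phase_law :: "(nat \<Rightarrow> real) measure" where
  "phase_law \<equiv> distr M (PiM {1..} (\<lambda>_. borel)) (\<lambda>\<omega>. \<lambda>j\<in>{1..}. \<theta> j \<omega>)"

abbreviation weight_law :: "nat \<Rightarrow> (nat \<Rightarrow> real) measure" where
  "weight_law i \<equiv> distr M (PiM ({1..} - {i}) (\<lambda>_. borel)) (\<lambda>\<omega>. \<lambda>j\<in>{1..} - {i}. Z j \<omega>)"

lemma continuous_H: "continuous_on UNIV H"
proof -
  have "(\<lambda>s. C * \<bar>t - s\<bar> powr \<beta>) \<midarrow>t\<rightarrow> C * \<bar>t - t\<bar> powr \<beta>" for t
    using \<beta> by (intro tendsto_intros) auto
  then have lim: "(\<lambda>s. C * \<bar>t - s\<bar> powr \<beta>) \<midarrow>t\<rightarrow> 0" for t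
    by simp
  have "H \<midarrow>t\<rightarrow> H t" for t
  proof (rule LIM_zero_cancel, rule Lim_null_comparison[OF _ lim])
    show "\<forall>\<^sub>F s in at t. norm (H s - H t) \<le> C * \<bar>t - s\<bar> powr \<beta>"
      using holder by (auto simp: abs_minus_commute intro!: always_eventually)
  qed
  then show ?thesis
    by (simp add: continuous_on_def)
qed

lemma measurable_H[measurable]: "H \<in> borel_measurable borel"
  using continuous_H by (rule borel_measurable_continuous_onI)

lemma measurable_Z[measurable]: "Z (Suc j) \<in> borel_measurable M"
  using distributed_measurable[OF normal_Z[of "Suc j"]] by simp

lemma measurable_\<theta>'[measurable]: "\<theta> (Suc j) \<in> borel_measurable M"
  by (rule measurable_\<theta>) simp

lemma measurable_coeff[measurable (raw)]:
  assumes [measurable]: "f \<in> borel_measurable N" "g \<in> borel_measurable N"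
  shows "(\<lambda>x. coeff j (f x) (g x)) \<in> borel_measurable N"
  unfolding weierstrass_coeff_def by measurable

lemma measurable_X[measurable (raw)]:
  assumes [measurable]: "f \<in> borel_measurable N" "g \<in> measurable N M"
  shows "(\<lambda>x. X (f x) (g x)) \<in> borel_measurable N"
  unfolding weierstrass_process_eq by measurable

lemma nn_integral_Z_square: "(\<integral>\<^sup>+\<omega>. ennreal ((Z (Suc j) \<omega>)\<^sup>2) \<partial>M) = 1"
  using distributed_nn_integral[OF normal_Z[of "Suc j"], of "\<lambda>z. ennreal (z\<^sup>2)"]
    nn_integral_gauss_affine_square[of 1 0] by simp

text \<open>The series of \<open>(Z j)\<^sup>2 / j\<^sup>2\<close> has finite expectation, so almost
  surely it converges and each term is at most its sum. Linear growth is crude but harmless next to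
  geometric decay.\<close>

lemma AE_Z_linear_growth: "AE \<omega> in M. \<exists>K\<ge>0. \<forall>j. \<bar>Z (Suc j) \<omega>\<bar> \<le> K * real (Suc j)"
proof -
  define T where "T \<omega> = (\<Sum>j. ennreal (inverse ((real (Suc j))\<^sup>2)) * ennreal ((Z (Suc j) \<omega>)\<^sup>2))" for \<omega>
  have "(\<integral>\<^sup>+\<omega>. T \<omega> \<partial>M) = (\<Sum>j. ennreal (inverse ((real (Suc j))\<^sup>2)))"
    unfolding T_def by (subst nn_integral_suminf) (auto simp: nn_integral_cmult nn_integral_Z_square)
  also have "summable (\<lambda>j. inverse ((real (Suc j))\<^sup>2))"
    using inverse_power_summable[of 2, where 'a = real] summable_Suc_iff[of "\<lambda>n. inverse ((real n)\<^sup>2)"] by auto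
  then have "(\<Sum>j. ennreal (inverse ((real (Suc j))\<^sup>2))) \<noteq> \<infinity>"
    by (subst suminf_ennreal2) auto
  finally have "AE \<omega> in M. T \<omega> \<noteq> \<infinity>"
    by (intro nn_integral_PInf_AE) (auto simp: T_def)
  then show ?thesis
  proof eventually_elim
    case (elim \<omega>)
    then obtain K where K: "K \<ge> 0" "T \<omega> = ennreal K"
      by (cases "T \<omega>") auto
    have "\<bar>Z (Suc j) \<omega>\<bar> \<le> sqrt K * real (Suc j)" for j
    proof -
      have "(\<Sum>i\<in>{j}. ennreal (inverse ((real (Suc i))\<^sup>2)) * ennreal ((Z (Suc i) \<omega>)\<^sup>2)) \<le> T \<omega>"
        unfolding T_def by (intro sum_le_suminf) auto
      then have "ennreal (inverse ((real (Suc j))\<^sup>2) * (Z (Suc j) \<omega>)\<^sup>2) \<le> ennreal K"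
        by (simp add: K ennreal_mult)
      then have "inverse ((real (Suc j))\<^sup>2) * (Z (Suc j) \<omega>)\<^sup>2 \<le> K"
        using K by (subst (asm) ennreal_le_iff) auto
      then have "(Z (Suc j) \<omega>)\<^sup>2 \<le> K * (real (Suc j))\<^sup>2"
        by (simp add: field_simps del: of_nat_Suc)
      then have "sqrt ((Z (Suc j) \<omega>)\<^sup>2) \<le> sqrt (K * (real (Suc j))\<^sup>2)"
        by (rule real_sqrt_le_mono)
      then show ?thesis
        by (simp add: real_sqrt_mult)
    qed
    then show ?case
      using K by (intro exI[of _ "sqrt K"]) auto
  qed
qed

text \<open>A divergent \<open>suminf\<close> has an unspecified value, so increments of
  \<open>X\<close> may be taken term by term only after this.\<close>

lemma summable_X:
  assumes "\<And>j. \<bar>Z (Suc j) \<omega>\<bar> \<le> K * real (Suc j)"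
  shows "summable (\<lambda>j. Z (Suc j) \<omega> * coeff (Suc j) t (\<theta> (Suc j) \<omega>))"
proof (rule summable_comparison_test')
  show "summable (\<lambda>j. K * (real (Suc j) * l powr (- H t * real (Suc j))))"
    using l H by (intro summable_mult summable_linear_powr)
  fix j
  have "\<bar>coeff (Suc j) t (\<theta> (Suc j) \<omega>)\<bar> \<le> l powr (- H t * real (Suc j)) * 1"
    unfolding weierstrass_coeff_def abs_mult
    by (intro mult_mono) (auto simp: mult.commute simp del: of_nat_Suc)
  then have "\<bar>Z (Suc j) \<omega>\<bar> * \<bar>coeff (Suc j) t (\<theta> (Suc j) \<omega>)\<bar> \<le> (K * real (Suc j)) * l powr (- H t * real (Suc j))"
    by (intro mult_mono assms order_trans[OF abs_ge_zero assms]) auto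
  then show "norm (Z (Suc j) \<omega> * coeff (Suc j) t (\<theta> (Suc j) \<omega>)) \<le> K * (real (Suc j) * l powr (- H t * real (Suc j)))"
    by (simp add: abs_mult mult.assoc)
qed

lemma coeff_diff_le:
  assumes "0 \<le> \<alpha>" "\<alpha> \<le> h" "h \<le> H s" "h \<le> H t" "\<bar>t - s\<bar> \<le> 1"
  shows "\<bar>coeff (Suc j) t u - coeff (Suc j) s u\<bar>
    \<le> (C * ln l + 2) * real (Suc j) * l powr (- (h - \<alpha>) * real (Suc j)) * \<bar>t - s\<bar> powr \<alpha>"
  using assms H[of s] l C by (intro weierstrass_coeff_diff_le[where \<beta> = \<beta>] holder) auto

lemma path_holder:
  assumes Z: "K \<ge> 0" "\<And>j. \<bar>Z (Suc j) \<omega>\<bar> \<le> K * real (Suc j)" and \<alpha>: "0 \<le> \<alpha>" "\<alpha> < h"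
  obtains D where "D \<ge> 0" "\<And>s t. h \<le> H s \<Longrightarrow> h \<le> H t \<Longrightarrow> \<bar>t - s\<bar> \<le> 1 \<Longrightarrow> \<bar>X t \<omega> - X s \<omega>\<bar> \<le> D * \<bar>t - s\<bar> powr \<alpha>"
proof
  \<comment> \<open>One factor \<open>Suc j\<close> comes from the growth of \<open>Z\<close>, the
    other from \<open>coeff_diff_le\<close>. The constant built from \<open>B\<close> does not
    depend on \<open>s\<close> and \<open>t\<close>.\<close>
  define B where "B j = (real (Suc j))\<^sup>2 * l powr (- (h - \<alpha>) * real (Suc j))" for j
  have B: "summable B"
    unfolding B_def using l \<alpha> by (intro summable_square_powr) auto
  define c where "c = K * (C * ln l + 2)"
  have c: "c \<ge> 0"
    using Z(1) C l by (simp add: c_def)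
  show "c * suminf B \<ge> 0"
    using c B by (intro mult_nonneg_nonneg suminf_nonneg) (auto simp: B_def)
  fix s t assume st: "h \<le> H s" "h \<le> H t" "\<bar>t - s\<bar> \<le> 1"
  define d where "d j = Z (Suc j) \<omega> * coeff (Suc j) t (\<theta> (Suc j) \<omega>) - Z (Suc j) \<omega> * coeff (Suc j) s (\<theta> (Suc j) \<omega>)" for j
  have d: "\<bar>d j\<bar> \<le> c * \<bar>t - s\<bar> powr \<alpha> * B j" for j
  proof -
    have "\<bar>d j\<bar> = \<bar>Z (Suc j) \<omega>\<bar> * \<bar>coeff (Suc j) t (\<theta> (Suc j) \<omega>) - coeff (Suc j) s (\<theta> (Suc j) \<omega>)\<bar>"
      by (simp add: d_def abs_mult flip: right_diff_distrib)
    also have "\<dots> \<le> (K * real (Suc j)) * ((C * ln l + 2) * real (Suc j) * l powr (- (h - \<alpha>) * real (Suc j)) * \<bar>t - s\<bar> powr \<alpha>)"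
      using Z \<alpha> st by (intro mult_mono coeff_diff_le order_trans[OF abs_ge_zero Z(2)]) auto
    also have "\<dots> = c * \<bar>t - s\<bar> powr \<alpha> * B j"
      by (simp add: c_def B_def power2_eq_square mult_ac)
    finally show ?thesis .
  qed
  have "X t \<omega> - X s \<omega> = suminf d"
    unfolding weierstrass_process_eq d_def using Z by (intro suminf_diff summable_X)
  also have "\<bar>\<dots>\<bar> \<le> (\<Sum>j. c * \<bar>t - s\<bar> powr \<alpha> * B j)"
  proof -
    have B': "summable (\<lambda>j. c * \<bar>t - s\<bar> powr \<alpha> * B j)"
      by (intro summable_mult B)
    have "summable (\<lambda>j. \<bar>d j\<bar>)"
      by (rule summable_comparison_test'[OF B']) (use d in auto)
    then show ?thesis
      using B' d by (intro order_trans[OF summable_rabs suminf_le]) auto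
  qed
  also have "\<dots> = c * suminf B * \<bar>t - s\<bar> powr \<alpha>"
    using B by (subst suminf_mult) auto
  finally show "\<bar>X t \<omega> - X s \<omega>\<bar> \<le> c * suminf B * \<bar>t - s\<bar> powr \<alpha>" .
qed

text \<open>Cauchy-Schwarz with weights \<open>B j\<close> bounds the squared sum by
  \<open>S\<close> times the sum of \<open>B j * (Z (Suc j))\<^sup>2\<close>. Its expectation
  requires only the second moments of single weights, so no mixed products have to be
  evaluated.\<close>

lemma moment_le:
  assumes \<alpha>: "0 \<le> \<alpha>" "\<alpha> < h"
  obtains D where "D \<ge> 0" "\<And>s t. h \<le> H s \<Longrightarrow> h \<le> H t \<Longrightarrow> \<bar>t - s\<bar> \<le> 1 \<Longrightarrow>
    (\<integral>\<^sup>+\<omega>. ennreal (\<bar>X t \<omega> - X s \<omega>\<bar>\<^sup>2) \<partial>M) \<le> ennreal (D * \<bar>t - s\<bar> powr (2 * \<alpha>))"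
proof
  define B where "B j = (C * ln l + 2) * (real (Suc j) * l powr (- (h - \<alpha>) * real (Suc j)))" for j
  have B: "summable B"
    unfolding B_def using l \<alpha> by (intro summable_mult summable_linear_powr) auto
  have B0: "B j \<ge> 0" for j
    using l C by (simp add: B_def)
  define S where "S = suminf B"
  have S0: "S \<ge> 0"
    unfolding S_def by (intro suminf_nonneg B B0)
  show "S\<^sup>2 \<ge> 0" by simp
  fix s t assume st: "h \<le> H s" "h \<le> H t" "\<bar>t - s\<bar> \<le> 1"
  define T where "T \<omega> = (\<Sum>j. ennreal (B j) * ennreal ((Z (Suc j) \<omega>)\<^sup>2))" for \<omega>
  define R where "R = \<bar>t - s\<bar> powr \<alpha>"
  have R0: "R \<ge> 0" by (simp add: R_def)
  have "AE \<omega> in M. ennreal (\<bar>X t \<omega> - X s \<omega>\<bar>\<^sup>2) \<le> ennreal (R\<^sup>2 * S) * T \<omega>"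
    using AE_Z_linear_growth
  proof eventually_elim
    case (elim \<omega>)
    then obtain K where K: "\<And>j. \<bar>Z (Suc j) \<omega>\<bar> \<le> K * real (Suc j)" by auto
    define d where "d j = Z (Suc j) \<omega> * coeff (Suc j) t (\<theta> (Suc j) \<omega>) - Z (Suc j) \<omega> * coeff (Suc j) s (\<theta> (Suc j) \<omega>)" for j
    have d: "\<bar>d j\<bar> \<le> R * (B j * \<bar>Z (Suc j) \<omega>\<bar>)" for j
    proof -
      have "\<bar>d j\<bar> = \<bar>coeff (Suc j) t (\<theta> (Suc j) \<omega>) - coeff (Suc j) s (\<theta> (Suc j) \<omega>)\<bar> * \<bar>Z (Suc j) \<omega>\<bar>"
        by (simp add: d_def abs_mult mult.commute flip: right_diff_distrib)
      also have "\<dots> \<le> ((C * ln l + 2) * real (Suc j) * l powr (- (h - \<alpha>) * real (Suc j)) * \<bar>t - s\<bar> powr \<alpha>) * \<bar>Z (Suc j) \<omega>\<bar>"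
        using \<alpha> st by (intro mult_right_mono coeff_diff_le) auto
      also have "\<dots> = R * (B j * \<bar>Z (Suc j) \<omega>\<bar>)"
        by (simp add: R_def B_def mult_ac)
      finally show ?thesis .
    qed
    have "d sums (X t \<omega> - X s \<omega>)"
      unfolding weierstrass_process_eq d_def using K by (intro sums_diff summable_sums summable_X)
    then have "(\<lambda>n. ennreal (\<bar>\<Sum>j<n. d j\<bar>\<^sup>2)) \<longlonglongrightarrow> ennreal (\<bar>X t \<omega> - X s \<omega>\<bar>\<^sup>2)"
      unfolding sums_def by (intro tendsto_ennrealI tendsto_intros)
    moreover have "ennreal (\<bar>\<Sum>j<n. d j\<bar>\<^sup>2) \<le> ennreal (R\<^sup>2 * S) * T \<omega>" for n
    proof -
      have "\<bar>\<Sum>j<n. d j\<bar> \<le> (\<Sum>j<n. \<bar>d j\<bar>)"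
        by (rule sum_abs)
      also have "\<dots> \<le> (\<Sum>j<n. R * (B j * \<bar>Z (Suc j) \<omega>\<bar>))"
        by (intro sum_mono d)
      \<comment> \<open>Splitting \<open>B j\<close> into two square roots gives the factors for the
        weighted Cauchy-Schwarz inequality.\<close>
      also have "\<dots> = R * (\<Sum>j<n. sqrt (B j) * (sqrt (B j) * \<bar>Z (Suc j) \<omega>\<bar>))"
        using B0 by (simp add: sum_distrib_left flip: mult.assoc)
      finally have "\<bar>\<Sum>j<n. d j\<bar>\<^sup>2 \<le> (R * (\<Sum>j<n. sqrt (B j) * (sqrt (B j) * \<bar>Z (Suc j) \<omega>\<bar>)))\<^sup>2"
        by (intro power_mono) auto
      also have "\<dots> \<le> R\<^sup>2 * ((\<Sum>j<n. (sqrt (B j))\<^sup>2) * (\<Sum>j<n. (sqrt (B j) * \<bar>Z (Suc j) \<omega>\<bar>)\<^sup>2))"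
        unfolding power_mult_distrib[of R] by (intro mult_left_mono Cauchy_Schwarz_ineq_sum) auto
      also have "\<dots> = R\<^sup>2 * ((\<Sum>j<n. B j) * (\<Sum>j<n. B j * (Z (Suc j) \<omega>)\<^sup>2))"
        using B0 by (simp add: power_mult_distrib)
      also have "\<dots> \<le> R\<^sup>2 * (S * (\<Sum>j<n. B j * (Z (Suc j) \<omega>)\<^sup>2))"
        unfolding S_def using B B0 by (intro mult_left_mono mult_right_mono sum_le_suminf sum_nonneg) auto
      finally have "ennreal (\<bar>\<Sum>j<n. d j\<bar>\<^sup>2) \<le> ennreal (R\<^sup>2 * (S * (\<Sum>j<n. B j * (Z (Suc j) \<omega>)\<^sup>2)))"
        by (rule ennreal_leI)
      also have "\<dots> = ennreal (R\<^sup>2 * S) * (\<Sum>j<n. ennreal (B j) * ennreal ((Z (Suc j) \<omega>)\<^sup>2))"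
        using B0 S0 by (simp add: ennreal_mult sum_nonneg mult.assoc flip: sum_ennreal)
      also have "\<dots> \<le> ennreal (R\<^sup>2 * S) * T \<omega>"
        unfolding T_def by (intro mult_left_mono sum_le_suminf) auto
      finally show ?thesis .
    qed
    ultimately show ?case
      by (blast intro: LIMSEQ_le_const2)
  qed
  then have "(\<integral>\<^sup>+\<omega>. ennreal (\<bar>X t \<omega> - X s \<omega>\<bar>\<^sup>2) \<partial>M) \<le> (\<integral>\<^sup>+\<omega>. ennreal (R\<^sup>2 * S) * T \<omega> \<partial>M)"
    by (rule nn_integral_mono_AE)
  also have "\<dots> = ennreal (R\<^sup>2 * S) * (\<Sum>j. ennreal (B j))"
    unfolding T_def by (simp add: nn_integral_cmult nn_integral_suminf nn_integral_Z_square)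
  also have "(\<Sum>j. ennreal (B j)) = ennreal S"
    unfolding S_def by (intro suminf_ennreal2 B0 B)
  also have "ennreal (R\<^sup>2 * S) * ennreal S = ennreal (S\<^sup>2 * \<bar>t - s\<bar> powr (2 * \<alpha>))"
  proof -
    have "R\<^sup>2 = \<bar>t - s\<bar> powr (2 * \<alpha>)"
      unfolding R_def power2_eq_square powr_add[symmetric] by simp
    then show ?thesis
      using S0 by (simp add: power2_eq_square mult_ac flip: ennreal_mult)
  qed
  finally show "(\<integral>\<^sup>+\<omega>. ennreal (\<bar>X t \<omega> - X s \<omega>\<bar>\<^sup>2) \<partial>M) \<le> ennreal (S\<^sup>2 * \<bar>t - s\<bar> powr (2 * \<alpha>))" .
qed

section \<open>Isolating one weight and one phase\<close>

text \<open>Two independences are combined: first of the phase family from the family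
  \<open>Z\<close>, then of \<open>Z i\<close> from the remaining weights. The integral over
  \<open>Z i\<close> is placed innermost because the Gaussian estimates hold with everything else
  frozen.\<close>

lemma nn_integral_split_coordinate:
  assumes i: "i \<ge> 1"
    and F[measurable]: "F \<in> borel_measurable
      (PiM {1..} (\<lambda>_. borel) \<Otimes>\<^sub>M (borel \<Otimes>\<^sub>M PiM ({1..} - {i}) (\<lambda>_. borel)))"
  shows "(\<integral>\<^sup>+\<omega>. F (\<lambda>j\<in>{1..}. \<theta> j \<omega>, (Z i \<omega>, \<lambda>j\<in>{1..} - {i}. Z j \<omega>)) \<partial>M) =
    (\<integral>\<^sup>+u. (\<integral>\<^sup>+w. (\<integral>\<^sup>+z. ennreal (std_normal_density z) * F (u, (z, w)) \<partial>lborel)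
      \<partial>weight_law i) \<partial>phase_law)"
proof -
  let ?P = "PiM {1..} (\<lambda>_. borel) :: (nat \<Rightarrow> real) measure"
  let ?J = "{1..} - {i}"
  let ?Q = "PiM ?J (\<lambda>_. borel) :: (nat \<Rightarrow> real) measure"
  let ?U = "\<lambda>\<omega>. \<lambda>j\<in>{1..}. \<theta> j \<omega>"
  let ?W = "\<lambda>\<omega>. \<lambda>j\<in>?J. Z j \<omega>"
  have [measurable]: "?U \<in> measurable M ?P"
    using indep_var_rv1[OF indep_\<theta>_Z] .
  have Zi[measurable]: "Z j \<in> borel_measurable M" if "j \<in> {1..}" for j
    using distributed_measurable[OF normal_Z[of j]] that by simp
  have Zi'[measurable]: "Z i \<in> borel_measurable M"
    using Zi i by auto
  have W[measurable]: "?W \<in> measurable M ?Q"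
    by (intro measurable_restrict Zi) auto
  let ?Z = "\<lambda>\<omega>. \<lambda>j\<in>{1..}. Z j \<omega>"
  \<comment> \<open>\<open>Z i\<close> is carried as a family indexed by \<open>{i}\<close>, the
    form in which \<open>indep_var_restrict\<close> separates it from the others.\<close>
  let ?S = "PiM {i} (\<lambda>_. borel) :: (nat \<Rightarrow> real) measure"
  let ?R = "\<lambda>\<omega>. \<lambda>j\<in>{i}. Z j \<omega>"
  have [measurable]: "?Z \<in> measurable M ?P"
    using indep_var_rv2[OF indep_\<theta>_Z] .
  have [measurable]: "?R \<in> measurable M ?S"
    by (intro measurable_restrict) (use i in auto)
  have [measurable]: "(\<lambda>v. v i) \<in> borel_measurable ?P" "(\<lambda>v. v i) \<in> borel_measurable ?S"
    "(\<lambda>v. restrict v ?J) \<in> measurable ?P ?Q"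
    using i by (auto intro!: measurable_component_singleton measurable_restrict_subset)
  have UZ: "distr M ?P ?U \<Otimes>\<^sub>M distr M ?P ?Z = distr M (?P \<Otimes>\<^sub>M ?P) (\<lambda>\<omega>. (?U \<omega>, ?Z \<omega>))"
    using indep_\<theta>_Z unfolding indep_var_distribution_eq by simp
  have "indep_var ?S ?R ?Q ?W"
    using i by (intro indep_var_restrict[OF indep_Z]) auto
  then have RW: "distr M ?S ?R \<Otimes>\<^sub>M distr M ?Q ?W = distr M (?S \<Otimes>\<^sub>M ?Q) (\<lambda>\<omega>. (?R \<omega>, ?W \<omega>))"
    unfolding indep_var_distribution_eq by simp
  interpret V: prob_space "distr M ?P ?Z" by (rule prob_space_distr) simp
  interpret R: prob_space "distr M ?S ?R" by (rule prob_space_distr) simp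
  interpret W: prob_space "distr M ?Q ?W" by (rule prob_space_distr) simp
  interpret RW: pair_sigma_finite "distr M ?S ?R" "distr M ?Q ?W" ..
  have i': "restrict (?Z \<omega>) ?J = ?W \<omega>" "?Z \<omega> i = Z i \<omega>" for \<omega>
    using i by (auto simp: fun_eq_iff restrict_def)
  have "(\<integral>\<^sup>+\<omega>. F (?U \<omega>, (Z i \<omega>, ?W \<omega>)) \<partial>M)
    = (\<integral>\<^sup>+\<omega>. (\<lambda>(u, v). F (u, (v i, restrict v ?J))) (?U \<omega>, ?Z \<omega>) \<partial>M)"
    unfolding i' prod.case ..
  also have "\<dots> = (\<integral>\<^sup>+x. (\<lambda>(u, v). F (u, (v i, restrict v ?J))) x \<partial>distr M (?P \<Otimes>\<^sub>M ?P) (\<lambda>\<omega>. (?U \<omega>, ?Z \<omega>)))"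
    by (subst nn_integral_distr) measurable
  also have "\<dots> = (\<integral>\<^sup>+u. (\<integral>\<^sup>+v. F (u, (v i, restrict v ?J)) \<partial>distr M ?P ?Z) \<partial>distr M ?P ?U)"
  proof -
    have "(\<lambda>(u, v). F (u, (v i, restrict v ?J))) \<in> borel_measurable (?P \<Otimes>\<^sub>M ?P)"
      by measurable
    then have "(\<lambda>(u, v). F (u, (v i, restrict v ?J))) \<in> borel_measurable (distr M ?P ?U \<Otimes>\<^sub>M distr M ?P ?Z)"
      by (subst measurable_cong_sets[OF sets_pair_measure_cong refl]) auto
    from V.nn_integral_fst[OF this] show ?thesis
      unfolding UZ[symmetric] by simp
  qed
  also have "\<dots> = (\<integral>\<^sup>+u. (\<integral>\<^sup>+w. (\<integral>\<^sup>+z. ennreal (std_normal_density z) * F (u, (z, w)) \<partial>lborel) \<partial>distr M ?Q ?W) \<partial>distr M ?P ?U)"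
  proof (rule nn_integral_cong)
    fix u assume "u \<in> space (distr M ?P ?U)"
    then have [measurable]: "u \<in> space ?P" by simp
    have "(\<integral>\<^sup>+v. F (u, (v i, restrict v ?J)) \<partial>distr M ?P ?Z) = (\<integral>\<^sup>+\<omega>. F (u, (?Z \<omega> i, restrict (?Z \<omega>) ?J)) \<partial>M)"
      by (subst nn_integral_distr) measurable
    also have "\<dots> = (\<integral>\<^sup>+\<omega>. (\<lambda>(v, w). F (u, (v i, w))) (?R \<omega>, ?W \<omega>) \<partial>M)"
      unfolding i' by simp
    also have "\<dots> = (\<integral>\<^sup>+x. (\<lambda>(v, w). F (u, (v i, w))) x \<partial>distr M (?S \<Otimes>\<^sub>M ?Q) (\<lambda>\<omega>. (?R \<omega>, ?W \<omega>)))"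
      by (subst nn_integral_distr) measurable
    also have "\<dots> = (\<integral>\<^sup>+w. (\<integral>\<^sup>+v. F (u, (v i, w)) \<partial>distr M ?S ?R) \<partial>distr M ?Q ?W)"
    proof -
      have "(\<lambda>(v, w). F (u, (v i, w))) \<in> borel_measurable (?S \<Otimes>\<^sub>M ?Q)"
        by measurable
      then have "(\<lambda>(v, w). F (u, (v i, w))) \<in> borel_measurable (distr M ?S ?R \<Otimes>\<^sub>M distr M ?Q ?W)"
        by (subst measurable_cong_sets[OF sets_pair_measure_cong refl]) auto
      from RW.nn_integral_snd[OF this] show ?thesis
        unfolding RW[symmetric] by simp
    qed
    also have "\<dots> = (\<integral>\<^sup>+w. (\<integral>\<^sup>+z. ennreal (std_normal_density z) * F (u, (z, w)) \<partial>lborel) \<partial>distr M ?Q ?W)"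
    proof (rule nn_integral_cong)
      fix w assume "w \<in> space (distr M ?Q ?W)"
      then have [measurable]: "w \<in> space ?Q" by simp
      have "(\<integral>\<^sup>+v. F (u, (v i, w)) \<partial>distr M ?S ?R) = (\<integral>\<^sup>+\<omega>. F (u, (Z i \<omega>, w)) \<partial>M)"
        by (subst nn_integral_distr) auto
      also have "\<dots> = (\<integral>\<^sup>+z. ennreal (std_normal_density z) * F (u, (z, w)) \<partial>lborel)"
        by (subst distributed_nn_integral[OF normal_Z[OF i]]) auto
      finally show "(\<integral>\<^sup>+v. F (u, (v i, w)) \<partial>distr M ?S ?R) = (\<integral>\<^sup>+z. ennreal (std_normal_density z) * F (u, (z, w)) \<partial>lborel)" .
    qed
    finally show "(\<integral>\<^sup>+v. F (u, (v i, restrict v ?J)) \<partial>distr M ?P ?Z)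
      = (\<integral>\<^sup>+w. (\<integral>\<^sup>+z. ennreal (std_normal_density z) * F (u, (z, w)) \<partial>lborel) \<partial>distr M ?Q ?W)" .
  qed
  finally show ?thesis .
qed

text \<open>Of the offset \<open>W\<close> only its independence of \<open>z\<close> is recorded:
  the Gaussian bounds applied afterwards are uniform in the offset.\<close>

lemma increment_split:
  assumes G[measurable]: "G \<in> borel_measurable borel"
  obtains W where "(\<integral>\<^sup>+\<omega>. G (X t \<omega> - X s \<omega>) \<partial>M) =
    (\<integral>\<^sup>+u. (\<integral>\<^sup>+w. (\<integral>\<^sup>+z. ennreal (std_normal_density z) *
        G ((coeff (Suc k) t (u (Suc k)) - coeff (Suc k) s (u (Suc k))) * z + W u w) \<partial>lborel) \<partial>weight_law (Suc k)) \<partial>phase_law)"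
proof
  let ?P = "PiM {1..} (\<lambda>_. borel) :: (nat \<Rightarrow> real) measure"
  let ?J = "{1..} - {Suc k}"
  let ?Q = "PiM ?J (\<lambda>_. borel) :: (nat \<Rightarrow> real) measure"
  define b where "b j u = coeff (Suc j) t (u (Suc j)) - coeff (Suc j) s (u (Suc j))" for j and u :: "nat \<Rightarrow> real"
  \<comment> \<open>Term \<open>k\<close> is set to 0 rather than removed, so the sum still runs
    over all naturals and never consults the missing coordinate \<open>Suc k\<close> of
    \<open>w\<close>.\<close>
  define W where "W u w = (\<Sum>j. if j = k then 0 else w (Suc j) * b j u)" for u w :: "nat \<Rightarrow> real"
  have [measurable]: "(\<lambda>u. u (Suc j)) \<in> borel_measurable ?P" for j
    by (intro measurable_component_singleton) auto
  have [measurable]: "b j \<in> borel_measurable ?P" for j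
    unfolding b_def by measurable
  have "(\<lambda>(u, w). if j = k then 0 else w (Suc j) * b j u) \<in> borel_measurable (?P \<Otimes>\<^sub>M ?Q)" for j
  proof (cases "j = k")
    case False
    then have [measurable]: "(\<lambda>w. w (Suc j)) \<in> borel_measurable ?Q"
      by (intro measurable_component_singleton) auto
    show ?thesis
      unfolding if_not_P[OF False] by measurable
  qed simp
  then have W[measurable]: "(\<lambda>(u, w). W u w) \<in> borel_measurable (?P \<Otimes>\<^sub>M ?Q)"
    unfolding W_def split_def by (intro borel_measurable_suminf)
  define F where "F = (\<lambda>(u, z, w). G (b k u * z + W u w))"
  have F: "F \<in> borel_measurable (?P \<Otimes>\<^sub>M (borel \<Otimes>\<^sub>M ?Q))"
    unfolding F_def by measurable
  \<comment> \<open>Only almost everywhere, since separating a term from a \<open>suminf\<close>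
    presupposes convergence.\<close>
  have "AE \<omega> in M. X t \<omega> - X s \<omega>
    = b k (\<lambda>j\<in>{1..}. \<theta> j \<omega>) * Z (Suc k) \<omega> + W (\<lambda>j\<in>{1..}. \<theta> j \<omega>) (\<lambda>j\<in>?J. Z j \<omega>)"
    using AE_Z_linear_growth
  proof eventually_elim
    case (elim \<omega>)
    then obtain K where K: "\<And>j. \<bar>Z (Suc j) \<omega>\<bar> \<le> K * real (Suc j)" by auto
    define d where "d j = Z (Suc j) \<omega> * coeff (Suc j) t (\<theta> (Suc j) \<omega>) - Z (Suc j) \<omega> * coeff (Suc j) s (\<theta> (Suc j) \<omega>)" for j
    have "d sums (X t \<omega> - X s \<omega>)"
      unfolding weierstrass_process_eq d_def using K by (intro sums_diff summable_sums summable_X)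
    then have "(\<lambda>j. d j - (if j = k then d j else 0)) sums (X t \<omega> - X s \<omega> - d k)"
      by (intro sums_diff sums_single)
    also have "(\<lambda>j. d j - (if j = k then d j else 0)) =
      (\<lambda>j. if j = k then 0 else (\<lambda>j\<in>?J. Z j \<omega>) (Suc j) * b j (\<lambda>j\<in>{1..}. \<theta> j \<omega>))"
      by (auto simp: fun_eq_iff d_def b_def right_diff_distrib)
    finally have "W (\<lambda>j\<in>{1..}. \<theta> j \<omega>) (\<lambda>j\<in>?J. Z j \<omega>) = X t \<omega> - X s \<omega> - d k"
      unfolding W_def by (rule sums_unique[symmetric])
    then show ?case
      by (simp add: d_def b_def algebra_simps)
  qed
  then have "(\<integral>\<^sup>+\<omega>. G (X t \<omega> - X s \<omega>) \<partial>M)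
    = (\<integral>\<^sup>+\<omega>. F (\<lambda>j\<in>{1..}. \<theta> j \<omega>, (Z (Suc k) \<omega>, \<lambda>j\<in>?J. Z j \<omega>)) \<partial>M)"
    by (intro nn_integral_cong_AE) (auto simp: F_def)
  then show "(\<integral>\<^sup>+\<omega>. G (X t \<omega> - X s \<omega>) \<partial>M) =
    (\<integral>\<^sup>+u. (\<integral>\<^sup>+w. (\<integral>\<^sup>+z. ennreal (std_normal_density z) *
        G ((coeff (Suc k) t (u (Suc k)) - coeff (Suc k) s (u (Suc k))) * z + W u w) \<partial>lborel)
      \<partial>weight_law (Suc k)) \<partial>phase_law)"
    using nn_integral_split_coordinate[OF _ F] by (simp add: F_def b_def)
qed

lemma prob_space_weight_law: "prob_space (weight_law i)"
  by (intro prob_space_distr measurable_restrict)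
    (auto intro: distributed_measurable[OF normal_Z, simplified])

lemma nn_integral_phase_coordinate:
  assumes [measurable]: "g \<in> borel_measurable borel"
  shows "(\<integral>\<^sup>+u. g (u (Suc k)) \<partial>phase_law)
    = (\<integral>\<^sup>+u. g u * indicator {0..2 * pi} u \<partial>lborel) / ennreal (2 * pi)"
proof -
  have [measurable]: "(\<lambda>\<omega>. \<lambda>j\<in>{1..}. \<theta> j \<omega>) \<in> measurable M (PiM {1..} (\<lambda>_. borel))"
    by (intro measurable_restrict measurable_\<theta>) auto
  have [measurable]: "(\<lambda>u. u (Suc k)) \<in> borel_measurable (PiM {1..} (\<lambda>_. borel) :: (nat \<Rightarrow> real) measure)"
    by (intro measurable_component_singleton) auto
  have "(\<integral>\<^sup>+u. g (u (Suc k)) \<partial>phase_law)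
    = (\<integral>\<^sup>+\<omega>. g ((\<lambda>j\<in>{1..}. \<theta> j \<omega>) (Suc k)) \<partial>M)"
    by (rule nn_integral_distr) measurable
  also have "\<dots> = (\<integral>\<^sup>+\<omega>. g (\<theta> (Suc k) \<omega>) \<partial>M)"
    by simp
  also have "\<dots> = (\<integral>\<^sup>+u. g u \<partial>distr M lborel (\<theta> (Suc k)))"
    by (subst nn_integral_distr) auto
  also have "\<dots> = (\<integral>\<^sup>+u. g u * indicator {0..<2 * pi} u \<partial>lborel) / ennreal (2 * pi)"
    by (subst uniform_\<theta>) (simp_all add: nn_integral_uniform_measure)
  \<comment> \<open>Closing the interval changes a null set and matches the form of the sine
    integrals.\<close>
  also have "(\<integral>\<^sup>+u. g u * indicator {0..<2 * pi} u \<partial>lborel) = (\<integral>\<^sup>+u. g u * indicator {0..2 * pi} u \<partial>lborel)"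
    using AE_lborel_singleton[of "2 * pi"]
    by (intro nn_integral_cong_AE) (auto elim!: eventually_mono split: split_indicator)
  finally show ?thesis .
qed

text \<open>Uniformity of the Gaussian bound in \<open>w\<close> eliminates the other weights, whose
  law has mass 1, and with them every phase except the one in the chosen coefficient. What is left
  is an average over one uniform phase.\<close>

lemma increment_le:
  assumes [measurable]: "G \<in> borel_measurable borel" "g \<in> borel_measurable borel"
    and bound: "\<And>a w. (\<integral>\<^sup>+z. ennreal (std_normal_density z) * G (a * z + w) \<partial>lborel) \<le> g a"
  shows "(\<integral>\<^sup>+\<omega>. G (X t \<omega> - X s \<omega>) \<partial>M)
    \<le> (\<integral>\<^sup>+u. g (coeff (Suc k) t u - coeff (Suc k) s u) * indicator {0..2 * pi} u \<partial>lborel) / ennreal (2 * pi)"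
proof -
  obtain W where "(\<integral>\<^sup>+\<omega>. G (X t \<omega> - X s \<omega>) \<partial>M) =
    (\<integral>\<^sup>+u. (\<integral>\<^sup>+w. (\<integral>\<^sup>+z. ennreal (std_normal_density z) *
        G ((coeff (Suc k) t (u (Suc k)) - coeff (Suc k) s (u (Suc k))) * z + W u w) \<partial>lborel) \<partial>weight_law (Suc k)) \<partial>phase_law)"
    by (rule increment_split[OF assms(1), where t = t and s = s and k = k])
  also have "\<dots> \<le> (\<integral>\<^sup>+u. (\<integral>\<^sup>+w. g (coeff (Suc k) t (u (Suc k)) - coeff (Suc k) s (u (Suc k))) \<partial>weight_law (Suc k)) \<partial>phase_law)"
    by (intro nn_integral_mono bound)
  also have "\<dots> = (\<integral>\<^sup>+u. g (coeff (Suc k) t (u (Suc k)) - coeff (Suc k) s (u (Suc k))) \<partial>phase_law)"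
    using prob_space.emeasure_space_1[OF prob_space_weight_law[of "Suc k"]] by simp
  also have "\<dots> = (\<integral>\<^sup>+u. g (coeff (Suc k) t u - coeff (Suc k) s u) * indicator {0..2 * pi} u \<partial>lborel) / ennreal (2 * pi)"
    by (rule nn_integral_phase_coordinate) measurable
  finally show ?thesis .
qed

lemma increment_ge:
  assumes [measurable]: "G \<in> borel_measurable borel" "g \<in> borel_measurable borel"
    and bound: "\<And>a w. g a \<le> (\<integral>\<^sup>+z. ennreal (std_normal_density z) * G (a * z + w) \<partial>lborel)"
  shows "(\<integral>\<^sup>+u. g (coeff (Suc k) t u - coeff (Suc k) s u) * indicator {0..2 * pi} u \<partial>lborel) / ennreal (2 * pi)
    \<le> (\<integral>\<^sup>+\<omega>. G (X t \<omega> - X s \<omega>) \<partial>M)"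
proof -
  obtain W where W: "(\<integral>\<^sup>+\<omega>. G (X t \<omega> - X s \<omega>) \<partial>M) =
    (\<integral>\<^sup>+u. (\<integral>\<^sup>+w. (\<integral>\<^sup>+z. ennreal (std_normal_density z) *
        G ((coeff (Suc k) t (u (Suc k)) - coeff (Suc k) s (u (Suc k))) * z + W u w) \<partial>lborel) \<partial>weight_law (Suc k)) \<partial>phase_law)"
    by (rule increment_split[OF assms(1), where t = t and s = s and k = k])
  have "(\<integral>\<^sup>+u. g (coeff (Suc k) t u - coeff (Suc k) s u) * indicator {0..2 * pi} u \<partial>lborel) / ennreal (2 * pi)
    = (\<integral>\<^sup>+u. g (coeff (Suc k) t (u (Suc k)) - coeff (Suc k) s (u (Suc k))) \<partial>phase_law)"
    by (rule nn_integral_phase_coordinate[symmetric]) measurable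
  also have "\<dots> = (\<integral>\<^sup>+u. (\<integral>\<^sup>+w. g (coeff (Suc k) t (u (Suc k)) - coeff (Suc k) s (u (Suc k))) \<partial>weight_law (Suc k)) \<partial>phase_law)"
    using prob_space.emeasure_space_1[OF prob_space_weight_law[of "Suc k"]] by simp
  also have "\<dots> \<le> (\<integral>\<^sup>+\<omega>. G (X t \<omega> - X s \<omega>) \<partial>M)"
    unfolding W by (intro nn_integral_mono bound)
  finally show ?thesis .
qed

lemma moment_ge:
  assumes st: "s \<noteq> t" "l * \<bar>t - s\<bar> \<le> 1" and h: "0 \<le> h" "H s \<le> h" "H t \<le> h"
  shows "ennreal ((2 / (pi * l))\<^sup>2 / 2 * \<bar>t - s\<bar> powr (2 * h)) \<le> (\<integral>\<^sup>+\<omega>. ennreal (\<bar>X t \<omega> - X s \<omega>\<bar>\<^sup>2) \<partial>M)"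
proof -
  obtain j A \<phi> where j: "j \<ge> 1" and A: "2 / (pi * l) * \<bar>t - s\<bar> powr h \<le> A"
    and coeff: "\<And>u. coeff j t u - coeff j s u = A * sin (u + \<phi>)"
    by (rule weierstrass_coeff_amplitude[OF l st h]) blast
  obtain k where k: "j = Suc k"
    using j by (cases j) auto
  have A0: "0 \<le> 2 / (pi * l) * \<bar>t - s\<bar> powr h"
    using l by simp
  have "(2 / (pi * l))\<^sup>2 * \<bar>t - s\<bar> powr (2 * h) = (2 / (pi * l) * \<bar>t - s\<bar> powr h)\<^sup>2"
    unfolding power_mult_distrib by (simp add: power2_eq_square flip: powr_add)
  also have "\<dots> \<le> A\<^sup>2"
    using A A0 by (rule power_mono)
  finally have A2: "(2 / (pi * l))\<^sup>2 * \<bar>t - s\<bar> powr (2 * h) \<le> A\<^sup>2" .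
  have "(\<integral>\<^sup>+u. ennreal ((coeff (Suc k) t u - coeff (Suc k) s u)\<^sup>2) * indicator {0..2 * pi} u \<partial>lborel) / ennreal (2 * pi)
    \<le> (\<integral>\<^sup>+\<omega>. ennreal ((X t \<omega> - X s \<omega>)\<^sup>2) \<partial>M)"
    by (rule increment_ge[where g = "\<lambda>a. ennreal (a\<^sup>2)"]) (auto simp: nn_integral_gauss_affine_square)
  also have "(\<integral>\<^sup>+u. ennreal ((coeff (Suc k) t u - coeff (Suc k) s u)\<^sup>2) * indicator {0..2 * pi} u \<partial>lborel)
    = ennreal (A\<^sup>2) * (\<integral>\<^sup>+u. ennreal ((sin (u + \<phi>))\<^sup>2) * indicator {0..2 * pi} u \<partial>lborel)"
    using coeff unfolding k
    by (subst nn_integral_cmult[symmetric]) (auto simp: power_mult_distrib ennreal_mult mult.assoc)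
  \<comment> \<open>The mean of \<open>sin\<^sup>2\<close> over a period is \<open>1 / 2\<close>,
    the origin of that factor in the statement.\<close>
  also have "\<dots> / ennreal (2 * pi) = ennreal (A\<^sup>2 / 2)"
    unfolding nn_integral_sin_square by (simp add: divide_ennreal flip: ennreal_mult)
  finally have "ennreal (A\<^sup>2 / 2) \<le> (\<integral>\<^sup>+\<omega>. ennreal (\<bar>X t \<omega> - X s \<omega>\<bar>\<^sup>2) \<partial>M)"
    by simp
  then show ?thesis
    using A2 by (elim order_trans[rotated]) (auto intro!: ennreal_leI)
qed

text \<open>The Gaussian bound gives \<open>r powr (\<eta> - \<gamma>) * A powr - \<eta>\<close>
  times a power of the sine that is integrable because \<open>\<eta> < 1\<close>. Inserting the
  lower bound on \<open>A\<close>, of order \<open>r powr h\<close>, produces the exponent.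
  \<open>D\<close> is chosen before \<open>s\<close>, \<open>t\<close> and \<open>h\<close>.\<close>

lemma kernel_expectation_le:
  assumes \<gamma>: "\<gamma> > 1" and \<eta>: "0 \<le> \<eta>" "\<eta> < 1"
  obtains D where "D \<ge> 0" "\<And>s t h. s \<noteq> t \<Longrightarrow> l * \<bar>t - s\<bar> \<le> 1 \<Longrightarrow> 0 \<le> h \<Longrightarrow> H s \<le> h \<Longrightarrow> H t \<le> h \<Longrightarrow>
    (\<integral>\<^sup>+\<omega>. ennreal (max \<bar>t - s\<bar> \<bar>X t \<omega> - X s \<omega>\<bar> powr - \<gamma>) \<partial>M)
      \<le> ennreal (D * \<bar>t - s\<bar> powr - (\<gamma> - \<eta> + h * \<eta>))"
proof
  define C1 where "C1 = 2 + 2 / (\<gamma> - 1)"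
  define C2 where "C2 = 4 * (2 / pi) powr - \<eta> * (2 / (1 - \<eta>) + 2 * pi)"
  define c where "c = 2 / (pi * l)"
  have C1: "C1 \<ge> 0" and C2: "C2 \<ge> 0" and c: "c > 0"
    using \<gamma> \<eta> l by (auto simp: C1_def C2_def c_def)
  show "C1 * c powr - \<eta> * C2 \<ge> 0"
    using C1 C2 by simp
  fix s t h assume st: "s \<noteq> t" "l * \<bar>t - s\<bar> \<le> 1" and h: "0 \<le> h" "H s \<le> h" "H t \<le> h"
  define r where "r = \<bar>t - s\<bar>"
  have r: "r > 0" using st by (simp add: r_def)
  obtain j A \<phi> where j: "j \<ge> 1" and A: "c * r powr h \<le> A"
    and coeff: "\<And>u. coeff j t u - coeff j s u = A * sin (u + \<phi>)"
    unfolding c_def r_def by (rule weierstrass_coeff_amplitude[OF l st h]) blast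
  obtain k where k: "j = Suc k"
    using j by (cases j) auto
  have cr: "c * r powr h > 0"
    using c r by simp
  then have A0: "A > 0"
    using A by linarith
  \<comment> \<open>The value at \<open>a = 0\<close> is imposed because \<open>0 powr - \<eta> = 0\<close>.\<close>
  define g where "g a = (if a = 0 then \<infinity> else ennreal (C1 * r powr (\<eta> - \<gamma>) * \<bar>a\<bar> powr - \<eta>))" for a :: real
  have [measurable]: "g \<in> borel_measurable borel"
    unfolding g_def by measurable
  have bound: "(\<integral>\<^sup>+z. ennreal (std_normal_density z) * ennreal (max r \<bar>a * z + w\<bar> powr - \<gamma>) \<partial>lborel) \<le> g a" for a w
    using nn_integral_gauss_kernel_le[OF r \<gamma>, of \<eta> a w] \<eta> by (auto simp: g_def C1_def)
  have "(\<integral>\<^sup>+\<omega>. ennreal (max r \<bar>X t \<omega> - X s \<omega>\<bar> powr - \<gamma>) \<partial>M)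
    \<le> (\<integral>\<^sup>+u. g (coeff (Suc k) t u - coeff (Suc k) s u) * indicator {0..2 * pi} u \<partial>lborel) / ennreal (2 * pi)"
    by (rule increment_le[where G = "\<lambda>x. ennreal (max r \<bar>x\<bar> powr - \<gamma>)"]) (auto intro: bound)
  \<comment> \<open>The normalisation \<open>1 / (2 * pi)\<close> is below 1 and is dropped.\<close>
  also have "\<dots> \<le> (\<integral>\<^sup>+u. g (coeff (Suc k) t u - coeff (Suc k) s u) * indicator {0..2 * pi} u \<partial>lborel)"
  proof -
    have "inverse (ennreal (2 * pi)) \<le> 1"
      using pi_gt3 by (simp add: inverse_ennreal field_simps)
    then show ?thesis
      unfolding divide_ennreal_def by (rule mult_left_le) auto
  qed
  also have "\<dots> = (\<integral>\<^sup>+u. ennreal (C1 * r powr (\<eta> - \<gamma>) * A powr - \<eta>) *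
      (ennreal (\<bar>sin (u + \<phi>)\<bar> powr - \<eta>) * indicator {0..2 * pi} u) \<partial>lborel)"
  \<comment> \<open>The zeros of the sine, where \<open>g\<close> is infinite, form a null set of
    phases.\<close>
  proof (rule nn_integral_cong_AE)
    show "AE u in lborel. g (coeff (Suc k) t u - coeff (Suc k) s u) * indicator {0..2 * pi} u =
      ennreal (C1 * r powr (\<eta> - \<gamma>) * A powr - \<eta>) * (ennreal (\<bar>sin (u + \<phi>)\<bar> powr - \<eta>) * indicator {0..2 * pi} u)"
      using AE_sin_shift_nonzero[of \<phi>]
    proof eventually_elim
      case (elim u)
      have "coeff (Suc k) t u - coeff (Suc k) s u = A * sin (u + \<phi>)"
        using coeff k by simp
      then have "g (coeff (Suc k) t u - coeff (Suc k) s u)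
        = ennreal (C1 * r powr (\<eta> - \<gamma>) * (A * \<bar>sin (u + \<phi>)\<bar>) powr - \<eta>)"
        using elim A0 by (simp add: g_def abs_mult)
      also have "(A * \<bar>sin (u + \<phi>)\<bar>) powr - \<eta> = A powr - \<eta> * \<bar>sin (u + \<phi>)\<bar> powr - \<eta>"
        using A0 by (simp add: powr_mult)
      finally show ?case
        using C1 by (simp add: ennreal_mult mult.assoc)
    qed
  qed
  also have "\<dots> = ennreal (C1 * r powr (\<eta> - \<gamma>) * A powr - \<eta>) *
      (\<integral>\<^sup>+u. ennreal (\<bar>sin (u + \<phi>)\<bar> powr - \<eta>) * indicator {0..2 * pi} u \<partial>lborel)"
    by (intro nn_integral_cmult) auto
  also have "\<dots> \<le> ennreal (C1 * r powr (\<eta> - \<gamma>) * A powr - \<eta>) * ennreal C2"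
    unfolding C2_def using \<eta> by (intro mult_left_mono nn_integral_sin_powr_le) auto
  also have "\<dots> = ennreal (C1 * r powr (\<eta> - \<gamma>) * A powr - \<eta> * C2)"
    using C1 C2 by (simp add: ennreal_mult)
  also have "\<dots> \<le> ennreal (C1 * r powr (\<eta> - \<gamma>) * (c * r powr h) powr - \<eta> * C2)"
    using A cr \<eta> C1 C2 by (intro ennreal_leI mult_right_mono mult_left_mono powr_mono2') auto
  also have "C1 * r powr (\<eta> - \<gamma>) * (c * r powr h) powr - \<eta> * C2 = C1 * c powr - \<eta> * C2 * r powr - (\<gamma> - \<eta> + h * \<eta>)"
  proof -
    have "(c * r powr h) powr - \<eta> = c powr - \<eta> * r powr (h * - \<eta>)"
      using c by (simp add: powr_mult powr_powr)
    moreover have "r powr - (\<gamma> - \<eta> + h * \<eta>) = r powr (\<eta> - \<gamma>) * r powr (h * - \<eta>)"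
      by (simp flip: powr_add)
    ultimately show ?thesis by simp
  qed
  finally show "(\<integral>\<^sup>+\<omega>. ennreal (max \<bar>t - s\<bar> \<bar>X t \<omega> - X s \<omega>\<bar> powr - \<gamma>) \<partial>M)
    \<le> ennreal (C1 * c powr - \<eta> * C2 * \<bar>t - s\<bar> powr - (\<gamma> - \<eta> + h * \<eta>))"
    unfolding r_def .
qed

lemma path_continuous:
  assumes Z: "K \<ge> 0" "\<And>j. \<bar>Z (Suc j) \<omega>\<bar> \<le> K * real (Suc j)"
  shows "continuous_on S (\<lambda>t. X t \<omega>)"
proof -
  have "(\<lambda>t. X t \<omega>) \<midarrow>t\<rightarrow> X t \<omega>" for t
  proof -
    \<comment> \<open>\<open>H\<close> exceeds \<open>H t / 2\<close> near \<open>t\<close>, and a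
      quarter leaves a positive exponent strictly below that.\<close>
    define \<alpha> where "\<alpha> = H t / 4"
    have \<alpha>: "0 < \<alpha>" "\<alpha> < H t / 2"
      using H[of t] by (auto simp: \<alpha>_def)
    obtain D where D: "\<And>s u. H t / 2 \<le> H s \<Longrightarrow> H t / 2 \<le> H u \<Longrightarrow> \<bar>u - s\<bar> \<le> 1 \<Longrightarrow> \<bar>X u \<omega> - X s \<omega>\<bar> \<le> D * \<bar>u - s\<bar> powr \<alpha>"
      by (rule path_holder[OF Z less_imp_le[OF \<alpha>(1)] \<alpha>(2)]) blast
    have "(\<lambda>s. D * \<bar>s - t\<bar> powr \<alpha>) \<midarrow>t\<rightarrow> D * \<bar>t - t\<bar> powr \<alpha>"
      using \<alpha> by (intro tendsto_intros) auto
    then have lim: "(\<lambda>s. D * \<bar>s - t\<bar> powr \<alpha>) \<midarrow>t\<rightarrow> 0"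
      by simp
    have "H \<midarrow>t\<rightarrow> H t"
      using continuous_H by (simp add: continuous_on_def)
    then have "\<forall>\<^sub>F s in at t. H t / 2 < H s"
      using H[of t] by (intro order_tendstoD) auto
    moreover have "\<forall>\<^sub>F s in at t. s \<in> ball t 1"
      by (intro eventually_at_in_open') auto
    ultimately have "\<forall>\<^sub>F s in at t. norm (X s \<omega> - X t \<omega>) \<le> D * \<bar>s - t\<bar> powr \<alpha>"
    proof eventually_elim
      case (elim s)
      then show ?case
        using D[of t s] H(1)[of t] by (auto simp: dist_real_def abs_minus_commute)
    qed
    from Lim_null_comparison[OF this lim] show ?thesis
      by (rule LIM_zero_cancel)
  qed
  then have "continuous_on UNIV (\<lambda>t. X t \<omega>)"
    by (simp add: continuous_on_def)
  then show ?thesis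
    by (rule continuous_on_subset) auto
qed

text \<open>By Tonelli the expected energy is a double time integral of at most
  \<open>D * |t - s| powr - \<kappa>\<close>, which is finite for \<open>\<kappa> < 1\<close>. The
  bound on \<open>b - a\<close> puts every pair of times in the range of the scale argument.\<close>

lemma AE_graph_dim_ge:
  assumes ab: "a < b" "l * (b - a) \<le> 1" and h: "0 \<le> h" "\<And>t. t \<in> {a..b} \<Longrightarrow> H t \<le> h"
    and \<gamma>: "1 < \<gamma>" "\<gamma> < 2 - h"
  shows "AE \<omega> in M. ennreal \<gamma> \<le> hausdorff_dim (path_graph X \<omega> {a..b})"
proof -
  \<comment> \<open>\<open>e\<close> is the value of \<open>\<eta>\<close> at which
    \<open>\<kappa> = \<gamma> - \<eta> * (1 - h)\<close> equals 1, and
    \<open>\<gamma> < 2 - h\<close> says that \<open>e < 1\<close>. The midpoint of \<open>e\<close>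
    and 1 then meets both \<open>\<eta> < 1\<close> and \<open>\<kappa> < 1\<close>.\<close>
  define e where "e = (\<gamma> - 1) / (1 - h)"
  define \<eta> where "\<eta> = (e + 1) / 2"
  have "e < 1" "0 \<le> e"
    using \<gamma> by (auto simp: e_def field_simps)
  then have \<eta>: "0 \<le> \<eta>" "\<eta> < 1" "(\<gamma> - 1) / (1 - h) < \<eta>"
    by (auto simp: \<eta>_def simp flip: e_def)
  define \<kappa> where "\<kappa> = \<gamma> - \<eta> + h * \<eta>"
  have "\<gamma> - 1 < \<eta> * (1 - h)"
    using \<eta>(3) \<gamma> by (simp add: field_simps)
  then have \<kappa>: "0 \<le> \<kappa>" "\<kappa> < 1"
    using \<eta> \<gamma> add_nonneg_nonneg[OF _ mult_nonneg_nonneg[OF h(1) \<eta>(1)], of "\<gamma> - \<eta>"]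
    by (auto simp: \<kappa>_def algebra_simps)
  obtain D where D: "D \<ge> 0" "\<And>s t h. s \<noteq> t \<Longrightarrow> l * \<bar>t - s\<bar> \<le> 1 \<Longrightarrow> 0 \<le> h \<Longrightarrow> H s \<le> h \<Longrightarrow> H t \<le> h \<Longrightarrow>
    (\<integral>\<^sup>+\<omega>. ennreal (max \<bar>t - s\<bar> \<bar>X t \<omega> - X s \<omega>\<bar> powr - \<gamma>) \<partial>M)
      \<le> ennreal (D * \<bar>t - s\<bar> powr - (\<gamma> - \<eta> + h * \<eta>))"
    by (rule kernel_expectation_le[OF \<gamma>(1) \<eta>(1,2)]) blast
  define k where "k \<omega> t s = ennreal (max \<bar>t - s\<bar> \<bar>X t \<omega> - X s \<omega>\<bar> powr - \<gamma>) * indicator {a..b} s * indicator {a..b} t" for \<omega> t s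
  interpret L: pair_sigma_finite M "lborel :: real measure" ..
  have k_le: "(\<integral>\<^sup>+\<omega>. k \<omega> t s \<partial>M) \<le> ennreal D * (ennreal (\<bar>s - t\<bar> powr - \<kappa>) * indicator {a..b} s) * indicator {a..b} t" for s t
  proof (cases "s \<in> {a..b} \<and> t \<in> {a..b} \<and> s \<noteq> t")
    case True
    then have "\<bar>t - s\<bar> \<le> b - a" by auto
    then have "l * \<bar>t - s\<bar> \<le> 1"
      using l ab mult_left_mono[of "\<bar>t - s\<bar>" "b - a" l] by linarith
    then show ?thesis
      using True D(1) D(2)[of s t h] h by (simp add: k_def \<kappa>_def abs_minus_commute flip: ennreal_mult)
  qed (auto simp: k_def)
  \<comment> \<open>The expectation is moved inwards past one time integral after the other.\<close>
  have "(\<integral>\<^sup>+\<omega>. (\<integral>\<^sup>+t. (\<integral>\<^sup>+s. k \<omega> t s \<partial>lborel) \<partial>lborel) \<partial>M)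
    = (\<integral>\<^sup>+t. (\<integral>\<^sup>+\<omega>. (\<integral>\<^sup>+s. k \<omega> t s \<partial>lborel) \<partial>M) \<partial>lborel)"
    unfolding k_def by (rule L.Fubini'[symmetric]) measurable
  also have "\<dots> = (\<integral>\<^sup>+t. (\<integral>\<^sup>+s. (\<integral>\<^sup>+\<omega>. k \<omega> t s \<partial>M) \<partial>lborel) \<partial>lborel)"
    unfolding k_def by (intro nn_integral_cong L.Fubini'[symmetric]) measurable
  also have "\<dots> \<le> (\<integral>\<^sup>+t. (\<integral>\<^sup>+s. ennreal D * (ennreal (\<bar>s - t\<bar> powr - \<kappa>) * indicator {a..b} s) * indicator {a..b} t \<partial>lborel) \<partial>lborel)"
    by (intro nn_integral_mono k_le)
  also have "\<dots> = (\<integral>\<^sup>+t. ennreal D * (\<integral>\<^sup>+s. ennreal (\<bar>s - t\<bar> powr - \<kappa>) * indicator {a..b} s \<partial>lborel) * indicator {a..b} t \<partial>lborel)"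
    by (simp add: nn_integral_cmult nn_integral_multc)
  also have "\<dots> \<le> (\<integral>\<^sup>+t. ennreal D * ennreal (2 / (1 - \<kappa>) + (b - a)) * indicator {a..b} t \<partial>lborel)"
    using \<kappa> ab by (intro nn_integral_mono mult_right_mono mult_left_mono nn_integral_abs_powr_le) auto
  also have "\<dots> < \<infinity>"
    using ab by (simp add: nn_integral_cmult_indicator ennreal_mult_less_top)
  finally have "(\<integral>\<^sup>+\<omega>. (\<integral>\<^sup>+t. (\<integral>\<^sup>+s. k \<omega> t s \<partial>lborel) \<partial>lborel) \<partial>M) \<noteq> \<infinity>"
    by simp
  then have "AE \<omega> in M. (\<integral>\<^sup>+t. (\<integral>\<^sup>+s. k \<omega> t s \<partial>lborel) \<partial>lborel) \<noteq> \<infinity>"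
    unfolding k_def by (intro nn_integral_PInf_AE) measurable
  then show ?thesis
    using AE_Z_linear_growth AE_space
  proof eventually_elim
    case (elim \<omega>)
    then obtain K where K: "K \<ge> 0" "\<And>j. \<bar>Z (Suc j) \<omega>\<bar> \<le> K * real (Suc j)" by auto
    have [measurable]: "\<omega> \<in> space M" using elim by simp
    have "(\<integral>\<^sup>+t. (\<integral>\<^sup>+s. k \<omega> t s \<partial>lborel) \<partial>lborel)
      = (\<integral>\<^sup>+t\<in>{a..b}. (\<integral>\<^sup>+s\<in>{a..b}. ennreal (max \<bar>t - s\<bar> \<bar>X t \<omega> - X s \<omega>\<bar> powr - \<gamma>) \<partial>lborel) \<partial>lborel)"
      unfolding k_def by (intro nn_integral_cong nn_integral_multc) measurable
    then show ?case
      unfolding path_graph_def using elim ab \<gamma>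
      by (intro hausdorff_dim_graph_ge_energy path_continuous[OF K]) (auto simp: top.not_eq_extremum)
  qed
qed

section \<open>Deterministic local exponents\<close>

lemma H_near:
  assumes "\<epsilon> > 0"
  obtains \<delta> where "\<delta> > 0" "\<And>t. \<bar>t - t\<^sub>0\<bar> < \<delta> \<Longrightarrow> \<bar>H t - H t\<^sub>0\<bar> < \<epsilon>"
  using continuous_H assms unfolding continuous_on_iff dist_real_def by (metis UNIV_I)

lemma sup_increment_ratio_finite:
  assumes \<alpha>: "0 < \<alpha>" "\<alpha> < H t\<^sub>0"
  shows "(INF \<rho>\<in>{0<..}. sup_increment_ratio M X \<alpha> t\<^sub>0 \<rho>) < \<infinity>"
proof -
  \<comment> \<open>A level strictly between: \<open>H\<close> stays above \<open>h\<close> near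
    \<open>t\<^sub>0\<close>, and \<open>h - \<alpha> > 0\<close> makes the series in
    \<open>moment_le\<close> converge.\<close>
  define h where "h = (\<alpha> + H t\<^sub>0) / 2"
  have h: "\<alpha> < h" "h < H t\<^sub>0" using \<alpha> by (auto simp: h_def)
  obtain \<delta> where \<delta>: "\<delta> > 0" "\<And>t. \<bar>t - t\<^sub>0\<bar> < \<delta> \<Longrightarrow> \<bar>H t - H t\<^sub>0\<bar> < H t\<^sub>0 - h"
    using H_near[of "H t\<^sub>0 - h" t\<^sub>0] h by auto
  obtain D where D: "D \<ge> 0" "\<And>s t. h \<le> H s \<Longrightarrow> h \<le> H t \<Longrightarrow> \<bar>t - s\<bar> \<le> 1 \<Longrightarrow>
    (\<integral>\<^sup>+\<omega>. ennreal (\<bar>X t \<omega> - X s \<omega>\<bar>\<^sup>2) \<partial>M) \<le> ennreal (D * \<bar>t - s\<bar> powr (2 * \<alpha>))"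
    by (rule moment_le[OF less_imp_le[OF \<alpha>(1)] h(1)]) blast
  define \<rho> where "\<rho> = min \<delta> (1 / 2)"
  have \<rho>: "\<rho> > 0" using \<delta> by (simp add: \<rho>_def)
  have "(INF \<rho>\<in>{0<..}. sup_increment_ratio M X \<alpha> t\<^sub>0 \<rho>) \<le> sup_increment_ratio M X \<alpha> t\<^sub>0 \<rho>"
    using \<rho> by (intro INF_lower) auto
  also have "\<dots> \<le> ennreal D"
    unfolding sup_increment_ratio_def
  proof (rule SUP_least, clarify)
    fix s t assume "(s, t) \<in> distinct_pairs (half_line_ball t\<^sub>0 \<rho>)"
    then have st: "s \<noteq> t" "\<bar>s - t\<^sub>0\<bar> < \<rho>" "\<bar>t - t\<^sub>0\<bar> < \<rho>"
      by (auto simp: distinct_pairs_def half_line_ball_def dist_real_def abs_minus_commute)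
    have "\<bar>t - s\<bar> \<le> 1"
      using st unfolding \<rho>_def by linarith
    moreover have "h \<le> H s" "h \<le> H t"
      using st \<delta>(2)[of s] \<delta>(2)[of t] by (auto simp: \<rho>_def)
    ultimately have "increment_ratio M X \<alpha> s t \<le> ennreal (D * \<bar>t - s\<bar> powr (2 * \<alpha>)) / ennreal (\<bar>t - s\<bar> powr (2 * \<alpha>))"
      unfolding increment_ratio_def by (intro divide_right_mono_ennreal D)
    also have "\<dots> = ennreal D"
      using st D by (simp add: divide_ennreal)
    finally show "increment_ratio M X \<alpha> s t \<le> ennreal D" .
  qed
  finally show ?thesis
    by (rule le_less_trans) simp
qed

lemma inf_increment_ratio_infinite:
  assumes \<alpha>: "H t\<^sub>0 < \<alpha>"
  shows "(SUP \<rho>\<in>{0<..}. inf_increment_ratio M X \<alpha> t\<^sub>0 \<rho>) = \<infinity>"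
proof -
  define h where "h = (\<alpha> + H t\<^sub>0) / 2"
  have h: "H t\<^sub>0 < h" "h < \<alpha>" using \<alpha> by (auto simp: h_def)
  have h0: "0 \<le> h" using h H(1)[of t\<^sub>0] by simp
  obtain \<delta> where \<delta>: "\<delta> > 0" "\<And>t. \<bar>t - t\<^sub>0\<bar> < \<delta> \<Longrightarrow> \<bar>H t - H t\<^sub>0\<bar> < h - H t\<^sub>0"
    using H_near[of "h - H t\<^sub>0" t\<^sub>0] h by auto
  define c where "c = (2 / (pi * l))\<^sup>2 / 2"
  have c: "c > 0" using l by (simp add: c_def)
  define m where "m = 2 * (\<alpha> - h)"
  have m: "m > 0" using h by (simp add: m_def)
  have "ennreal (real n) \<le> (SUP \<rho>\<in>{0<..}. inf_increment_ratio M X \<alpha> t\<^sub>0 \<rho>)" for n :: nat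
  proof -
    \<comment> \<open>The solution of \<open>c * y powr - m = n + 1\<close>. Radius
      \<open>y / 2\<close> confines the distances to at most \<open>y\<close>, so the ratio, at
      least \<open>c * r powr - m\<close>, exceeds \<open>n\<close>; the entry
      \<open>1 / (2 * l)\<close> in \<open>\<rho>\<close> serves \<open>moment_ge\<close>.\<close>
    define y where "y = (c / (real n + 1)) powr (1 / m)"
    have y: "y > 0" using c by (simp add: y_def)
    have ym: "y powr - m = (real n + 1) / c"
      using c m by (simp add: y_def powr_powr powr_minus)
    define \<rho> where "\<rho> = min (min \<delta> (1 / (2 * l))) (y / 2)"
    have \<rho>: "\<rho> > 0" using \<delta> l y by (simp add: \<rho>_def)
    have "ennreal (real n) \<le> inf_increment_ratio M X \<alpha> t\<^sub>0 \<rho>"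
      unfolding inf_increment_ratio_def
    proof (rule INF_greatest, clarify)
      fix s t assume "(s, t) \<in> distinct_pairs (half_line_ball t\<^sub>0 \<rho>)"
      then have st: "s \<noteq> t" "\<bar>s - t\<^sub>0\<bar> < \<rho>" "\<bar>t - t\<^sub>0\<bar> < \<rho>"
        by (auto simp: distinct_pairs_def half_line_ball_def dist_real_def abs_minus_commute)
      define r where "r = \<bar>t - s\<bar>"
      have r: "0 < r" "r \<le> 2 * \<rho>" using st by (auto simp: r_def)
      have Hst: "H s \<le> h" "H t \<le> h"
        using \<delta>(2)[of s] \<delta>(2)[of t] st by (auto simp: \<rho>_def)
      have "l * r \<le> l * (1 / l)"
        using r l by (intro mult_left_mono) (auto simp: \<rho>_def)
      then have lr: "l * \<bar>t - s\<bar> \<le> 1"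
        using l by (simp add: r_def)
      have "r \<le> y" using r by (simp add: \<rho>_def)
      then have "y powr - m \<le> r powr - m"
        using r m by (intro powr_mono2') auto
      then have "real n + 1 \<le> c * r powr - m"
        using c unfolding ym by (simp add: field_simps)
      then have "ennreal (real n) \<le> ennreal (c * r powr - m)"
        by (intro ennreal_leI) simp
      also have "c * r powr - m = c * r powr (2 * h) / r powr (2 * \<alpha>)"
        using powr_diff[of r "2 * h" "2 * \<alpha>"] by (simp add: m_def right_diff_distrib)
      also have "ennreal \<dots> = ennreal (c * r powr (2 * h)) / ennreal (r powr (2 * \<alpha>))"
        using r c by (simp add: divide_ennreal)
      also have "\<dots> \<le> increment_ratio M X \<alpha> s t"
        unfolding increment_ratio_def r_def c_def
        by (intro divide_right_mono_ennreal moment_ge st lr h0 Hst)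
      finally show "ennreal (real n) \<le> increment_ratio M X \<alpha> s t" .
    qed
    also have "\<dots> \<le> (SUP \<rho>\<in>{0<..}. inf_increment_ratio M X \<alpha> t\<^sub>0 \<rho>)"
      using \<rho> by (intro SUP_upper) auto
    finally show ?thesis .
  qed
  then have "\<not> (SUP \<rho>\<in>{0<..}. inf_increment_ratio M X \<alpha> t\<^sub>0 \<rho>) < \<infinity>"
    by (metis ennreal_Ex_less_of_nat ennreal_of_nat_eq_real_of_nat infinity_ennreal_def not_less)
  then show ?thesis
    unfolding infinity_ennreal_def by (rule contrapos_np) (simp only: top.not_eq_extremum)
qed

text \<open>Both exponents switch at \<open>H t\<^sub>0\<close>: below it the upper limit is finite,
  above it the lower limit is infinite, and \<open>inf_increment_ratio_le_sup\<close> supplies the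
  two negative statements.\<close>

lemma local_exponents:
  assumes t0: "t\<^sub>0 \<ge> 0"
  shows "local_holder_exponent M X t\<^sub>0 = ennreal (H t\<^sub>0)"
    and "local_sub_exponent M X t\<^sub>0 = ennreal (H t\<^sub>0)"
proof -
  note Lim_eq = tendsto_Lim[OF trivial_limit_at_right_real tendsto_sup_increment_ratio]
    tendsto_Lim[OF trivial_limit_at_right_real tendsto_inf_increment_ratio]
  have inf_top: "(SUP \<rho>\<in>{0<..}. inf_increment_ratio M X \<alpha> t\<^sub>0 \<rho>) = \<infinity>"
    and sup_top: "\<not> (INF \<rho>\<in>{0<..}. sup_increment_ratio M X \<alpha> t\<^sub>0 \<rho>) < \<infinity>" if "H t\<^sub>0 < \<alpha>" for \<alpha>
    using inf_increment_ratio_infinite[OF that] inf_increment_ratio_le_sup[OF t0, of M X \<alpha>]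
    by (simp_all only: not_less)
  have sup_fin: "(INF \<rho>\<in>{0<..}. sup_increment_ratio M X \<alpha> t\<^sub>0 \<rho>) < \<infinity>"
    and inf_fin: "(SUP \<rho>\<in>{0<..}. inf_increment_ratio M X \<alpha> t\<^sub>0 \<rho>) \<noteq> \<infinity>" if "0 < \<alpha>" "\<alpha> < H t\<^sub>0" for \<alpha>
    using sup_increment_ratio_finite[OF that] inf_increment_ratio_le_sup[OF t0, of M X \<alpha>]
    by (auto simp only: dest: le_less_trans)
  show "local_holder_exponent M X t\<^sub>0 = ennreal (H t\<^sub>0)"
    unfolding local_holder_exponent_def Lim_eq by (intro Sup_ennreal_threshold H sup_fin sup_top)
  show "local_sub_exponent M X t\<^sub>0 = ennreal (H t\<^sub>0)"
    unfolding local_sub_exponent_def Lim_eq by (intro Inf_ennreal_threshold H inf_fin inf_top)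
qed

section \<open>Almost sure local dimensions at all times\<close>

text \<open>The null set in \<open>AE_graph_dim_ge\<close> depends on the interval and on both
  exponents, so these are restricted to rationals. The upper bounds and continuity hold
  simultaneously at all times on the event of linear growth.\<close>

lemma AE_local_dimensions:
  "AE \<omega> in M. \<forall>t\<^sub>0\<ge>0.
     ((\<lambda>\<rho>. hausdorff_dim (path_graph X \<omega> (half_line_ball t\<^sub>0 \<rho>))) \<longlongrightarrow> ennreal (2 - H t\<^sub>0)) (at_right 0) \<and>
     ((\<lambda>\<rho>. hausdorff_dim (path_range X \<omega> (half_line_ball t\<^sub>0 \<rho>))) \<longlongrightarrow> 1) (at_right 0)"
proof -
  have "AE \<omega> in M. \<forall>a b h \<gamma> :: rat. of_rat a < (of_rat b :: real) \<and> l * (of_rat b - of_rat a) \<le> 1 \<and> 0 \<le> (of_rat h :: real) \<and>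
      (\<forall>t\<in>{of_rat a..of_rat b}. H t \<le> of_rat h) \<and> 1 < (of_rat \<gamma> :: real) \<and> of_rat \<gamma> < 2 - (of_rat h :: real) \<longrightarrow>
      ennreal (of_rat \<gamma>) \<le> hausdorff_dim (path_graph X \<omega> {of_rat a..of_rat b})"
    unfolding AE_all_countable
  proof (intro allI AE_impI)
    fix a b h \<gamma> :: rat
    assume *: "of_rat a < (of_rat b :: real) \<and> l * (of_rat b - of_rat a) \<le> 1 \<and> 0 \<le> (of_rat h :: real) \<and>
      (\<forall>t\<in>{of_rat a..of_rat b}. H t \<le> of_rat h) \<and> 1 < (of_rat \<gamma> :: real) \<and> of_rat \<gamma> < 2 - (of_rat h :: real)"
    then show "AE \<omega> in M. ennreal (of_rat \<gamma>) \<le> hausdorff_dim (path_graph X \<omega> {of_rat a..of_rat b})"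
      by (intro AE_graph_dim_ge[where h = "of_rat h"]) auto
  qed
  then show ?thesis
    using AE_Z_linear_growth
  proof eventually_elim
    case (elim \<omega>)
    obtain K where K: "K \<ge> 0" "\<And>j. \<bar>Z (Suc j) \<omega>\<bar> \<le> K * real (Suc j)"
      using elim(2) by auto
    have lower: "\<exists>a b. a < b \<and> {a..b} \<subseteq> half_line_ball t\<^sub>0 \<rho> \<and> ennreal \<gamma> \<le> hausdorff_dim (path_graph X \<omega> {a..b})"
      if t0: "t\<^sub>0 \<ge> 0" and \<rho>: "\<rho> > 0" and \<gamma>: "1 < \<gamma>" "\<gamma> < 2 - H t\<^sub>0" for t\<^sub>0 \<rho> \<gamma> :: real
    proof -
      obtain \<gamma>' :: rat where \<gamma>': "\<gamma> < of_rat \<gamma>'" "of_rat \<gamma>' < 2 - H t\<^sub>0"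
        using of_rat_dense[OF \<gamma>(2)] by blast
      then have "H t\<^sub>0 < 2 - of_rat \<gamma>'" by simp
      then obtain h :: rat where h: "H t\<^sub>0 < of_rat h" "of_rat h < 2 - (of_rat \<gamma>' :: real)"
        using of_rat_dense by blast
      obtain \<delta> where \<delta>: "\<delta> > 0" "\<And>t. \<bar>t - t\<^sub>0\<bar> < \<delta> \<Longrightarrow> \<bar>H t - H t\<^sub>0\<bar> < of_rat h - H t\<^sub>0"
        using H_near[of "of_rat h - H t\<^sub>0" t\<^sub>0] h by auto
      \<comment> \<open>The rational interval is placed to the right of \<open>t\<^sub>0\<close>,
        which keeps it in the half-line also at 0. The entries of the minimum give inclusion in the
        ball, the bound on \<open>H\<close>, and the length condition.\<close>
      define e where "e = min (min \<rho> \<delta>) (1 / l)"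
      have e: "e > 0" using \<rho> \<delta> l by (simp add: e_def)
      then obtain a :: rat where a: "t\<^sub>0 < of_rat a" "of_rat a < t\<^sub>0 + e"
        using of_rat_dense[of t\<^sub>0 "t\<^sub>0 + e"] by auto
      then obtain b :: rat where b: "of_rat a < (of_rat b :: real)" "of_rat b < t\<^sub>0 + e"
        using of_rat_dense[of "of_rat a" "t\<^sub>0 + e"] by auto
      have "(of_rat b - of_rat a :: real) \<le> 1 / l"
        using a b by (auto simp: e_def)
      then have "l * (of_rat b - of_rat a) \<le> 1"
        using l by (simp add: field_simps)
      moreover have "H t \<le> of_rat h" if "t \<in> {of_rat a..of_rat b}" for t
      proof -
        have "\<bar>t - t\<^sub>0\<bar> < \<delta>"
          using that a b by (auto simp: e_def)
        then show ?thesis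
          using \<delta>(2)[of t] by simp
      qed
      moreover have "0 \<le> (of_rat h :: real)"
        using h(1) H(1)[of t\<^sub>0] by linarith
      moreover have "1 < (of_rat \<gamma>' :: real)"
        using \<gamma> \<gamma>' by linarith
      ultimately have "ennreal (of_rat \<gamma>') \<le> hausdorff_dim (path_graph X \<omega> {of_rat a..of_rat b})"
        using b(1) h(2) by (intro elim(1)[rule_format, where h = h]) (simp del: of_rat_less_1_iff one_less_of_rat_iff)
      then have "ennreal \<gamma> \<le> hausdorff_dim (path_graph X \<omega> {of_rat a..of_rat b})"
        using \<gamma>' by (elim order_trans[rotated]) (auto intro!: ennreal_leI)
      moreover have "{of_rat a..of_rat b} \<subseteq> half_line_ball t\<^sub>0 \<rho>"
        using a b t0 by (auto simp: half_line_ball_def dist_real_def e_def simp del: zero_le_of_rat_iff)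
      ultimately show ?thesis
        using b by blast
    qed
    have upper: "\<exists>\<rho>\<^sub>0>0. \<forall>\<rho>\<in>{0<..<\<rho>\<^sub>0}. hausdorff_dim (path_graph X \<omega> (half_line_ball t\<^sub>0 \<rho>)) \<le> ennreal (2 - \<alpha>)
        \<and> hausdorff_dim (path_range X \<omega> (half_line_ball t\<^sub>0 \<rho>)) \<le> 1"
      if \<alpha>: "0 < \<alpha>" "\<alpha> < H t\<^sub>0" for t\<^sub>0 \<alpha> :: real
    proof -
      define h where "h = (\<alpha> + H t\<^sub>0) / 2"
      have h: "\<alpha> < h" "h < H t\<^sub>0" using \<alpha> by (auto simp: h_def)
      obtain \<delta> where \<delta>: "\<delta> > 0" "\<And>t. \<bar>t - t\<^sub>0\<bar> < \<delta> \<Longrightarrow> \<bar>H t - H t\<^sub>0\<bar> < H t\<^sub>0 - h"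
        using H_near[of "H t\<^sub>0 - h" t\<^sub>0] h by auto
      obtain D where D: "D \<ge> 0" "\<And>s t. h \<le> H s \<Longrightarrow> h \<le> H t \<Longrightarrow> \<bar>t - s\<bar> \<le> 1 \<Longrightarrow> \<bar>X t \<omega> - X s \<omega>\<bar> \<le> D * \<bar>t - s\<bar> powr \<alpha>"
        by (rule path_holder[OF K less_imp_le[OF \<alpha>(1)] h(1)]) blast
      define \<rho>\<^sub>0 where "\<rho>\<^sub>0 = min \<delta> (1 / 2)"
      have "\<rho>\<^sub>0 > 0" using \<delta> by (simp add: \<rho>\<^sub>0_def)
      moreover have "hausdorff_dim (path_graph X \<omega> (half_line_ball t\<^sub>0 \<rho>)) \<le> ennreal (2 - \<alpha>)
        \<and> hausdorff_dim (path_range X \<omega> (half_line_ball t\<^sub>0 \<rho>)) \<le> 1" if \<rho>: "\<rho> \<in> {0<..<\<rho>\<^sub>0}" for \<rho>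
      proof -
        let ?I = "{t\<^sub>0 - \<rho>..t\<^sub>0 + \<rho>}"
        have sub: "half_line_ball t\<^sub>0 \<rho> \<subseteq> ?I"
          by (auto simp: half_line_ball_def dist_real_def)
        have hI: "h \<le> H t" if "t \<in> ?I" for t
        proof -
          have "\<bar>t - t\<^sub>0\<bar> < \<delta>"
            using that \<rho> by (auto simp: \<rho>\<^sub>0_def)
          then show ?thesis
            using \<delta>(2)[of t] by linarith
        qed
        have "hausdorff_dim (path_graph X \<omega> (half_line_ball t\<^sub>0 \<rho>)) \<le> hausdorff_dim {(t, X t \<omega>) |t. t \<in> ?I}"
          unfolding path_graph_def using sub by (intro hausdorff_dim_mono) auto
        also have "\<dots> \<le> ennreal (2 - \<alpha>)"
          using \<rho> \<alpha> H(2)[of t\<^sub>0] D(1) hI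
          by (intro hausdorff_dim_graph_le[where C = D] D(2)) (auto simp: \<rho>\<^sub>0_def)
        finally have graph: "hausdorff_dim (path_graph X \<omega> (half_line_ball t\<^sub>0 \<rho>)) \<le> ennreal (2 - \<alpha>)" .
        have "compact ((\<lambda>t. X t \<omega>) ` ?I)"
          by (intro compact_continuous_image path_continuous[OF K]) auto
        then have "bounded (path_range X \<omega> (half_line_ball t\<^sub>0 \<rho>))"
          unfolding path_range_def using sub by (elim bounded_subset[OF compact_imp_bounded]) auto
        then show ?thesis
          using graph by (auto intro: hausdorff_dim_real_le_1)
      qed
      ultimately show ?thesis by blast
    qed
    have range_lower: "1 \<le> hausdorff_dim (path_range X \<omega> (half_line_ball t\<^sub>0 \<rho>))"
      if t0: "t\<^sub>0 \<ge> 0" and \<rho>: "\<rho> > 0" for t\<^sub>0 \<rho> :: real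
    proof -
      \<comment> \<open>The midpoint of 1 and \<open>2 - H t\<^sub>0\<close>.\<close>
      define \<gamma> where "\<gamma> = (3 - H t\<^sub>0) / 2"
      have \<gamma>: "1 < \<gamma>" "\<gamma> < 2 - H t\<^sub>0"
        using H(2)[of t\<^sub>0] by (auto simp: \<gamma>_def)
      obtain a b where ab: "a < b" "{a..b} \<subseteq> half_line_ball t\<^sub>0 \<rho>"
        "ennreal \<gamma> \<le> hausdorff_dim (path_graph X \<omega> {a..b})"
        using lower[OF t0 \<rho> \<gamma>] by blast
      have "\<exists>s\<in>{a..b}. \<exists>t\<in>{a..b}. X s \<omega> < X t \<omega>"
      proof (rule ccontr)
        assume "\<not> ?thesis"
        then have "X s \<omega> = X t \<omega>" if "s \<in> {a..b}" "t \<in> {a..b}" for s t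
          using that by (meson linorder_neqE_linordered_idom)
        then have const: "\<bar>X t \<omega> - X s \<omega>\<bar> \<le> 0 * \<bar>t - s\<bar> powr 1" if "s \<in> {a..b}" "t \<in> {a..b}" for s t
          using that by (metis abs_zero diff_self mult_zero_left order_refl)
        \<comment> \<open>A constant path is Lipschitz with constant 0, so its graph has dimension
          at most 1, below \<open>\<gamma>\<close>.\<close>
        have "hausdorff_dim (path_graph X \<omega> {a..b}) \<le> ennreal (2 - 1)"
          unfolding path_graph_def
          by (rule hausdorff_dim_graph_le[OF less_imp_le[OF ab(1)] _ _ _ const]) auto
        with ab(3) have "ennreal \<gamma> \<le> ennreal (2 - 1)"
          by (rule order_trans)
        then show False
          using \<gamma> by (subst (asm) ennreal_le_iff) auto
      qed
      then obtain s t where st: "s \<in> {a..b}" "t \<in> {a..b}" "X s \<omega> < X t \<omega>" by blast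
      have "connected ((\<lambda>t. X t \<omega>) ` {a..b})"
        by (intro connected_continuous_image path_continuous[OF K]) auto
      then have "{X s \<omega>..X t \<omega>} \<subseteq> (\<lambda>t. X t \<omega>) ` {a..b}"
        using st by (intro connected_contains_Icc) auto
      also have "\<dots> \<subseteq> path_range X \<omega> (half_line_ball t\<^sub>0 \<rho>)"
        using ab by (auto simp: path_range_def)
      finally show ?thesis
        using hausdorff_dim_interval_ge_1[OF st(3)] hausdorff_dim_mono order_trans by blast
    qed
    show ?case
    proof (intro allI impI conjI)
      fix t\<^sub>0 :: real assume t0: "t\<^sub>0 \<ge> 0"
      show "((\<lambda>\<rho>. hausdorff_dim (path_graph X \<omega> (half_line_ball t\<^sub>0 \<rho>))) \<longlongrightarrow> ennreal (2 - H t\<^sub>0)) (at_right 0)"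
      proof (rule order_tendstoI)
        fix x assume "x < ennreal (2 - H t\<^sub>0)"
        moreover have "1 < ennreal (2 - H t\<^sub>0)"
          using H(2)[of t\<^sub>0] by simp
        \<comment> \<open>The maximum with 1 is taken because the energy method works for exponents
          above 1.\<close>
        ultimately obtain y where y: "max x 1 < y" "y < ennreal (2 - H t\<^sub>0)"
          using dense[of "max x 1" "ennreal (2 - H t\<^sub>0)"] by auto
        then obtain \<gamma> where \<gamma>: "y = ennreal \<gamma>" "\<gamma> \<ge> 0"
          by (cases y) auto
        have \<gamma>': "1 < \<gamma>" "\<gamma> < 2 - H t\<^sub>0"
          using y \<gamma> by (auto simp: ennreal_less_iff)
        have "x < hausdorff_dim (path_graph X \<omega> (half_line_ball t\<^sub>0 \<rho>))" if \<rho>: "\<rho> > 0" for \<rho>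
        proof -
          obtain a b where ab: "{a..b} \<subseteq> half_line_ball t\<^sub>0 \<rho>" "y \<le> hausdorff_dim (path_graph X \<omega> {a..b})"
            using lower[OF t0 \<rho> \<gamma>'] \<gamma> by blast
          then have "path_graph X \<omega> {a..b} \<subseteq> path_graph X \<omega> (half_line_ball t\<^sub>0 \<rho>)"
            by (auto simp: path_graph_def)
          then show ?thesis
            using ab y hausdorff_dim_mono by (meson less_le_trans max.strict_boundedE)
        qed
        then show "\<forall>\<^sub>F \<rho> in at_right 0. x < hausdorff_dim (path_graph X \<omega> (half_line_ball t\<^sub>0 \<rho>))"
          by (intro eventually_at_rightI[of 0 1]) auto
      next
        fix x assume "ennreal (2 - H t\<^sub>0) < x"
        then obtain y where y: "ennreal (2 - H t\<^sub>0) < y" "y < x"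
          using dense by blast
        then obtain \<gamma> where \<gamma>: "y = ennreal \<gamma>" "\<gamma> \<ge> 0"
          by (cases y) auto
        have \<gamma>': "2 - H t\<^sub>0 < \<gamma>"
          using y \<gamma> H(2)[of t\<^sub>0] by (auto simp: ennreal_less_iff)
        \<comment> \<open>\<open>2 - \<gamma>\<close> may be negative;
          \<open>H t\<^sub>0 / 2\<close> keeps the Hoelder exponent positive without losing
          \<open>2 - \<alpha> \<le> \<gamma>\<close>.\<close>
        define \<alpha> where "\<alpha> = max (2 - \<gamma>) (H t\<^sub>0 / 2)"
        have \<alpha>: "0 < \<alpha>" "\<alpha> < H t\<^sub>0" "2 - \<alpha> \<le> \<gamma>"
          using \<gamma>' H(1)[of t\<^sub>0] by (auto simp: \<alpha>_def)
        then have "ennreal (2 - \<alpha>) < x"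
          using y \<gamma> by (auto intro: le_less_trans[OF ennreal_leI])
        then show "\<forall>\<^sub>F \<rho> in at_right 0. hausdorff_dim (path_graph X \<omega> (half_line_ball t\<^sub>0 \<rho>)) < x"
          using upper[OF \<alpha>(1,2)] by (auto intro: eventually_at_rightI le_less_trans)
      qed
      have "\<forall>\<^sub>F \<rho> in at_right 0. hausdorff_dim (path_range X \<omega> (half_line_ball t\<^sub>0 \<rho>)) = 1"
      proof -
        have "0 < H t\<^sub>0 / 2" "H t\<^sub>0 / 2 < H t\<^sub>0"
          using H(1)[of t\<^sub>0] by auto
        from upper[OF this] show ?thesis
          using range_lower[OF t0] by (auto intro!: eventually_at_rightI antisym)
      qed
      then show "((\<lambda>\<rho>. hausdorff_dim (path_range X \<omega> (half_line_ball t\<^sub>0 \<rho>))) \<longlongrightarrow> 1) (at_right 0)"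
        by (rule tendsto_eventually)
    qed
  qed
qed

end

section \<open>Transfer from the whole line to the half-line\<close>

theorem corollary3p10:
  fixes M :: "'a measure"
    and Z \<theta> :: "nat \<Rightarrow> 'a \<Rightarrow> real"
    and H :: "real \<Rightarrow> real"
    and \<beta> l :: real
    and X :: "real \<Rightarrow> 'a \<Rightarrow> real"
  assumes "prob_space M"
    and "\<beta> > 0"
    and "\<And>t. t \<ge> 0 \<Longrightarrow> 0 < H t \<and> H t < 1"
    and "holder_continuous_on \<beta> {0..} H"
    and "\<And>t. t \<ge> 0 \<Longrightarrow> H t < \<beta>"
    and "l \<ge> 2"
    and "prob_space.indep_vars M (\<lambda>_. borel) Z {1..}"
    and "\<And>j. j \<ge> 1 \<Longrightarrow> distributed M lborel (Z j) std_normal_density"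
    and "\<And>j. j \<ge> 1 \<Longrightarrow> \<theta> j \<in> borel_measurable M"
    and "\<And>j. j \<ge> 1 \<Longrightarrow> distr M lborel (\<theta> j) = uniform_measure lborel {0..<2 * pi}"
    and "prob_space.indep_var M
           (PiM {1..} (\<lambda>_. borel)) (\<lambda>\<omega>. \<lambda>j\<in>{1..}. \<theta> j \<omega>)
           (PiM {1..} (\<lambda>_. borel)) (\<lambda>\<omega>. \<lambda>j\<in>{1..}. Z j \<omega>)"
    and "X = weierstrass_process l H Z \<theta>"
  shows "(\<forall>t\<^sub>0\<ge>0. local_holder_exponent M X t\<^sub>0 = ennreal (H t\<^sub>0) \<and>
                   local_sub_exponent M X t\<^sub>0 = ennreal (H t\<^sub>0)) \<and>
         (AE \<omega> in M. \<forall>t\<^sub>0\<ge>0.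
            ((\<lambda>\<rho>. hausdorff_dim (path_graph X \<omega> (half_line_ball t\<^sub>0 \<rho>)))
               \<longlongrightarrow> ennreal (2 - H t\<^sub>0)) (at_right 0) \<and>
            ((\<lambda>\<rho>. hausdorff_dim (path_range X \<omega> (half_line_ball t\<^sub>0 \<rho>)))
               \<longlongrightarrow> 1) (at_right 0))"
proof -
  obtain C where C: "\<And>s t. s \<ge> 0 \<Longrightarrow> t \<ge> 0 \<Longrightarrow> dist (H s) (H t) \<le> C * dist s t powr \<beta>"
    using assms(4) unfolding holder_continuous_on_def by auto
  \<comment> \<open>Constant extension to negative times. Since \<open>max 0\<close> is 1-Lipschitz
    the Hoelder condition survives; its constant carries no sign by definition, hence
    \<open>max 0 C\<close> below.\<close>
  define H' where "H' t = H (max 0 t)" for t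
  have H'_eq: "H' t = H t" if "t \<ge> 0" for t
    using that by (simp add: H'_def)
  have holder: "\<bar>H' t - H' s\<bar> \<le> max 0 C * \<bar>t - s\<bar> powr \<beta>" for s t
  proof -
    have "\<bar>H' t - H' s\<bar> \<le> C * \<bar>max 0 t - max 0 s\<bar> powr \<beta>"
      using C[of "max 0 t" "max 0 s"] by (simp add: H'_def dist_real_def)
    also have "\<dots> \<le> max 0 C * \<bar>t - s\<bar> powr \<beta>"
      using assms(2) by (intro mult_mono powr_mono2) auto
    finally show ?thesis .
  qed
  interpret prob_space M by fact
  interpret W: gaussian_weierstrass M Z \<theta> H' l \<beta> "max 0 C"
    using assms holder by unfold_locales (auto simp: H'_def)
  define X' where "X' = weierstrass_process l H' Z \<theta>"
  \<comment> \<open>The exponents, graphs and ranges in question involve only times in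
    \<open>half_line_ball\<close>, where both processes agree.\<close>
  have X'_eq: "X t = X' t" if "t \<ge> 0" for t
    using that by (simp add: assms(12) X'_def weierstrass_process_def H'_eq fun_eq_iff)
  have ratio_eq: "increment_ratio M X \<alpha> s t = increment_ratio M X' \<alpha> s t"
    if "(s, t) \<in> distinct_pairs (half_line_ball t\<^sub>0 \<rho>)" for \<alpha> s t t\<^sub>0 \<rho>
    using that by (auto simp: increment_ratio_def X'_eq distinct_pairs_def half_line_ball_def)
  have ratios: "sup_increment_ratio M X = sup_increment_ratio M X'" "inf_increment_ratio M X = inf_increment_ratio M X'"
    unfolding sup_increment_ratio_def inf_increment_ratio_def fun_eq_iff
    using ratio_eq by (auto intro!: SUP_cong INF_cong)
  have exponents: "local_holder_exponent M X = local_holder_exponent M X'" "local_sub_exponent M X = local_sub_exponent M X'"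
    unfolding local_holder_exponent_def[abs_def] local_sub_exponent_def[abs_def] ratios by simp_all
  have paths: "path_graph X \<omega> (half_line_ball t\<^sub>0 \<rho>) = path_graph X' \<omega> (half_line_ball t\<^sub>0 \<rho>)"
    "path_range X \<omega> (half_line_ball t\<^sub>0 \<rho>) = path_range X' \<omega> (half_line_ball t\<^sub>0 \<rho>)" for \<omega> t\<^sub>0 \<rho>
    unfolding path_graph_def path_range_def using X'_eq
    by (auto simp: half_line_ball_def intro!: Collect_cong ex_cong1)
  show ?thesis
    using W.local_exponents W.AE_local_dimensions
    unfolding exponents paths X'_def[symmetric] by (auto simp: H'_eq elim!: eventually_mono)
qed

end
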